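(* Let $\mathbf{k}$ be a commutative ring, $\delta\in\mathbf{k}$, and $B=B^{\mathbf{k},\delta}$ the Brauer category. The pair $(B^+,B^-)$ gives a Morita equivalence between $B$ and $\mathbb{S}$ if and only if $\delta$ is non-singular.
   Context: **Brauer diagrams and category.** For $p,q\ge0$, a $(p,q)$-Brauer diagram is a partition of $[p]^+\sqcup[q]^-=\{1^+,\dots,p^+\}\sqcup\{1^-,\dots,q^-\}$ into unordered pairs ($i^+$ top points, $i^-$ bottom points); $\mathbb{B}(p,q)$ is their set. Upward: no pair of two top points; downward: no pair of two bottom points; level: both; monotone: $(i-k)(j-l)>0$ for any two distinct pairs $\{i^+,j^-\},\{k^+,l^-\}$. $\mathbb{B}^+,\mathbb{B}^-,\mathbb{B}^0$: upward, downward, level; $\mathbb{B}^{\pm,m}$: monotone ones. $\overline f$: exchange $i^\pm\leftrightarrow i^\mp$. $p\preceq q$ iff $p\le q$ and $q-p$ even. $B$ has objects the non-negative integers, $B(p,q)$ free on $\mathbb{B}(p,q)$, $f\circ g=\delta^{l(f,g)}f\hat\circ g$ where $g$ is placed on top of $f$, $l(f,g)$ is the number of closed loops and $f\hat\circ g$ the diagram after deleting loops. $B^\pm(p,q)$: span of $\mathbb{B}^\pm(p,q)$. $\mathbb{S}$: wide subcategory of $B$ spanned by level diagrams, $\mathbb{S}_p=\mathbb{S}(p,p)=\mathbf{k}[\mathfrak{S}_p]$, $\mathbb{S}(p,q)=0$ for $p\ne q$. **Morita equivalence.** $B^+$ is a left $B$-module: $g\in B(q,q')$ acts on $f\in B^+(p,q)$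 by the projection of $g\circ f$ to $B^+(p,q')$ killing non-upward diagrams. $B^-$ is a right $B$-module: $f\in B^-(q,s)$ acted on by $g\in B(p,q)$ is the projection of $f\circ g$ to $B^-(p,s)$ killing non-downward diagrams. "The pair $(B^+,B^-)$ gives a Morita equivalence between $B$ and $\mathbb{S}$" means: $B^+\otimes_{\mathbb{S}}B^-\cong B$ as $B$-bimodules, where $(B^+\otimes_{\mathbb{S}}B^-)(p,q)=\bigoplus_sB^+(s,q)\otimes_{\mathbb{S}_s}B^-(p,s)$ with the left $B$-action given by the projection action on the factor $B^+$ and the right $B$-action given by the projection action on the factor $B^-$, and $B^-\otimes_BB^+\cong\mathbb{S}$ as $\mathbb{S}$-bimodules (tensor product over the linear category $B$ of the right $B$-module $B^-$ and the left $B$-module $B^+$, both with these projection actions). **Non-singularity.** For $p\preceq q$ and $f,g\in\mathbb{B}^{+,m}(p,q)$, over $\mathbb{Z}[x]$ with parameter $x$ let $a_{f,g}=\overline f\circ g$ if $\overline f\hat\circ g$ is level, and $0$ otherwise; $A_{p,q}=(a_{f,g})\in M_n(\mathbb{Z}[x][\mathfrak{S}_p])$, $n=|\mathbb{B}^{+,m}(p,q)|$; $\iota:M_n(\mathbb{Z}[x][\mathfrak{S}_p])\hookrightarrow M_{n\,p!}(\mathbb{Z}[x])$ induced by the left regular representation; $f_{p,q}(x)=\det\iota(A_{p,q})$. $\delta$ is non-singular if $f_{p,q}(\delta)$ is invertible in $\mathbf{k}$ for all $p\preceq q$. *)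

theory Defs
  imports
    "HOL-Library.Poly_Mapping"
    "HOL-Library.Disjoint_Sets"
    "HOL-Library.Set_Algebras"
    "HOL-Library.Countable_Set"
    "Jordan_Normal_Form.Determinant"
begin

section \<open>Free modules\<close>

text \<open>
  The free module on a type of generators is the type of finitely supported functions; the free
  module on a set \<open>A\<close> of generators is the set of those functions whose support lies in \<open>A\<close>.
\<close>

definition scal :: "'k::comm_ring_1 \<Rightarrow> ('a \<Rightarrow>\<^sub>0 'k) \<Rightarrow> ('a \<Rightarrow>\<^sub>0 'k)" where
  "scal c f = Poly_Mapping.map ((*) c) f"

definition free_on :: "'a set \<Rightarrow> ('a \<Rightarrow>\<^sub>0 'k::comm_ring_1) set" where
  "free_on A = {f. Poly_Mapping.keys f \<subseteq> A}"

text \<open>The linear extension of a map defined on generators.\<close>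

definition lin_ext :: "('a \<Rightarrow> ('b \<Rightarrow>\<^sub>0 'k::comm_ring_1)) \<Rightarrow> ('a \<Rightarrow>\<^sub>0 'k) \<Rightarrow> ('b \<Rightarrow>\<^sub>0 'k)" where
  "lin_ext F f = (\<Sum>a\<in>Poly_Mapping.keys f. scal (Poly_Mapping.lookup f a) (F a))"

abbreviation gen :: "'a \<Rightarrow> ('a \<Rightarrow>\<^sub>0 'k::comm_ring_1)" where
  "gen a \<equiv> Poly_Mapping.single a 1"

lemma lookup_scal [simp]: "Poly_Mapping.lookup (scal c f) a = c * Poly_Mapping.lookup f a"
  unfolding scal_def by transfer (simp add: when_def)

interpretation free_module: Modules.module "scal :: 'k::comm_ring_1 \<Rightarrow> ('a \<Rightarrow>\<^sub>0 'k) \<Rightarrow> _"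
  by unfold_locales (auto intro!: poly_mapping_eqI simp: lookup_add algebra_simps)


section \<open>Brauer diagrams\<close>

text \<open>\<open>Top i\<close> is $i^+$ and \<open>Bot i\<close> is $i^-$.\<close>

datatype point = Top nat | Bot nat

type_synonym diagram = "point set set"

definition points :: "nat \<Rightarrow> nat \<Rightarrow> point set" where
  "points p q = Top ` {1..p} \<union> Bot ` {1..q}"

definition brauer :: "nat \<Rightarrow> nat \<Rightarrow> diagram set" where
  "brauer p q = {D. partition_on (points p q) D \<and> (\<forall>P\<in>D. card P = 2)}"

definition upward :: "diagram \<Rightarrow> bool" where
  "upward D \<longleftrightarrow> \<not> (\<exists>P\<in>D. P \<subseteq> range Top)"

definition downward :: "diagram \<Rightarrow> bool" where
  "downward D \<longleftrightarrow> \<not> (\<exists>P\<in>D. P \<subseteq> range Bot)"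

definition level :: "diagram \<Rightarrow> bool" where
  "level D \<longleftrightarrow> upward D \<and> downward D"

definition monotone_diagram :: "diagram \<Rightarrow> bool" where
  "monotone_diagram D \<longleftrightarrow>
     (\<forall>i j k l. {Top i, Bot j} \<in> D \<and> {Top k, Bot l} \<in> D \<and> {Top i, Bot j} \<noteq> {Top k, Bot l}
        \<longrightarrow> (int i - int k) * (int j - int l) > 0)"

definition brauer_up :: "nat \<Rightarrow> nat \<Rightarrow> diagram set" where
  "brauer_up p q = {D \<in> brauer p q. upward D}"

definition brauer_down :: "nat \<Rightarrow> nat \<Rightarrow> diagram set" where
  "brauer_down p q = {D \<in> brauer p q. downward D}"

definition brauer_level :: "nat \<Rightarrow> nat \<Rightarrow> diagram set" where
  "brauer_level p q = {D \<in> brauer p q. level D}"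

definition brauer_up_mono :: "nat \<Rightarrow> nat \<Rightarrow> diagram set" where
  "brauer_up_mono p q = {D \<in> brauer_up p q. monotone_diagram D}"

fun flip_point :: "point \<Rightarrow> point" where
  "flip_point (Top i) = Bot i"
| "flip_point (Bot i) = Top i"

definition flip :: "diagram \<Rightarrow> diagram" where
  "flip D = (\<lambda>P. flip_point ` P) ` D"

definition preceq :: "nat \<Rightarrow> nat \<Rightarrow> bool" (infix \<open>\<preceq>\<^sub>B\<close> 50) where
  "p \<preceq>\<^sub>B q \<longleftrightarrow> p \<le> q \<and> even (q - p)"


section \<open>Composition of diagrams\<close>

text \<open>
  To compose \<open>g \<in> brauer p q\<close> and \<open>f \<in> brauer q s\<close>, the diagram \<open>g\<close> is placed on top of \<open>f\<close>.
  The bottom points of \<open>g\<close> and the top points of \<open>f\<close> become the middle points \<open>Mid i\<close> of the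
  stacked picture.  A connected component consisting of middle points only is a closed loop; every
  other component contains exactly two points from the outer rows.
\<close>

datatype stacked = Upper nat | Mid nat | Lower nat

fun in_upper :: "point \<Rightarrow> stacked" where
  "in_upper (Top i) = Upper i"
| "in_upper (Bot i) = Mid i"

fun in_lower :: "point \<Rightarrow> stacked" where
  "in_lower (Top i) = Mid i"
| "in_lower (Bot i) = Lower i"

fun outer :: "point \<Rightarrow> stacked" where
  "outer (Top i) = Upper i"
| "outer (Bot i) = Lower i"

definition stack :: "diagram \<Rightarrow> diagram \<Rightarrow> stacked set set" where
  "stack f g = (\<lambda>P. in_upper ` P) ` g \<union> (\<lambda>P. in_lower ` P) ` f"

definition joined :: "diagram \<Rightarrow> diagram \<Rightarrow> (stacked \<times> stacked) set" where
  "joined f g = {(u, v). \<exists>E\<in>stack f g. u \<in> E \<and> v \<in> E}"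

definition components :: "diagram \<Rightarrow> diagram \<Rightarrow> stacked set set" where
  "components f g = \<Union>(stack f g) // (joined f g)\<^sup>+"

definition loops :: "diagram \<Rightarrow> diagram \<Rightarrow> stacked set set" where
  "loops f g = {C \<in> components f g. C \<subseteq> range Mid}"

definition num_loops :: "diagram \<Rightarrow> diagram \<Rightarrow> nat" where
  "num_loops f g = card (loops f g)"

definition hat_comp :: "diagram \<Rightarrow> diagram \<Rightarrow> diagram" where
  "hat_comp f g = (\<lambda>C. outer -` C) ` (components f g - loops f g)"


section \<open>The Brauer category\<close>

type_synonym 'k morphism = "diagram \<Rightarrow>\<^sub>0 'k"

definition hom_B :: "nat \<Rightarrow> nat \<Rightarrow> 'k::comm_ring_1 morphism set" where
  "hom_B p q = free_on (brauer p q)"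

text \<open>
  \<open>hom_S p q\<close> is zero for \<open>p \<noteq> q\<close>, because there are no level diagrams in \<open>brauer p q\<close> then.
\<close>

definition hom_S :: "nat \<Rightarrow> nat \<Rightarrow> 'k::comm_ring_1 morphism set" where
  "hom_S p q = free_on (brauer_level p q)"

text \<open>
  The set of points of a diagram determines its source and target, so composition needs no object
  arguments.
\<close>

definition comp :: "'k::comm_ring_1 \<Rightarrow> 'k morphism \<Rightarrow> 'k morphism \<Rightarrow> 'k morphism" where
  "comp \<delta> f g = lin_ext (\<lambda>a. lin_ext (\<lambda>b. scal (\<delta> ^ num_loops a b) (gen (hat_comp a b))) g) f"

definition restrict_to :: "(diagram \<Rightarrow> bool) \<Rightarrow> 'k::comm_ring_1 morphism \<Rightarrow> 'k morphism" where
  "restrict_to Q = lin_ext (\<lambda>D. if Q D then gen D else 0)"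


section \<open>Bimodules over linear categories\<close>

text \<open>
  A bimodule over two linear categories with objects the natural numbers, covariant in \<open>q\<close> and
  contravariant in \<open>p\<close> in \<open>elts M p q\<close>:
  \<^item> \<open>lact M p q q' h m\<close>, for \<open>h : q \<rightarrow> q'\<close> and \<open>m \<in> elts M p q\<close>, lies in \<open>elts M p q'\<close>;
  \<^item> \<open>ract M p' p q m h\<close>, for \<open>h : p' \<rightarrow> p\<close> and \<open>m \<in> elts M p q\<close>, lies in \<open>elts M p' q\<close>.

  The categories acting are not part of the record; they are represented by their families of
  morphism sets.
\<close>

record ('k, 'h, 'm) bimodule =
  elts :: "nat \<Rightarrow> nat \<Rightarrow> 'm set"
  plus_m :: "nat \<Rightarrow> nat \<Rightarrow> 'm \<Rightarrow> 'm \<Rightarrow> 'm"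
  scal_m :: "nat \<Rightarrow> nat \<Rightarrow> 'k \<Rightarrow> 'm \<Rightarrow> 'm"
  lact :: "nat \<Rightarrow> nat \<Rightarrow> nat \<Rightarrow> 'h \<Rightarrow> 'm \<Rightarrow> 'm"
  ract :: "nat \<Rightarrow> nat \<Rightarrow> nat \<Rightarrow> 'm \<Rightarrow> 'h \<Rightarrow> 'm"

text \<open>Isomorphism of bimodules with the category with morphism sets \<open>H\<close> acting on both sides.\<close>

definition bimodule_iso ::
  "(nat \<Rightarrow> nat \<Rightarrow> 'h set) \<Rightarrow> ('k, 'h, 'm) bimodule \<Rightarrow> ('k, 'h, 'n) bimodule \<Rightarrow> bool" where
  "bimodule_iso H M N \<longleftrightarrow>
     (\<exists>\<phi>. (\<forall>p q. bij_betw (\<phi> p q) (elts M p q) (elts N p q)) \<and>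
          (\<forall>p q. \<forall>x\<in>elts M p q. \<forall>y\<in>elts M p q.
             \<phi> p q (plus_m M p q x y) = plus_m N p q (\<phi> p q x) (\<phi> p q y)) \<and>
          (\<forall>p q c. \<forall>x\<in>elts M p q. \<phi> p q (scal_m M p q c x) = scal_m N p q c (\<phi> p q x)) \<and>
          (\<forall>p q q'. \<forall>h\<in>H q q'. \<forall>x\<in>elts M p q.
             \<phi> p q' (lact M p q q' h x) = lact N p q q' h (\<phi> p q x)) \<and>
          (\<forall>p' p q. \<forall>h\<in>H p' p. \<forall>x\<in>elts M p q.
             \<phi> p' q (ract M p' p q x h) = ract N p' p q (\<phi> p q x) h))"

text \<open>
  The tensor product of \<open>M\<close> and \<open>N\<close> over the linear category with morphism sets \<open>H\<close>: at \<open>(p, q)\<close>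
  it is the quotient of the free module on the symbols \<open>(s, m, n)\<close>, to be read as \<open>m \<otimes> n\<close> with
  \<open>m \<in> M(s, q)\<close> and \<open>n \<in> N(p, s)\<close>, by the relations of bilinearity and \<open>m h \<otimes> n = m \<otimes> h n\<close> for
  \<open>h : s \<rightarrow> t\<close> in \<open>H\<close>.  If \<open>H\<close> has no nonzero morphisms between distinct objects, this is the direct
  sum over \<open>s\<close> of the tensor products of \<open>M(s, q)\<close> and \<open>N(p, s)\<close> over the algebra \<open>H s s\<close>.
\<close>

definition tensor_gens ::
  "('k, 'h, 'm) bimodule \<Rightarrow> ('k, 'h, 'n) bimodule \<Rightarrow> nat \<Rightarrow> nat \<Rightarrow> (nat \<times> 'm \<times> 'n) set" where
  "tensor_gens M N p q = {(s, m, n). m \<in> elts M s q \<and> n \<in> elts N p s}"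

definition tensor_rels ::
  "(nat \<Rightarrow> nat \<Rightarrow> 'h set) \<Rightarrow> ('k::comm_ring_1, 'h, 'm) bimodule \<Rightarrow> ('k, 'h, 'n) bimodule
     \<Rightarrow> nat \<Rightarrow> nat \<Rightarrow> ((nat \<times> 'm \<times> 'n) \<Rightarrow>\<^sub>0 'k) set" where
  "tensor_rels H M N p q =
     {gen (s, plus_m M s q m m', n) - gen (s, m, n) - gen (s, m', n) | s m m' n.
        m \<in> elts M s q \<and> m' \<in> elts M s q \<and> n \<in> elts N p s} \<union>
     {gen (s, m, plus_m N p s n n') - gen (s, m, n) - gen (s, m, n') | s m n n'.
        m \<in> elts M s q \<and> n \<in> elts N p s \<and> n' \<in> elts N p s} \<union>
     {gen (s, scal_m M s q c m, n) - scal c (gen (s, m, n)) | s c m n.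
        m \<in> elts M s q \<and> n \<in> elts N p s} \<union>
     {gen (s, m, scal_m N p s c n) - scal c (gen (s, m, n)) | s c m n.
        m \<in> elts M s q \<and> n \<in> elts N p s} \<union>
     {gen (s, ract M s t q m h, n) - gen (t, m, lact N p s t h n) | s t m h n.
        m \<in> elts M t q \<and> h \<in> H s t \<and> n \<in> elts N p s}"

definition tensor_ker ::
  "(nat \<Rightarrow> nat \<Rightarrow> 'h set) \<Rightarrow> ('k::comm_ring_1, 'h, 'm) bimodule \<Rightarrow> ('k, 'h, 'n) bimodule
     \<Rightarrow> nat \<Rightarrow> nat \<Rightarrow> ((nat \<times> 'm \<times> 'n) \<Rightarrow>\<^sub>0 'k) set" where
  "tensor_ker H M N p q = free_module.span (tensor_rels H M N p q)"

text \<open>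
  The elements of the tensor product are cosets \<open>x +o tensor_ker H M N p q\<close>.  Its operations are
  the ones induced from the free module; as they are compatible with the relations, the unions
  below are unions of equal cosets.
\<close>

definition tensor ::
  "(nat \<Rightarrow> nat \<Rightarrow> 'h set) \<Rightarrow> ('k::comm_ring_1, 'h, 'm) bimodule \<Rightarrow> ('k, 'h, 'n) bimodule
     \<Rightarrow> ('k, 'h, ((nat \<times> 'm \<times> 'n) \<Rightarrow>\<^sub>0 'k) set) bimodule" where
  "tensor H M N =
     \<lparr>elts = (\<lambda>p q. {x +o tensor_ker H M N p q | x. x \<in> free_on (tensor_gens M N p q)}),
      plus_m = (\<lambda>p q X Y. \<Union>x\<in>X. \<Union>y\<in>Y. (x + y) +o tensor_ker H M N p q),
      scal_m = (\<lambda>p q c X. \<Union>x\<in>X. scal c x +o tensor_ker H M N p q),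
      lact = (\<lambda>p q q' h X. \<Union>x\<in>X.
        lin_ext (\<lambda>(s, m, n). gen (s, lact M s q q' h m, n)) x +o tensor_ker H M N p q'),
      ract = (\<lambda>p' p q X h. \<Union>x\<in>X.
        lin_ext (\<lambda>(s, m, n). gen (s, m, ract N p' p s n h)) x +o tensor_ker H M N p' q)\<rparr>"


section \<open>The Morita equivalence\<close>

definition B_bimodule :: "'k::comm_ring_1 \<Rightarrow> ('k, 'k morphism, 'k morphism) bimodule" where
  "B_bimodule \<delta> =
     \<lparr>elts = hom_B, plus_m = (\<lambda>p q. (+)), scal_m = (\<lambda>p q. scal),
      lact = (\<lambda>p q q' h f. comp \<delta> h f), ract = (\<lambda>p' p q f h. comp \<delta> f h)\<rparr>"

definition S_bimodule :: "'k::comm_ring_1 \<Rightarrow> ('k, 'k morphism, 'k morphism) bimodule" where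
  "S_bimodule \<delta> =
     \<lparr>elts = hom_S, plus_m = (\<lambda>p q. (+)), scal_m = (\<lambda>p q. scal),
      lact = (\<lambda>p q q' h f. comp \<delta> h f), ract = (\<lambda>p' p q f h. comp \<delta> f h)\<rparr>"

text \<open>\<open>B\<close> acts on the left by the projection action, the level category on the right by composition.\<close>

definition B_plus :: "'k::comm_ring_1 \<Rightarrow> ('k, 'k morphism, 'k morphism) bimodule" where
  "B_plus \<delta> =
     \<lparr>elts = (\<lambda>p q. free_on (brauer_up p q)), plus_m = (\<lambda>p q. (+)), scal_m = (\<lambda>p q. scal),
      lact = (\<lambda>p q q' h f. restrict_to upward (comp \<delta> h f)),
      ract = (\<lambda>p' p q f h. comp \<delta> f h)\<rparr>"

text \<open>\<open>B\<close> acts on the right by the projection action, the level category on the left by composition.\<close>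

definition B_minus :: "'k::comm_ring_1 \<Rightarrow> ('k, 'k morphism, 'k morphism) bimodule" where
  "B_minus \<delta> =
     \<lparr>elts = (\<lambda>p q. free_on (brauer_down p q)), plus_m = (\<lambda>p q. (+)), scal_m = (\<lambda>p q. scal),
      lact = (\<lambda>p q q' h f. comp \<delta> h f),
      ract = (\<lambda>p' p q f h. restrict_to downward (comp \<delta> f h))\<rparr>"

definition gives_morita_equivalence :: "'k::comm_ring_1 \<Rightarrow> bool" where
  "gives_morita_equivalence \<delta> \<longleftrightarrow>
     bimodule_iso hom_B (tensor hom_S (B_plus \<delta>) (B_minus \<delta>)) (B_bimodule \<delta>) \<and>
     bimodule_iso hom_S (tensor hom_B (B_minus \<delta>) (B_plus \<delta>)) (S_bimodule \<delta>)"


section \<open>Non-singular parameters\<close>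

text \<open>
  The entry $a_{f,g}$ of the matrix $A_{p,q}$, formed in the Brauer category over the ring of
  integer polynomials, whose parameter is the indeterminate.
\<close>

definition gram_entry :: "diagram \<Rightarrow> diagram \<Rightarrow> int poly morphism" where
  "gram_entry f g =
     (if level (hat_comp (flip f) g) then comp [:0, 1:] (gen (flip f)) (gen g) else 0)"

text \<open>
  The entry of $\iota(A_{p,q})$ in row \<open>(f, \<sigma>)\<close> and column \<open>(g, \<tau>)\<close>: the coefficient of \<open>\<sigma>\<close> in the
  product of $a_{f,g}$ and \<open>\<tau>\<close>.
\<close>

definition gram_block_entry :: "diagram \<times> diagram \<Rightarrow> diagram \<times> diagram \<Rightarrow> int poly" where
  "gram_block_entry = (\<lambda>(f, \<sigma>) (g, \<tau>).
     Poly_Mapping.lookup (comp [:0, 1:] (gram_entry f g) (gen \<tau>)) \<sigma>)"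

text \<open>
  The determinant of a square matrix with rows and columns indexed by a finite set; it does not
  depend on the enumeration of the set, which is the same for rows and columns.
\<close>

definition det_on :: "'i set \<Rightarrow> ('i \<Rightarrow> 'i \<Rightarrow> 'a::comm_ring_1) \<Rightarrow> 'a" where
  "det_on I A =
     det (mat (card I) (card I) (\<lambda>(i, j). A (from_nat_into I i) (from_nat_into I j)))"

definition gram_det :: "nat \<Rightarrow> nat \<Rightarrow> int poly" where
  "gram_det p q = det_on (brauer_up_mono p q \<times> brauer_level p p) gram_block_entry"

definition non_singular :: "'k::comm_ring_1 \<Rightarrow> bool" where
  "non_singular \<delta> \<longleftrightarrow>
     (\<forall>p q. p \<preceq>\<^sub>B q \<longrightarrow> poly (map_poly of_int (gram_det p q)) \<delta> dvd 1)"

end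

theory Submission
  imports Defs "HOL-Library.Infinite_Set"
begin

text \<open>
  For upward \<open>x\<close> and downward \<open>n\<close> let \<open>\<langle>n, x\<rangle>\<close> be the level part of \<open>n \<circ> x\<close>.  The matrix \<open>\<iota>(A)\<close> is the
  Gram matrix, in the bases of diagrams, of the form taking \<open>(n, x)\<close> to the coefficient of the
  identity in \<open>\<langle>n, x\<rangle>\<close>.  The isomorphism $B^- \otimes_B B^+ \cong \mathbb{S}$ holds for every
  \<open>\<delta>\<close>, because \<open>m \<otimes> n = 1 \<otimes> \<langle>m, n\<rangle>\<close>.

  If \<open>\<delta>\<close> is non-singular, the monotone upward diagrams \<open>f\<close> have dual elements \<open>y\<^sub>f\<close> and
  \<open>h \<mapsto> \<Sum>\<^sub>f h f \<otimes> y\<^sub>f\<close> is a bimodule map $B \to B^+ \otimes_{\mathbb{S}} B^-$.  Composed with the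
  surjection \<open>m \<otimes> n \<mapsto> m \<circ> n\<close> it becomes unitriangular for the filtration by the middle object, so it
  is bijective.  Conversely, a bimodule isomorphism \<open>\<phi>\<close> satisfies \<open>\<phi>(m \<otimes> n) = m w n\<close> where
  \<open>w = \<phi>(1 \<otimes> 1)\<close> is annihilated by all non-downward diagrams; letting \<open>1 = \<Sum>\<^sub>j m\<^sub>j w n\<^sub>j\<close> act on an
  upward \<open>x\<close> leaves \<open>x = \<Sum>\<^sub>j m\<^sub>j z \<langle>n\<^sub>j, x\<rangle>\<close>, with \<open>z\<close> the level part of \<open>w\<close>, which exhibits a left
  inverse of the Gram matrix.
\<close>

section \<open>Blocks of a set system and associativity of composition\<close>

text \<open>The gluing map is only an auxiliary device: it does not commute with the projection
  actions, which discard diagrams that composition keeps. This is why the bimodule map runs in the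
  other direction. It comes from the Casimir element \<Sum> f \<otimes> \<open>y_f\<close>: acting
  on it by a morphism from the left or from the right gives the same class, and this is
  compatibility with both actions. For the converse nothing is known about the isomorphism beyond
  its linearity, so all information is extracted from the images of the elements 1 \<otimes> 1. The
  entries of the original matrix lie in a noncommutative group algebra. Passing to the coefficient
  of the identity loses nothing, because it is a nondegenerate trace on that algebra: the
  permutations form a basis, their inverses the dual basis, and inversion of permutations is
  flipping of diagrams. Over a commutative ring a left inverse of a square matrix already makes the
  determinant a unit, so the converse need not produce an inverse on both sides.\<close>

inductive conn :: "'v set set \<Rightarrow> 'v \<Rightarrow> 'v \<Rightarrow> bool" for A where
  edge: "E \<in> A \<Longrightarrow> u \<in> E \<Longrightarrow> v \<in> E \<Longrightarrow> conn A u v"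
| step: "conn A u v \<Longrightarrow> E \<in> A \<Longrightarrow> v \<in> E \<Longrightarrow> w \<in> E \<Longrightarrow> conn A u w"

text \<open>The vertex type is arbitrary, unlike in \<open>components\<close>, so that stacks of
  more than two diagrams fall under the same lemmas.\<close>

definition blocks :: "'v set set \<Rightarrow> 'v set set" where
  "blocks A = (\<lambda>u. {v. conn A u v}) ` \<Union>A"

lemma conn_iff_joined: "(u, v) \<in> (joined f g)\<^sup>+ \<longleftrightarrow> conn (stack f g) u v"
proof
  assume "(u, v) \<in> (joined f g)\<^sup>+"
  then show "conn (stack f g) u v"
  proof (induction rule: trancl_induct)
    case (base y)
    then show ?case by (auto simp: joined_def intro: conn.edge)
  next
    case (step y z)
    then show ?case by (auto simp: joined_def intro: conn.step)
  qed
next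
  assume "conn (stack f g) u v"
  then show "(u, v) \<in> (joined f g)\<^sup>+"
  proof (induction rule: conn.induct)
    case (edge E u v)
    then show ?case by (intro r_into_trancl) (auto simp: joined_def)
  next
    case (step u v E w)
    then have "(v, w) \<in> joined f g" by (auto simp: joined_def)
    with step(5) show ?case by (rule trancl_into_trancl)
  qed
qed

lemma components_eq: "components f g = blocks (stack f g)"
  by (auto simp: components_def blocks_def quotient_def conn_iff_joined Image_singleton)

lemma conn_refl: "u \<in> \<Union>A \<Longrightarrow> conn A u u"
  by (auto intro: conn.edge)

lemma conn_in: "conn A u v \<Longrightarrow> u \<in> \<Union>A \<and> v \<in> \<Union>A"
  by (induction rule: conn.induct) auto

lemma conn_trans: "conn A v w \<Longrightarrow> conn A u v \<Longrightarrow> conn A u w"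
  by (induction rule: conn.induct) (auto intro: conn.step)

lemma conn_sym: "conn A u v \<Longrightarrow> conn A v u"
  by (induction rule: conn.induct) (meson conn.edge conn_trans)+

lemma conn_mono: "conn A u v \<Longrightarrow> A \<subseteq> B \<Longrightarrow> conn B u v"
  by (induction rule: conn.induct) (meson conn.edge conn.step subsetD)+

lemma blocks_mem_iff: "C \<in> blocks A \<Longrightarrow> u \<in> C \<Longrightarrow> v \<in> C \<longleftrightarrow> conn A u v"
  unfolding blocks_def by clarsimp (meson conn_sym conn_trans)

lemma blocks_eq: "C \<in> blocks A \<Longrightarrow> u \<in> C \<Longrightarrow> C = {v. conn A u v}"
  using blocks_mem_iff by fastforce

lemma blocksE:
  assumes "C \<in> blocks A"
  obtains u where "u \<in> \<Union>A" "C = {v. conn A u v}"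
  using assms unfolding blocks_def by (rule imageE)

lemma blocks_nonempty: "C \<in> blocks A \<Longrightarrow> \<exists>u. u \<in> C"
  by (metis blocksE conn_refl mem_Collect_eq)

lemma blocks_sub: "C \<in> blocks A \<Longrightarrow> C \<subseteq> \<Union>A"
  by (metis blocksE conn_in mem_Collect_eq subsetI)

lemma blocks_eqI: "C \<in> blocks A \<Longrightarrow> D \<in> blocks A \<Longrightarrow> u \<in> C \<Longrightarrow> u \<in> D \<Longrightarrow> C = D"
  by (metis blocks_eq)

lemma blockI: "u \<in> \<Union>A \<Longrightarrow> {v. conn A u v} \<in> blocks A"
  unfolding blocks_def by (rule imageI)

lemma block_ex: "u \<in> \<Union>A \<Longrightarrow> \<exists>C\<in>blocks A. u \<in> C"
  using blockI conn_refl by (metis mem_Collect_eq)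

lemma finite_blocks: "finite (\<Union>A) \<Longrightarrow> finite (blocks A)"
  unfolding blocks_def by simp

lemma conn_image:
  assumes "inj \<phi>"
  shows "conn ((`) \<phi> ` A) x y \<Longrightarrow> x = \<phi> u \<Longrightarrow> \<exists>v. y = \<phi> v \<and> conn A u v"
proof (induction rule: conn.induct)
  case (edge E x y)
  then obtain F v where "F \<in> A" "E = \<phi> ` F" "y = \<phi> v" "v \<in> F" by auto
  then show ?case using edge assms by (auto simp: inj_image_mem_iff intro: conn.edge)
next
  case (step x y E z)
  then obtain v where v: "y = \<phi> v" "conn A u v" by auto
  from step obtain F w where "F \<in> A" "E = \<phi> ` F" "z = \<phi> w" "w \<in> F" by auto
  then show ?case using step v assms by (auto simp: inj_image_mem_iff intro: conn.step)
qed

lemma conn_image_iff: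
  assumes "inj \<phi>"
  shows "conn ((`) \<phi> ` A) (\<phi> u) (\<phi> v) \<longleftrightarrow> conn A u v"
proof
  show "conn ((`) \<phi> ` A) (\<phi> u) (\<phi> v) \<Longrightarrow> conn A u v"
    using conn_image[OF assms _ refl] assms by (metis injD)
  show "conn A u v \<Longrightarrow> conn ((`) \<phi> ` A) (\<phi> u) (\<phi> v)"
    by (induction rule: conn.induct) (meson conn.edge conn.step imageI)+
qed

lemma blocks_image:
  assumes "inj \<phi>"
  shows "blocks ((`) \<phi> ` A) = (`) \<phi> ` blocks A"
proof -
  have *: "{w. conn ((`) \<phi> ` A) (\<phi> u) w} = \<phi> ` {v. conn A u v}" for u
  proof (intro Set.set_eqI iffI)
    fix w assume "w \<in> {w. conn ((`) \<phi> ` A) (\<phi> u) w}"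
    then show "w \<in> \<phi> ` {v. conn A u v}" using conn_image[OF assms _ refl, of A u w] by auto
  qed (auto simp: conn_image_iff[OF assms])
  have "\<Union>((`) \<phi> ` A) = \<phi> ` \<Union>A" by auto
  then show ?thesis by (simp add: blocks_def image_image *)
qed

text \<open>Composition of diagrams is a \<open>reduct\<close>: the vertices of the middle row are eliminated.
  Associativity follows since two rows can be eliminated in either order.\<close>

definition reduct :: "'v set \<Rightarrow> 'v set set \<Rightarrow> 'v set set" where
  "reduct M A = {C - M | C. C \<in> blocks A \<and> \<not> C \<subseteq> M}"

lemma reduct_image: "reduct M A = (\<lambda>C. C - M) ` {C \<in> blocks A. \<not> C \<subseteq> M}"
  by (auto simp: reduct_def)

lemma reductI: "C \<in> blocks A \<Longrightarrow> u \<in> C \<Longrightarrow> u \<notin> M \<Longrightarrow> C - M \<in> reduct M A"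
  unfolding reduct_def by auto

lemma reductE:
  assumes "D \<in> reduct M A"
  obtains C u where "C \<in> blocks A" "D = C - M" "u \<in> C" "u \<notin> M"
  using assms unfolding reduct_def by auto

lemma conn_reduct_edge:
  assumes "u \<notin> M" "v \<notin> M" "conn A u v"
  shows "\<exists>E\<in>reduct M A. u \<in> E \<and> v \<in> E"
proof -
  obtain C where C: "C \<in> blocks A" "u \<in> C" using block_ex[of u A] conn_in[OF assms(3)] by auto
  then have "v \<in> C" using assms(3) blocks_mem_iff[OF C] by simp
  with C(2) assms(1,2) have "u \<in> C - M \<and> v \<in> C - M" by simp
  then show ?thesis using reductI[OF C assms(1)] by (rule bexI)
qed

lemma reduct_edge_conn: "E \<in> reduct M A \<Longrightarrow> u \<in> E \<Longrightarrow> v \<in> E \<Longrightarrow> conn A u v"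
  by (metis reductE blocks_mem_iff DiffD1)

lemma Union_reduct: "\<Union>(reduct M A) = \<Union>A - M"
proof (intro subset_antisym subsetI)
  fix u assume "u \<in> \<Union>(reduct M A)"
  then obtain C where "C \<in> blocks A" "u \<in> C - M" by (auto elim!: reductE)
  then show "u \<in> \<Union>A - M" using blocks_sub[of C A] by auto
next
  fix u assume "u \<in> \<Union>A - M"
  then show "u \<in> \<Union>(reduct M A)" using conn_reduct_edge[of u M u A] conn_refl[of u A] by auto
qed

text \<open>Since \<open>B\<close> avoids \<open>M\<close>, a path can visit \<open>M\<close> only
  along sets of \<open>A\<close>. Each excursion into \<open>M\<close> is therefore a path of
  \<open>A\<close> with both ends outside \<open>M\<close>, and \<open>reduct M A\<close> replaces
  it by one edge.\<close>

lemma conn_merge: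
  assumes "\<Union>B \<inter> M = {}" "u \<notin> M" "w \<notin> M"
  shows "conn (reduct M A \<union> B) u w \<longleftrightarrow> conn (A \<union> B) u w"
proof
  have e: "conn (A \<union> B) x y" if "E \<in> reduct M A \<union> B" "x \<in> E" "y \<in> E" for x y E
    using that reduct_edge_conn[of E M A x y] conn_mono[of A x y "A \<union> B"]
    by (auto intro: conn.edge)
  show "conn (reduct M A \<union> B) u w \<Longrightarrow> conn (A \<union> B) u w"
    by (induction rule: conn.induct) (meson e conn_trans)+
next
  let ?L = "conn (reduct M A \<union> B)"
  have red: "?L x y" if "x \<notin> M" "y \<notin> M" "conn A x y" for x y
    using conn_reduct_edge[OF that] by (auto intro: conn.edge)
  have fin: "?L u x" if "?L u a" "a \<notin> M" "a = x \<or> conn A a x" "x \<notin> M" for a x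
    using that red conn_trans by metis
  assume "conn (A \<union> B) u w"
  \<comment> \<open>The induction has to cover initial segments ending inside \<open>M\<close>. The
    invariant keeps a point \<open>a\<close> outside \<open>M\<close>, already reached in the
    reduced system, from which the rest of the segment uses \<open>A\<close> only.\<close>
  then have "u \<notin> M \<longrightarrow> (\<exists>a. a \<notin> M \<and> ?L u a \<and> (a = w \<or> conn A a w))"
  proof (induction rule: conn.induct)
    case (edge E u v)
    show ?case
    proof
      assume u: "u \<notin> M"
      show "\<exists>a. a \<notin> M \<and> ?L u a \<and> (a = v \<or> conn A a v)"
      proof (cases "E \<in> A")
        case True
        then have "conn A u v" "conn A u u" using edge by (auto intro: conn.edge)
        with u red show ?thesis by metis
      next
        case False
        then have "?L u v" "v \<notin> M" using edge assms(1) by (auto intro: conn.edge)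
        then show ?thesis by metis
      qed
    qed
  next
    case (step u v E w)
    show ?case
    proof
      assume u: "u \<notin> M"
      then obtain a where a: "a \<notin> M" "?L u a" "a = v \<or> conn A a v" using step by auto
      show "\<exists>a. a \<notin> M \<and> ?L u a \<and> (a = w \<or> conn A a w)"
      proof (cases "E \<in> A")
        case True
        then have "conn A a w" using a(3) step by (auto intro: conn.edge conn.step)
        with a show ?thesis by metis
      next
        case False
        then have v: "v \<notin> M" "w \<notin> M" "?L v w" using step assms(1) by (auto intro: conn.edge)
        have "?L u v" using a v red conn_trans by metis
        with v show ?thesis using conn_trans by metis
      qed
    qed
  qed
  with fin assms(2,3) show "?L u w" by metis
qed

lemma blocks_merge:
  assumes "\<Union>B \<inter> M = {}"
  shows "blocks (reduct M A \<union> B) = reduct M (A \<union> B)"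
proof -
  have U: "\<Union>(reduct M A \<union> B) = \<Union>(A \<union> B) - M"
    using assms Union_reduct[of M A] by auto
  have cl: "{v. conn (reduct M A \<union> B) u v} = {v. conn (A \<union> B) u v} - M" if "u \<notin> M" for u
  proof (intro Set.set_eqI iffI)
    fix v assume v: "v \<in> {v. conn (reduct M A \<union> B) u v}"
    then have "v \<in> \<Union>(reduct M A \<union> B)" using conn_in[of "reduct M A \<union> B" u v] by simp
    then have "v \<notin> M" unfolding U by simp
    with v show "v \<in> {v. conn (A \<union> B) u v} - M" using conn_merge[OF assms that] by simp
  qed (simp add: conn_merge[OF assms that])
  show ?thesis
  proof (intro Set.set_eqI iffI)
    fix C assume "C \<in> blocks (reduct M A \<union> B)"
    then obtain u where u: "u \<in> \<Union>(A \<union> B)" "u \<notin> M" "C = {v. conn (A \<union> B) u v} - M"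
      unfolding blocks_def U using cl by auto
    then show "C \<in> reduct M (A \<union> B)" using reductI blockI conn_refl by (metis mem_Collect_eq)
  next
    fix C assume "C \<in> reduct M (A \<union> B)"
    then obtain D u where D: "C = D - M" "D \<in> blocks (A \<union> B)" "u \<in> D" "u \<notin> M"
      by (auto elim: reductE)
    then have "u \<in> \<Union>(reduct M A \<union> B)" using U blocks_sub[OF D(2)] by auto
    moreover have "C = {v. conn (reduct M A \<union> B) u v}"
      using D(1) blocks_eq[OF D(2,3)] cl[OF D(4)] by simp
    ultimately show "C \<in> blocks (reduct M A \<union> B)" using blockI by metis
  qed
qed

text \<open>A component contained in \<open>M\<close> meets no set of \<open>B\<close>, so adding
  \<open>B\<close> neither enlarges nor creates such components.\<close>

lemma blocks_inside:
  assumes "\<Union>B \<inter> M = {}"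
  shows "{C \<in> blocks (A \<union> B). C \<subseteq> M} = {C \<in> blocks A. C \<subseteq> M}"
proof -
  have edgeA: "E \<in> A" if "E \<in> A \<union> B" "u \<in> E" "u \<in> M" for E u
    using that assms by auto
  have mono: "conn A u v \<Longrightarrow> conn (A \<union> B) u v" for u v
    by (rule conn_mono) auto
  have 1: "conn (A \<union> B) u v \<Longrightarrow> (\<And>v. conn (A \<union> B) u v \<Longrightarrow> v \<in> M) \<Longrightarrow> conn A u v" for u v
  proof (induction rule: conn.induct)
    case (edge E u v)
    then show ?case by (meson conn.edge conn_refl edgeA UnionI)
  next
    case (step u v E w)
    then show ?case by (meson conn.step edgeA)
  qed
  \<comment> \<open>Here only the component with respect to \<open>A\<close> is known to stay in
    \<open>M\<close>. By induction every point reached so far belongs to it, so the next edge cannot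
    come from \<open>B\<close>.\<close>
  have 2: "conn (A \<union> B) u v \<Longrightarrow> u \<in> M \<Longrightarrow> (\<And>v. conn A u v \<Longrightarrow> v \<in> M) \<Longrightarrow> conn A u v" for u v
  proof (induction rule: conn.induct)
    case (edge E u v)
    then show ?case by (meson conn.edge edgeA)
  next
    case (step u v E w)
    then show ?case by (meson conn.step edgeA)
  qed
  show ?thesis
  proof (intro Set.set_eqI iffI CollectI conjI; elim CollectE conjE)
    fix C assume C: "C \<in> blocks (A \<union> B)" "C \<subseteq> M"
    then obtain u where u: "u \<in> C" using blocks_nonempty by metis
    note e = blocks_eq[OF C(1) u]
    have "C = {v. conn A u v}"
      using 1[of u] mono[of u] C(2) e by auto
    moreover have "u \<in> \<Union>A" using calculation u conn_in by fastforce
    ultimately show "C \<in> blocks A" using blockI by metis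
  next
    fix C assume C: "C \<in> blocks A" "C \<subseteq> M"
    then obtain u where u: "u \<in> C" using blocks_nonempty by metis
    note e = blocks_eq[OF C(1) u]
    have "C = {v. conn (A \<union> B) u v}"
      using 2[of u] mono[of u] C(2) e u by auto
    moreover have "u \<in> \<Union>(A \<union> B)" using u blocks_sub[OF C(1)] by auto
    ultimately show "C \<in> blocks (A \<union> B)" using blockI by metis
  qed auto
qed

text \<open>A component inside \<open>M \<union> N\<close> either lies in \<open>M\<close>, and then
  depends on \<open>A\<close> only, or leaves a nonempty trace outside \<open>M\<close>, which is a
  component of the reduced system. This counts the loops when two rows are eliminated one after the
  other.\<close>

lemma card_blocks_merge:
  assumes "\<Union>B \<inter> M = {}" "N \<inter> M = {}" "finite (\<Union>A)" "finite (\<Union>B)"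
  shows "card {C \<in> blocks (A \<union> B). C \<subseteq> M \<union> N} =
    card {C \<in> blocks A. C \<subseteq> M} + card {C \<in> blocks (reduct M A \<union> B). C \<subseteq> N}"
proof -
  have fin: "finite (blocks (A \<union> B))" using assms by (intro finite_blocks) auto
  let ?X = "{C \<in> blocks (A \<union> B). C \<subseteq> M \<union> N \<and> \<not> C \<subseteq> M}"
  have "{C \<in> blocks (A \<union> B). C \<subseteq> M \<union> N} = {C \<in> blocks (A \<union> B). C \<subseteq> M} \<union> ?X" by auto
  then have "card {C \<in> blocks (A \<union> B). C \<subseteq> M \<union> N} = card {C \<in> blocks (A \<union> B). C \<subseteq> M} + card ?X"
    using fin by (simp only:) (rule card_Un_disjoint, auto)
  moreover have "card ?X = card {C \<in> blocks (reduct M A \<union> B). C \<subseteq> N}"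
  proof (rule bij_betw_same_card, rule bij_betw_imageI)
    show "inj_on (\<lambda>C. C - M) ?X"
    proof (rule inj_onI)
      fix C D assume a: "C \<in> ?X" "D \<in> ?X" "C - M = D - M"
      then obtain u where "u \<in> C - M" by auto
      with a have "u \<in> C" "u \<in> D" by auto
      with a show "C = D" using blocks_eqI[of C "A \<union> B" D u] by simp
    qed
    show "(\<lambda>C. C - M) ` ?X = {C \<in> blocks (reduct M A \<union> B). C \<subseteq> N}"
    proof (intro subset_antisym subsetI)
      fix D assume "D \<in> (\<lambda>C. C - M) ` ?X"
      then show "D \<in> {C \<in> blocks (reduct M A \<union> B). C \<subseteq> N}"
        unfolding blocks_merge[OF assms(1)] by (auto simp: reduct_def)
    next
      fix D assume "D \<in> {C \<in> blocks (reduct M A \<union> B). C \<subseteq> N}"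
      then obtain C where "D = C - M" "C \<in> blocks (A \<union> B)" "\<not> C \<subseteq> M" "D \<subseteq> N"
        unfolding blocks_merge[OF assms(1)] by (auto simp: reduct_def)
      then show "D \<in> (\<lambda>C. C - M) ` ?X" by (intro image_eqI[of _ _ C]) auto
    qed
  qed
  ultimately show ?thesis unfolding blocks_inside[OF assms(1)] by simp
qed

section \<open>Rows of a stack as disjoint copies of the natural numbers\<close>

fun place :: "(nat \<Rightarrow> 'v) \<Rightarrow> (nat \<Rightarrow> 'v) \<Rightarrow> point \<Rightarrow> 'v" where
  "place a b (Top i) = a i"
| "place a b (Bot i) = b i"

text \<open>Redraws a diagram between two chosen rows of a larger picture. The type
  \<open>stacked\<close> has room for three rows only, whereas a triple composite needs
  four.\<close>

definition img :: "(nat \<Rightarrow> 'v) \<Rightarrow> (nat \<Rightarrow> 'v) \<Rightarrow> diagram \<Rightarrow> 'v set set" where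
  "img a b D = (`) (place a b) ` D"

fun place3 :: "(nat \<Rightarrow> 'v) \<Rightarrow> (nat \<Rightarrow> 'v) \<Rightarrow> (nat \<Rightarrow> 'v) \<Rightarrow> stacked \<Rightarrow> 'v" where
  "place3 a b c (Upper i) = a i"
| "place3 a b c (Mid i) = b i"
| "place3 a b c (Lower i) = c i"

lemma place_in_upper: "place3 a b c (in_upper x) = place a b x"
  by (cases x) auto

lemma place_in_lower: "place3 a b c (in_lower x) = place b c x"
  by (cases x) auto

lemma place_outer: "place3 a b c (outer x) = place a c x"
  by (cases x) auto

lemma range_outer: "range outer = - range Mid"
proof (intro Set.set_eqI iffI)
  fix x assume "x \<in> range outer"
  then obtain y where "x = outer y" by blast
  then show "x \<in> - range Mid" by (cases y) auto
next
  fix x assume "x \<in> - range Mid"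
  then show "x \<in> range outer"
    by (cases x) (auto intro: range_eqI[of _ _ "Top _"] range_eqI[of _ _ "Bot _"])
qed

definition apart :: "(nat \<Rightarrow> 'v) \<Rightarrow> (nat \<Rightarrow> 'v) \<Rightarrow> bool" where
  "apart a b \<longleftrightarrow> inj a \<and> inj b \<and> (\<forall>i j. a i \<noteq> b j)"

lemma inj_place: "apart a b \<Longrightarrow> inj (place a b)"
  unfolding apart_def by (rule injI, rename_tac x y, case_tac x; case_tac y) (auto dest: injD, metis)

lemma inj_place3:
  assumes "apart a b" "apart b c" "apart a c"
  shows "inj (place3 a b c)"
proof (rule injI)
  have "a i \<noteq> b j" "b i \<noteq> c j" "a i \<noteq> c j" "b i \<noteq> a j" "c i \<noteq> b j" "c i \<noteq> a j" for i j
    using assms unfolding apart_def by metis+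
  then show "place3 a b c x = place3 a b c y \<Longrightarrow> x = y" for x y
    using assms by (cases x; cases y) (auto simp: apart_def dest: injD)
qed

lemma inj_img:
  assumes "apart a b"
  shows "inj (img a b)"
proof -
  have "inj ((`) (place a b))" by (simp add: inj_def inj_image_eq_iff[OF inj_place[OF assms]])
  then show ?thesis unfolding img_def by (simp add: inj_def inj_image_eq_iff)
qed

lemma stack_img:
  "(`) (place3 a b c) ` stack f g = img a b g \<union> img b c f"
  by (simp add: stack_def img_def image_Un image_image place_in_upper place_in_lower)

context
  fixes a b c :: "nat \<Rightarrow> 'v"
  assumes ap: "apart a b" "apart b c" "apart a c"
begin

lemma blocks_img: "blocks (img a b g \<union> img b c f) = (`) (place3 a b c) ` components f g"
  unfolding components_eq stack_img[symmetric] by (rule blocks_image[OF inj_place3[OF ap]])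

lemma place3_image_sub: "place3 a b c ` C \<subseteq> range b \<longleftrightarrow> C \<subseteq> range Mid"
proof -
  have "range b = place3 a b c ` range Mid" by (simp add: image_image)
  then show ?thesis using inj_place3[OF ap] by (simp add: inj_image_subset_iff)
qed

text \<open>The vertices in the image of \<open>outer\<close> are exactly those not of the form
  \<open>Mid i\<close>, so taking preimages under \<open>outer\<close> amounts to deleting the
  middle row. After embedding all rows in one carrier, composition becomes a
  \<open>reduct\<close>.\<close>

lemma hat_comp_img: "img a c (hat_comp f g) = reduct (range b) (img a b g \<union> img b c f)"
proof -
  have *: "place a c ` (outer -` C) = place3 a b c ` C - range b" for C
  proof -
    have "place a c ` (outer -` C) = place3 a b c ` (outer ` (outer -` C))"
      by (simp add: image_image place_outer del: image_vimage_eq)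
    also have "outer ` (outer -` C) = C - range Mid"
      by (simp add: image_vimage_eq range_outer Diff_eq)
    also have "place3 a b c ` (C - range Mid) = place3 a b c ` C - place3 a b c ` range Mid"
      using inj_place3[OF ap] by (rule image_set_diff)
    also have "place3 a b c ` range Mid = range b" by (simp add: image_image)
    finally show ?thesis .
  qed
  have "img a c (hat_comp f g) = (\<lambda>C. place3 a b c ` C - range b) ` (components f g - loops f g)"
    by (simp add: img_def hat_comp_def image_image *)
  also have "components f g - loops f g = {C \<in> components f g. \<not> C \<subseteq> range Mid}"
    by (auto simp: loops_def)
  also have "(\<lambda>C. place3 a b c ` C - range b) ` \<dots> = reduct (range b) (img a b g \<union> img b c f)"
    by (simp add: reduct_image blocks_img Compr_image_eq image_image place3_image_sub)
  finally show ?thesis .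
qed

lemma num_loops_img: "num_loops f g = card {C \<in> blocks (img a b g \<union> img b c f). C \<subseteq> range b}"
proof -
  have "{C \<in> blocks (img a b g \<union> img b c f). C \<subseteq> range b} = (`) (place3 a b c) ` loops f g"
    by (simp add: blocks_img loops_def Compr_image_eq place3_image_sub)
  moreover have "inj_on ((`) (place3 a b c)) (loops f g)"
    using inj_place3[OF ap] by (meson inj_image_eq_iff inj_onI)
  ultimately show ?thesis by (simp add: num_loops_def card_image)
qed

end

lemma reduct_reduct:
  assumes "\<Union>B \<inter> M = {}"
  shows "reduct N (reduct M A \<union> B) = reduct (M \<union> N) (A \<union> B)"
proof -
  have "{C \<in> reduct M (A \<union> B). \<not> C \<subseteq> N} =
    (\<lambda>C. C - M) ` {C \<in> blocks (A \<union> B). \<not> C \<subseteq> M \<union> N}"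
    unfolding reduct_image Compr_image_eq by (rule image_cong) auto
  then show ?thesis
    unfolding reduct_image[of N] reduct_image[of "M \<union> N"] blocks_merge[OF assms]
    by (simp add: image_image Diff_Diff_Int set_diff_eq)
qed

lemma Union_img: "\<Union>(img a b D) \<subseteq> range a \<union> range b"
proof -
  have "place a b x \<in> range a \<union> range b" for x by (cases x) auto
  then show ?thesis unfolding img_def by blast
qed

lemma finite_img: "finite (\<Union>D) \<Longrightarrow> finite (\<Union>(img a b D))"
proof -
  have "\<Union>(img a b D) = place a b ` \<Union>D" unfolding img_def by blast
  then show "finite (\<Union>D) \<Longrightarrow> finite (\<Union>(img a b D))" by simp
qed

text \<open>A concrete supply of disjoint rows. Below, tracks 2 to 5 are the four rows of a stack of
  three diagrams; only their being distinct matters.\<close>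

definition track :: "nat \<Rightarrow> nat \<Rightarrow> nat \<times> nat" where "track r i = (r, i)"

lemma apart_track: "r \<noteq> s \<Longrightarrow> apart (track r) (track s)"
  by (auto simp: apart_def inj_on_def track_def)

lemma Union_img_track: "k \<noteq> r \<Longrightarrow> k \<noteq> s \<Longrightarrow> \<Union>(img (track r) (track s) D) \<inter> range (track k) = {}"
proof -
  assume "k \<noteq> r" "k \<noteq> s"
  then have "(range (track r) \<union> range (track s)) \<inter> range (track k) = {}" by (auto simp: track_def)
  then show ?thesis using Union_img[of "track r" "track s" D] by blast
qed

text \<open>Both sides arise from the same picture with four rows by eliminating the two inner ones;
  injectivity of \<open>img\<close> brings the equality back to diagrams.\<close>

lemma hat_comp_assoc: "hat_comp (hat_comp f g) h = hat_comp f (hat_comp g h)"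
proof -
  note ap = apart_track
  let ?i = "\<lambda>r s. img (track r) (track s)"
  have "?i 2 5 (hat_comp (hat_comp f g) h) = 
    reduct (range (track 3)) (reduct (range (track 4)) (?i 3 4 g \<union> ?i 4 5 f) \<union> ?i 2 3 h)"
    by (simp add: hat_comp_img[OF ap ap ap, of 2 3 5] hat_comp_img[OF ap ap ap, of 3 4 5] Un_commute)
  also have "\<dots> = reduct (range (track 4) \<union> range (track 3)) ((?i 3 4 g \<union> ?i 4 5 f) \<union> ?i 2 3 h)"
    by (rule reduct_reduct) (simp add: Union_img_track)
  also have "\<dots> = reduct (range (track 3) \<union> range (track 4)) ((?i 2 3 h \<union> ?i 3 4 g) \<union> ?i 4 5 f)"
    by (simp add: Un_ac)
  also have "\<dots> = reduct (range (track 4)) (reduct (range (track 3)) (?i 2 3 h \<union> ?i 3 4 g) \<union> ?i 4 5 f)"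
    by (rule reduct_reduct[symmetric]) (simp add: Union_img_track)
  also have "\<dots> = ?i 2 5 (hat_comp f (hat_comp g h))"
    by (simp add: hat_comp_img[OF ap ap ap, of 2 4 5] hat_comp_img[OF ap ap ap, of 2 3 4] Un_commute)
  finally show ?thesis using inj_img[OF ap, of 2 5] by (simp add: inj_eq)
qed

text \<open>Both sums count the components of the four-row picture that stay in the two inner rows,
  split according to which row is eliminated first.\<close>

lemma num_loops_assoc:
  assumes "finite (\<Union>f)" "finite (\<Union>g)" "finite (\<Union>h)"
  shows "num_loops f g + num_loops (hat_comp f g) h = num_loops g h + num_loops f (hat_comp g h)"
proof -
  note ap = apart_track
  let ?i = "\<lambda>r s. img (track r) (track s)"
  let ?S = "?i 2 3 h \<union> ?i 3 4 g \<union> ?i 4 5 f"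
  note fin = finite_img[OF assms(1)] finite_img[OF assms(2)] finite_img[OF assms(3)]
  have d: "range (track 3) \<inter> range (track 4) = {}" by (auto simp: track_def)
  have "num_loops f g + num_loops (hat_comp f g) h =
    card {C \<in> blocks (?i 3 4 g \<union> ?i 4 5 f). C \<subseteq> range (track 4)} +
    card {C \<in> blocks (reduct (range (track 4)) (?i 3 4 g \<union> ?i 4 5 f) \<union> ?i 2 3 h). C \<subseteq> range (track 3)}"
    by (simp add: num_loops_img[OF ap ap ap, of 2 3 5 "hat_comp f g" h] num_loops_img[OF ap ap ap, of 3 4 5 f g]
        hat_comp_img[OF ap ap ap, of 3 4 5] Un_commute)
  also have "\<dots> = card {C \<in> blocks ((?i 3 4 g \<union> ?i 4 5 f) \<union> ?i 2 3 h). C \<subseteq> range (track 4) \<union> range (track 3)}"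
    by (rule card_blocks_merge[symmetric]) (use fin d in \<open>auto simp: Union_img_track\<close>)
  also have "\<dots> = card {C \<in> blocks ((?i 2 3 h \<union> ?i 3 4 g) \<union> ?i 4 5 f). C \<subseteq> range (track 3) \<union> range (track 4)}"
    by (simp add: Un_ac)
  also have "\<dots> = card {C \<in> blocks (?i 2 3 h \<union> ?i 3 4 g). C \<subseteq> range (track 3)} +
    card {C \<in> blocks (reduct (range (track 3)) (?i 2 3 h \<union> ?i 3 4 g) \<union> ?i 4 5 f). C \<subseteq> range (track 4)}"
    by (rule card_blocks_merge) (use fin d in \<open>auto simp: Union_img_track\<close>)
  also have "\<dots> = num_loops g h + num_loops f (hat_comp g h)"
    by (simp add: num_loops_img[OF ap ap ap, of 2 4 5 f "hat_comp g h"] num_loops_img[OF ap ap ap, of 2 3 4 g h]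
        hat_comp_img[OF ap ap ap, of 2 3 4] Un_commute)
  finally show ?thesis .
qed

section \<open>Composites are Brauer diagrams\<close>

definition pairing :: "'v set \<Rightarrow> 'v set set \<Rightarrow> bool" where
  "pairing X E \<longleftrightarrow> partition_on X E \<and> (\<forall>P\<in>E. card P = 2)"

text \<open>Extended by the identity, so that unmatched points become fixed points of an involution
  defined on the whole type. The ends of a path can then be counted as fixed points.\<close>

definition partner :: "'v set set \<Rightarrow> 'v \<Rightarrow> 'v" where
  "partner E x = (if x \<in> \<Union>E then THE y. {x, y} \<in> E \<and> y \<noteq> x else x)"

lemma pairing_Union: "pairing X E \<Longrightarrow> \<Union>E = X"
  by (simp add: pairing_def partition_on_def)

lemma pairing_eq: "pairing X E \<Longrightarrow> P \<in> E \<Longrightarrow> Q \<in> E \<Longrightarrow> x \<in> P \<Longrightarrow> x \<in> Q \<Longrightarrow> P = Q"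
  by (auto simp: pairing_def partition_on_def disjoint_def)

lemma pairing_card: "pairing X E \<Longrightarrow> P \<in> E \<Longrightarrow> card P = 2"
  by (simp add: pairing_def)

lemma pairingI:
  assumes "\<Union>E = X" "\<And>P. P \<in> E \<Longrightarrow> card P = 2"
    "\<And>P Q x. P \<in> E \<Longrightarrow> Q \<in> E \<Longrightarrow> x \<in> P \<Longrightarrow> x \<in> Q \<Longrightarrow> P = Q"
  shows "pairing X E"
proof -
  have "{} \<notin> E" using assms(2) by fastforce
  moreover have "disjoint E" unfolding disjoint_def using assms(3) by (metis disjoint_iff)
  ultimately show ?thesis using assms(1,2) by (simp add: pairing_def partition_on_def)
qed

lemma pairing_edge:
  assumes "pairing X E" "x \<in> X"
  shows "{x, partner E x} \<in> E \<and> partner E x \<noteq> x"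
proof -
  have "x \<in> \<Union>E" using assms(2) pairing_Union[OF assms(1)] by simp
  then obtain P where P: "P \<in> E" "x \<in> P" by auto
  then obtain a b where ab: "P = {a, b}" "a \<noteq> b"
    using pairing_card[OF assms(1) P(1)] by (auto simp: card_2_iff)
  define y where "y = (if x = a then b else a)"
  have y: "P = {x, y}" "y \<noteq> x" using P ab by (auto simp: y_def)
  have u: "z = y" if "{x, z} \<in> E \<and> z \<noteq> x" for z
  proof -
    have "{x, z} = P" using pairing_eq[OF assms(1) _ P(1), of "{x, z}" x] that P(2) by simp
    then show ?thesis using y that by (simp add: doubleton_eq_iff)
  qed
  have "partner E x = (THE y. {x, y} \<in> E \<and> y \<noteq> x)" using \<open>x \<in> \<Union>E\<close> by (simp add: partner_def)
  also have "\<dots> = y"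
  proof (rule the_equality)
    show "{x, y} \<in> E \<and> y \<noteq> x" using P y by simp
  qed (rule u)
  finally show ?thesis using P y by simp
qed

lemma partner_out: "pairing X E \<Longrightarrow> x \<notin> X \<Longrightarrow> partner E x = x"
  using pairing_Union by (auto simp: partner_def)

lemma partner_eq: 
  assumes "pairing X E" "P \<in> E" "x \<in> P"
  shows "P = {x, partner E x}"
proof -
  have "x \<in> X" using assms pairing_Union by auto
  then show ?thesis using pairing_edge[OF assms(1)] pairing_eq[OF assms(1,2) _ assms(3)] by simp
qed

lemma partner_partner: 
  assumes "pairing X E"
  shows "partner E (partner E x) = x"
proof (cases "x \<in> X")
  case True
  note e = pairing_edge[OF assms True]
  then have "{x, partner E x} = {partner E x, partner E (partner E x)}"
    using partner_eq[OF assms, of "{x, partner E x}" "partner E x"] by simp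
  then show ?thesis using e by (auto simp: doubleton_eq_iff)
qed (simp add: partner_out[OF assms])

lemma partner_fix: "pairing X E \<Longrightarrow> partner E x = x \<longleftrightarrow> x \<notin> X"
  using pairing_edge partner_out by metis

lemma partner_in: "pairing X E \<Longrightarrow> partner E x \<in> X \<longleftrightarrow> x \<in> X"
  by (metis partner_fix partner_partner)

section \<open>Orbits of two involutions and the ends of a path\<close>

lemma twice_mod_solutions:
  assumes "(n::nat) \<ge> 2"
  shows "{k. k < n \<and> (n dvd 2 * k \<or> n dvd 2 * k + (n - 1))} = {0, (n + 1) div 2}"
proof (intro Set.set_eqI iffI)
  fix k assume "k \<in> {k. k < n \<and> (n dvd 2 * k \<or> n dvd 2 * k + (n - 1))}"
  then have k: "k < n" "n dvd 2 * k \<or> n dvd 2 * k + (n - 1)" by auto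
  from k(2) show "k \<in> {0, (n + 1) div 2}"
  proof
    assume "n dvd 2 * k"
    then obtain c where c: "2 * k = n * c" by auto
    then have "n * c < n * 2" using k(1) by linarith
    then have "c < 2" by (simp only: mult_less_cancel1)
    then have "c = 0 \<or> c = 1" by auto
    then show ?thesis using c assms by auto
  next
    assume "n dvd 2 * k + (n - 1)"
    then obtain c where c: "2 * k + (n - 1) = n * c" by auto
    then have "n * c < n * 3" using k(1) assms by linarith
    then have "c < 3" by (simp only: mult_less_cancel1)
    moreover have "c \<noteq> 0" using c assms by (intro notI) simp
    ultimately have "c = 1 \<or> c = 2" by auto
    then show ?thesis using c assms by auto
  qed
next
  fix k assume "k \<in> {0, (n + 1) div 2}"
  then consider "k = 0" | "k = (n + 1) div 2" by auto
  then show "k \<in> {k. k < n \<and> (n dvd 2 * k \<or> n dvd 2 * k + (n - 1))}"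
  proof cases
    case 2
    show ?thesis
    proof (cases "even n")
      case True
      then have "2 * k = n" using 2 by auto
      then show ?thesis using assms by auto
    next
      case False
      then have "2 * k + (n - 1) = n * 2" using 2 assms by (auto elim!: oddE)
      then show ?thesis using 2 assms by simp
    qed
  qed (use assms in simp)
qed

text \<open>The orbit of a fixed point \<open>u\<close> of \<open>\<alpha>\<close> under the dihedral group generated by the involutions
  \<open>\<alpha>\<close> and \<open>\<beta>\<close> consists of the points \<open>(\<beta> \<alpha>)\<^sup>k u\<close> for \<open>k < n\<close>; such a point is fixed by \<open>\<alpha>\<close> iff
  \<open>2 k = 0\<close> and by \<open>\<beta>\<close> iff \<open>2 k = 1\<close> modulo \<open>n\<close>.\<close>

lemma dihedral_orbit:
  fixes \<alpha> \<beta> :: "'v \<Rightarrow> 'v"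
  assumes inv: "\<And>x. \<alpha> (\<alpha> x) = x" "\<And>x. \<beta> (\<beta> x) = x"
    and S: "finite S" "\<And>x. x \<in> S \<Longrightarrow> \<alpha> x \<in> S" "\<And>x. x \<in> S \<Longrightarrow> \<beta> x \<in> S" "u \<in> S"
    and u: "\<alpha> u = u" "\<beta> u \<noteq> u"
    and C: "C = range (\<lambda>k. ((\<beta> \<circ> \<alpha>) ^^ k) u)"
  shows "x \<in> C \<Longrightarrow> \<alpha> x \<in> C" "x \<in> C \<Longrightarrow> \<beta> x \<in> C" "card {x \<in> C. \<alpha> x = x \<or> \<beta> x = x} = 2"
proof -
  define \<rho> where "\<rho> = \<beta> \<circ> \<alpha>"
  have inj: "inj (\<rho> ^^ k)" for k
  proof (rule inj_fn)
    show "inj \<rho>" by (rule inj_on_inverseI[of _ "\<alpha> \<circ> \<beta>"]) (simp add: \<rho>_def inv)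
  qed
  have inS: "(\<rho> ^^ k) u \<in> S" for k
    by (induction k) (auto simp: \<rho>_def S)
  have "\<not> inj (\<lambda>k. (\<rho> ^^ k) u)"
    using finite_subset[OF _ S(1), of "range (\<lambda>k. (\<rho> ^^ k) u)"] inS
    by (auto dest: finite_imageD)
  then obtain i j where ij: "i < j" "(\<rho> ^^ i) u = (\<rho> ^^ j) u"
    by (auto simp: inj_def) (metis linorder_neqE_nat)
  have "(\<rho> ^^ i) ((\<rho> ^^ (j - i)) u) = (\<rho> ^^ (i + (j - i))) u"
    by (simp only: funpow_add comp_apply)
  also have "\<dots> = (\<rho> ^^ i) u" using ij by simp
  finally have "(\<rho> ^^ (j - i)) u = u" using inj by (auto dest: injD)
  then have ex: "\<exists>n>0. (\<rho> ^^ n) u = u" using ij(1) by (intro exI[of _ "j - i"]) auto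
  define n where "n = (LEAST n. n > 0 \<and> (\<rho> ^^ n) u = u)"
  have n: "n > 0" "(\<rho> ^^ n) u = u"
    using LeastI_ex[OF ex] by (auto simp: n_def)
  have per: "(\<rho> ^^ k) u = u \<longleftrightarrow> n dvd k" for k
  proof
    assume "n dvd k"
    then show "(\<rho> ^^ k) u = u" using funpow_mod_eq[OF n(2), of k] by simp
  next
    assume "(\<rho> ^^ k) u = u"
    then have "(\<rho> ^^ (k mod n)) u = u" using funpow_mod_eq[OF n(2), of k] by simp
    moreover have "k mod n < n" using n by simp
    ultimately have "k mod n = 0"
      using not_less_Least[of "k mod n" "\<lambda>n. n > 0 \<and> (\<rho> ^^ n) u = u"] by (auto simp: n_def)
    then show "n dvd k" by auto
  qed
  have add: "(\<rho> ^^ i) ((\<rho> ^^ j) u) = (\<rho> ^^ (i + j)) u" for i j by (simp add: funpow_add)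
  have n2: "n \<ge> 2"
  proof (rule ccontr)
    assume "\<not> n \<ge> 2"
    then have "n = 1" using n(1) by simp
    with n(2) show False using u by (simp add: \<rho>_def)
  qed
  \<comment> \<open>A reflection conjugates the rotation \<open>\<rho>\<close> to its inverse; this
    form of the relation avoids inverse powers.\<close>
  have \<rho>\<alpha>: "\<rho> (\<alpha> (\<rho> x)) = \<alpha> x" for x by (simp add: \<rho>_def inv)
  have A: "(\<rho> ^^ k) (\<alpha> ((\<rho> ^^ k) u)) = u" for k
  proof (induction k)
    case (Suc k)
    have "(\<rho> ^^ Suc k) (\<alpha> ((\<rho> ^^ Suc k) u)) = (\<rho> ^^ k) (\<rho> (\<alpha> (\<rho> ((\<rho> ^^ k) u))))"
      by (simp add: funpow_swap1)
    then show ?case using Suc \<rho>\<alpha> by simp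
  qed (simp add: u)
  have \<beta>\<rho>: "\<beta> x = \<rho> (\<alpha> x)" for x by (simp add: \<rho>_def inv)
  have B: "(\<rho> ^^ k) (\<beta> ((\<rho> ^^ k) u)) = \<rho> u" for k
    using A[of k] by (simp add: \<beta>\<rho> funpow_swap1[of \<rho> k, symmetric])
  have fixA: "\<alpha> ((\<rho> ^^ k) u) = (\<rho> ^^ k) u \<longleftrightarrow> n dvd 2 * k" for k
  proof -
    have "\<alpha> ((\<rho> ^^ k) u) = (\<rho> ^^ k) u \<longleftrightarrow> (\<rho> ^^ k) (\<alpha> ((\<rho> ^^ k) u)) = (\<rho> ^^ k) ((\<rho> ^^ k) u)"
      using inj[of k] by (simp add: inj_eq)
    also have "\<dots> \<longleftrightarrow> (\<rho> ^^ (2 * k)) u = u" using A add[of k k] by (auto simp: mult_2)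
    finally show ?thesis using per by simp
  qed
  have fixB: "\<beta> ((\<rho> ^^ k) u) = (\<rho> ^^ k) u \<longleftrightarrow> n dvd 2 * k + (n - 1)" for k
  proof -
    \<comment> \<open>On the orbit the power \<open>n - 1\<close> of \<open>\<rho>\<close> acts as
      its inverse, which turns the condition 2 k = 1 modulo \<open>n\<close> into a divisibility
      without subtraction.\<close>
    have r: "(\<rho> ^^ (n - 1)) (\<rho> u) = u" using n add[of "n - 1" 1] by simp
    have "\<beta> ((\<rho> ^^ k) u) = (\<rho> ^^ k) u \<longleftrightarrow> (\<rho> ^^ k) (\<beta> ((\<rho> ^^ k) u)) = (\<rho> ^^ k) ((\<rho> ^^ k) u)"
      using inj[of k] by (simp add: inj_eq)
    also have "\<dots> \<longleftrightarrow> \<rho> u = (\<rho> ^^ (2 * k)) u" using B add[of k k] by (auto simp: mult_2)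
    also have "\<dots> \<longleftrightarrow> (\<rho> ^^ (n - 1)) (\<rho> u) = (\<rho> ^^ (n - 1)) ((\<rho> ^^ (2 * k)) u)"
      using inj[of "n - 1"] by (simp add: inj_eq)
    also have "\<dots> \<longleftrightarrow> (\<rho> ^^ (2 * k + (n - 1))) u = u"
      using r add[of "n - 1" "2 * k"] by (auto simp: add.commute)
    finally show ?thesis using per by simp
  qed
  have C': "C = range (\<lambda>k. (\<rho> ^^ k) u)" by (simp add: C \<rho>_def)
  have clA: "\<alpha> x \<in> C" if "x \<in> C" for x
  proof -
    obtain k where k: "x = (\<rho> ^^ k) u" using \<open>x \<in> C\<close> C' by auto
    \<comment> \<open>The exponent \<open>n * k - k\<close> is a natural number representing -k
      modulo \<open>n\<close>.\<close>
    have "(\<rho> ^^ k) ((\<rho> ^^ (n * k - k)) u) = (\<rho> ^^ (n * k)) u" using add[of k] n(1) by simp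
    also have "\<dots> = (\<rho> ^^ k) (\<alpha> x)" using A[of k] per[of "n * k"] by (simp add: k)
    finally have "\<alpha> x = (\<rho> ^^ (n * k - k)) u" using inj[of k] by (simp add: inj_eq)
    then show ?thesis by (simp add: C')
  qed
  then show "x \<in> C \<Longrightarrow> \<alpha> x \<in> C" .
  show "\<beta> x \<in> C" if xC: "x \<in> C"
  proof -
    obtain k where "\<alpha> x = (\<rho> ^^ k) u" using clA[OF xC] C' by auto
    then have "\<beta> x = (\<rho> ^^ Suc k) u" by (simp add: \<beta>\<rho>)
    then show ?thesis unfolding C' by (rule range_eqI)
  qed
  have Cn: "C = (\<lambda>k. (\<rho> ^^ k) u) ` {k. k < n}"
  proof (intro subset_antisym subsetI)
    fix x assume "x \<in> C"
    then obtain k where "x = (\<rho> ^^ k) u" using C' by auto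
    then have "x = (\<rho> ^^ (k mod n)) u" using funpow_mod_eq[OF n(2), of k] by simp
    then show "x \<in> (\<lambda>k. (\<rho> ^^ k) u) ` {k. k < n}" using n(1) by (intro image_eqI[of _ _ "k mod n"]) auto
  qed (auto simp: C')
  have injn: "inj_on (\<lambda>k. (\<rho> ^^ k) u) {k. k < n}"
  proof (rule linorder_inj_onI)
    fix i j assume ij: "i < j" "i \<in> {k. k < n}" "j \<in> {k. k < n}"
    show "(\<rho> ^^ i) u \<noteq> (\<rho> ^^ j) u"
    proof
      assume "(\<rho> ^^ i) u = (\<rho> ^^ j) u"
      then have "(\<rho> ^^ i) u = (\<rho> ^^ i) ((\<rho> ^^ (j - i)) u)" using ij(1) add[of i "j - i"] by simp
      then have "(\<rho> ^^ (j - i)) u = u" using inj[of i] by (simp add: inj_eq)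
      then have "n dvd j - i" using per by simp
      then show False using ij by (auto dest: dvd_imp_le)
    qed
  qed auto
  have "{x \<in> C. \<alpha> x = x \<or> \<beta> x = x} = (\<lambda>k. (\<rho> ^^ k) u) ` {k. k < n \<and> (n dvd 2 * k \<or> n dvd 2 * k + (n - 1))}"
    unfolding Cn Compr_image_eq by (simp add: fixA fixB)
  \<comment> \<open>The exponent 0 gives the starting end \<open>u\<close>. The other end is at n/2
    if \<open>n\<close> is even, where 2 k = 0, and at (n+1)/2 if \<open>n\<close> is odd, where 2 k
    = 1 modulo \<open>n\<close>.\<close>
  also have "\<dots> = (\<lambda>k. (\<rho> ^^ k) u) ` {0, (n + 1) div 2}"
    by (simp only: twice_mod_solutions[OF n2])
  also have "card \<dots> = card {0, (n + 1) div 2}"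
    by (rule card_image, rule inj_on_subset[OF injn]) (use n2 in auto)
  also have "\<dots> = 2" using n2 by simp
  finally show "card {x \<in> C. \<alpha> x = x \<or> \<beta> x = x} = 2" .
qed

text \<open>The component of \<open>u\<close> is a path alternating between the two matchings and
  starting at \<open>u\<close>, which only \<open>F\<close> matches. As a set it is the orbit of
  \<open>u\<close> under the two partner involutions, and the points outside
  \<open>X \<inter> Y\<close> are those fixed by one of them. The case of an end matched only by
  \<open>E\<close> follows by symmetry.\<close>

lemma block_outer_card_aux:
  assumes E: "pairing X E" "finite X" and F: "pairing Y F" "finite Y"
    and C: "C \<in> blocks (E \<union> F)" "u \<in> C" "u \<notin> X"
  shows "card (C - X \<inter> Y) = 2"
proof -
  let ?a = "partner E" and ?b = "partner F"
  have XY: "\<Union>(E \<union> F) = X \<union> Y" using pairing_Union[OF E(1)] pairing_Union[OF F(1)] by simp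
  have uY: "u \<in> Y" using C XY blocks_sub[OF C(1)] by auto
  define Orb where "Orb = range (\<lambda>k. ((?b \<circ> ?a) ^^ k) u)"
  note inv = partner_partner[OF E(1)] partner_partner[OF F(1)]
  have S: "x \<in> X \<union> Y \<Longrightarrow> ?a x \<in> X \<union> Y" "x \<in> X \<union> Y \<Longrightarrow> ?b x \<in> X \<union> Y" for x
    using partner_in[OF E(1), of x] partner_out[OF E(1), of x] partner_in[OF F(1), of x] partner_out[OF F(1), of x]
    by auto
  have u: "?a u = u" "?b u \<noteq> u" "u \<in> X \<union> Y"
    using partner_fix[OF E(1)] partner_fix[OF F(1)] C(3) uY by auto
  note dih = dihedral_orbit[OF inv _ S u(3,1,2) Orb_def, simplified]
  have cl: "x \<in> Orb \<Longrightarrow> ?a x \<in> Orb" "x \<in> Orb \<Longrightarrow> ?b x \<in> Orb" for x using dih E F by auto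
  have card: "card {x \<in> Orb. ?a x = x \<or> ?b x = x} = 2" using dih E F by auto
  have ca: "conn (E \<union> F) x (?a x)" "conn (E \<union> F) x (?b x)" if "x \<in> X \<union> Y" for x
  proof -
    have r: "conn (E \<union> F) x x" using that XY by (intro conn_refl) simp
    show "conn (E \<union> F) x (?a x)"
    proof (cases "x \<in> X")
      case True
      with pairing_edge[OF E(1) True] show ?thesis by (intro conn.edge[of "{x, ?a x}"]) auto
    qed (use r partner_out[OF E(1)] in simp)
    show "conn (E \<union> F) x (?b x)"
    proof (cases "x \<in> Y")
      case True
      with pairing_edge[OF F(1) True] show ?thesis by (intro conn.edge[of "{x, ?b x}"]) auto
    qed (use r partner_out[OF F(1)] in simp)
  qed
  have "conn (E \<union> F) u (((?b \<circ> ?a) ^^ k) u)" for k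
  proof (induction k)
    case 0
    then show ?case using u(3) XY by (simp add: conn_refl)
  next
    case (Suc k)
    let ?y = "((?b \<circ> ?a) ^^ k) u"
    have "?y \<in> X \<union> Y" by (rule conn_in[OF Suc, THEN conjunct2, unfolded XY])
    then have "conn (E \<union> F) ?y (?a ?y)" "conn (E \<union> F) (?a ?y) (?b (?a ?y))"
      using ca(1)[of ?y] ca(2)[of "?a ?y"] S(1)[of ?y] by simp_all
    note c = conn_trans[OF this(2) conn_trans[OF this(1) Suc]]
    have "((?b \<circ> ?a) ^^ Suc k) u = ?b (?a ?y)" by simp
    with c show ?case by (simp only:)
  qed
  then have sub1: "Orb \<subseteq> C" unfolding Orb_def using blocks_mem_iff[OF C(1,2)] by (intro image_subsetI) simp
  have uO: "u \<in> Orb" unfolding Orb_def by (rule range_eqI[of _ _ 0]) simp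
  \<comment> \<open>Any edge through a point leads to one of its two partners, so a set closed under
    both involutions is closed under connectedness.\<close>
  have "conn (E \<union> F) a x \<Longrightarrow> a \<in> Orb \<Longrightarrow> x \<in> Orb" for a x
  proof (induction rule: conn.induct)
    case (edge P u v)
    then have "P = {u, ?a u} \<or> P = {u, ?b u}"
      using partner_eq[OF E(1), of P u] partner_eq[OF F(1), of P u] by (metis UnE)
    then have "v = u \<or> v = ?a u \<or> v = ?b u" using edge(3) by (elim disjE) auto
    then show ?case using cl[OF edge(4)] edge(4) by (elim disjE) simp_all
  next
    case (step a u P v)
    then have "P = {u, ?a u} \<or> P = {u, ?b u}"
      using partner_eq[OF E(1), of P u] partner_eq[OF F(1), of P u] by (metis UnE)
    then have "v = u \<or> v = ?a u \<or> v = ?b u" using step(4) by (elim disjE) auto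
    moreover have "u \<in> Orb" using step by simp
    ultimately show ?case using cl[of u] by (elim disjE) simp_all
  qed
  then have "C \<subseteq> Orb" using uO blocks_mem_iff[OF C(1,2)] by (intro subsetI) simp
  with sub1 have "C = Orb" by simp
  then have "C - X \<inter> Y = {x \<in> Orb. ?a x = x \<or> ?b x = x}"
    using partner_fix[OF E(1)] partner_fix[OF F(1)] by auto
  with card show ?thesis by simp
qed

lemma block_outer_card:
  assumes "pairing X E" "finite X" "pairing Y F" "finite Y" "C \<in> blocks (E \<union> F)" "\<not> C \<subseteq> X \<inter> Y"
  shows "card (C - X \<inter> Y) = 2"
proof -
  obtain u where u: "u \<in> C" "u \<notin> X \<or> u \<notin> Y" using assms by auto
  then show ?thesis
    using block_outer_card_aux[OF assms(1-5)] block_outer_card_aux[OF assms(3,4,1,2), of C] assms(5)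
    by (auto simp: Un_commute Int_commute)
qed

section \<open>The composite as a perfect matching\<close>

lemma pairing_image:
  assumes "pairing X E" "inj_on \<phi> X"
  shows "pairing (\<phi> ` X) ((`) \<phi> ` E)"
proof (rule pairingI)
  have sub: "P \<subseteq> X" if "P \<in> E" for P using that pairing_Union[OF assms(1)] by auto
  show "\<Union>((`) \<phi> ` E) = \<phi> ` X" using pairing_Union[OF assms(1)] by auto
  show "card P = 2" if "P \<in> (`) \<phi> ` E" for P
  proof -
    from that obtain P' where P: "P = \<phi> ` P'" "P' \<in> E" by (rule imageE)
    then show ?thesis
      using card_image[OF inj_on_subset[OF assms(2) sub[OF P(2)]]] pairing_card[OF assms(1)] by simp
  qed
  fix P Q x assume "P \<in> (`) \<phi> ` E" "Q \<in> (`) \<phi> ` E" "x \<in> P" "x \<in> Q"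
  then obtain P' Q' y z where *: "P' \<in> E" "Q' \<in> E" "P = \<phi> ` P'" "Q = \<phi> ` Q'" "y \<in> P'" "z \<in> Q'" "\<phi> y = \<phi> z"
    by auto
  then have "y = z" using assms(2) sub by (auto dest: inj_onD)
  then show "P = Q" using * pairing_eq[OF assms(1), of P' Q' y] by simp
qed

lemma brauer_pairing: "D \<in> brauer p q \<longleftrightarrow> pairing (points p q) D"
  by (simp add: brauer_def pairing_def)

lemma finite_points: "finite (points p q)"
  by (simp add: points_def)

lemma brauer_finite_Union: "D \<in> brauer p q \<Longrightarrow> finite (\<Union>D)"
  by (simp add: brauer_pairing pairing_Union finite_points)

lemma inj_in_upper: "inj in_upper"
  by (rule injI, rename_tac x y, case_tac x; case_tac y) auto

lemma inj_in_lower: "inj in_lower"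
  by (rule injI, rename_tac x y, case_tac x; case_tac y) auto

lemma inj_outer: "inj outer"
  by (rule injI, rename_tac x y, case_tac x; case_tac y) auto

lemma in_upper_points: "in_upper ` points p q = Upper ` {1..p} \<union> Mid ` {1..q}"
  by (simp add: points_def image_Un image_image)

lemma in_lower_points: "in_lower ` points p q = Mid ` {1..p} \<union> Lower ` {1..q}"
  by (simp add: points_def image_Un image_image)

lemma hat_comp_closed:
  assumes f: "f \<in> brauer q s" and g: "g \<in> brauer p q"
  shows "hat_comp f g \<in> brauer p s"
proof -
  let ?X = "in_upper ` points p q" and ?Y = "in_lower ` points q s"
  have E: "pairing ?X ((`) in_upper ` g)" "finite ?X"
    using pairing_image[of "points p q" g in_upper] g inj_in_upper
    by (auto simp: brauer_pairing finite_points intro: inj_on_subset)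
  have F: "pairing ?Y ((`) in_lower ` f)" "finite ?Y"
    using pairing_image[of "points q s" f in_lower] f inj_in_lower
    by (auto simp: brauer_pairing finite_points intro: inj_on_subset)
  have st: "stack f g = (`) in_upper ` g \<union> (`) in_lower ` f" by (simp add: stack_def)
  have U: "\<Union>(stack f g) = ?X \<union> ?Y" using pairing_Union[OF E(1)] pairing_Union[OF F(1)] by (simp add: st)
  have I: "?X \<inter> ?Y = Mid ` {1..q}" by (auto simp: in_upper_points in_lower_points)
  \<comment> \<open>The target of \<open>g\<close> is the source of \<open>f\<close>, so the middle
    vertices occurring in the stack are precisely those matched on both sides. This identifies the
    loops with the components inside \<open>?X \<inter> ?Y\<close>.\<close>
  have mid: "C - range Mid = C - ?X \<inter> ?Y" "C \<subseteq> range Mid \<longleftrightarrow> C \<subseteq> ?X \<inter> ?Y" if "C \<in> components f g" for C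
  proof -
    have "C \<subseteq> ?X \<union> ?Y" using that blocks_sub U by (metis components_eq)
    then have "C \<inter> range Mid \<subseteq> ?X \<inter> ?Y" by (auto simp: in_upper_points in_lower_points)
    then show "C - range Mid = C - ?X \<inter> ?Y" "C \<subseteq> range Mid \<longleftrightarrow> C \<subseteq> ?X \<inter> ?Y"
      unfolding I by auto
  qed
  have mem: "Q \<in> hat_comp f g \<longleftrightarrow> (\<exists>C \<in> components f g. \<not> C \<subseteq> range Mid \<and> Q = outer -` C)" for Q
    by (auto simp: hat_comp_def loops_def)
  have "pairing (points p s) (hat_comp f g)"
  proof (rule pairingI)
    show "\<Union>(hat_comp f g) = points p s"
    proof (intro Set.set_eqI iffI)
      fix x assume "x \<in> \<Union>(hat_comp f g)"
      then obtain Q where Q: "Q \<in> hat_comp f g" "x \<in> Q" by (rule UnionE)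
      from Q(1) obtain C where C: "C \<in> components f g" "Q = outer -` C" unfolding mem by (elim bexE conjE)
      then have "outer x \<in> \<Union>(stack f g)" using Q(2) blocks_sub[of C "stack f g"] by (auto simp: components_eq)
      then have "outer x \<in> ?X \<union> ?Y" by (simp only: U)
      then show "x \<in> points p s"
        by (cases x) (auto simp: in_upper_points in_lower_points points_def)
    next
      fix x assume x: "x \<in> points p s"
      then have "outer x \<in> \<Union>(stack f g)" unfolding U in_upper_points in_lower_points
        by (cases x) (auto simp: points_def)
      then obtain C where C: "C \<in> components f g" "outer x \<in> C"
        using block_ex[of "outer x" "stack f g"] unfolding components_eq by auto
      have "outer x \<notin> range Mid" using range_outer by auto
      then show "x \<in> \<Union>(hat_comp f g)" using C by (intro UnionI[of "outer -` C"]) (auto simp: mem)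
    qed
    fix Q assume "Q \<in> hat_comp f g"
    then obtain C where C: "C \<in> components f g" "\<not> C \<subseteq> range Mid" "Q = outer -` C"
      unfolding mem by (elim bexE conjE)
    have "card Q = card (outer ` Q)" using inj_outer by (metis card_image inj_on_subset subset_UNIV)
    also have "outer ` Q = C - range Mid" unfolding C(3) by (simp add: image_vimage_eq range_outer Diff_eq)
    also have "\<dots> = C - ?X \<inter> ?Y" using mid C by simp
    also have "card \<dots> = 2"
      by (rule block_outer_card[OF E F]) (use C mid in \<open>auto simp: components_eq st\<close>)
    finally show "card Q = 2" .
  next
    fix P Q x assume "P \<in> hat_comp f g" "Q \<in> hat_comp f g" "x \<in> P" "x \<in> Q"
    then obtain C D where *: "C \<in> components f g" "D \<in> components f g" "P = outer -` C" "Q = outer -` D"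
      unfolding mem by (elim bexE conjE)
    then have "C = D" using \<open>x \<in> P\<close> \<open>x \<in> Q\<close> blocks_eqI[of C "stack f g" D "outer x"]
      by (simp add: components_eq)
    with * show "P = Q" by simp
  qed
  then show ?thesis by (simp add: brauer_pairing)
qed

lemma hat_comp_memI:
  assumes "f \<in> brauer q s" "g \<in> brauer p q" "conn (stack f g) (outer x) (outer y)" "x \<noteq> y"
  shows "{x, y} \<in> hat_comp f g"
proof -
  have "outer x \<in> \<Union>(stack f g)" using conn_in[OF assms(3)] by simp
  then obtain C where C: "C \<in> components f g" "outer x \<in> C"
    using block_ex[of "outer x" "stack f g"] unfolding components_eq by auto
  then have y: "outer y \<in> C"
    using assms(3) blocks_mem_iff[of C "stack f g" "outer x" "outer y"] by (simp add: components_eq)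
  have "outer x \<notin> range Mid" using range_outer by auto
  with C have m: "outer -` C \<in> hat_comp f g" by (auto simp: hat_comp_def loops_def)
  then have "card (outer -` C) = 2"
    using hat_comp_closed[OF assms(1,2)] by (simp add: brauer_def)
  moreover have "{x, y} \<subseteq> outer -` C" using C y by simp
  ultimately have "{x, y} = outer -` C" using assms(4) by (intro card_subset_eq) (auto intro: card_ge_0_finite)
  with m show ?thesis by simp
qed

lemma brauer_subset_eq:
  assumes "D \<in> brauer p q" "D' \<in> brauer p q" "D \<subseteq> D'"
  shows "D = D'"
proof (intro subset_antisym assms(3) subsetI)
  fix P assume P: "P \<in> D'"
  then obtain x where x: "x \<in> P" using assms(2) by (fastforce simp: brauer_def)
  moreover have "\<Union>D = \<Union>D'"
    using assms(1,2) pairing_Union[of "points p q"] by (simp add: brauer_pairing)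
  ultimately have "x \<in> \<Union>D" using P by auto
  then obtain Q where "Q \<in> D" "x \<in> Q" by auto
  then have "Q = P" using assms P x pairing_eq[of "points p q" D' Q P x] by (auto simp: brauer_pairing)
  with \<open>Q \<in> D\<close> show "P \<in> D" by simp
qed

text \<open>A perfect matching contained in another one equals it. To compute a composite it is
  therefore enough to connect the two ends of each pair of a candidate; the other components need no
  inspection.\<close>

lemma hat_comp_eqI:
  assumes "f \<in> brauer q s" "g \<in> brauer p q" "D \<in> brauer p s"
    "\<And>x y. {x, y} \<in> D \<Longrightarrow> x \<noteq> y \<Longrightarrow> conn (stack f g) (outer x) (outer y)"
  shows "hat_comp f g = D"
proof (rule brauer_subset_eq[symmetric, OF assms(3) hat_comp_closed[OF assms(1,2)]], rule subsetI)
  fix P assume P: "P \<in> D"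
  then have "card P = 2" using assms(3) by (simp add: brauer_def)
  then obtain x y where "P = {x, y}" "x \<noteq> y" by (auto simp: card_2_iff)
  then show "P \<in> hat_comp f g" using hat_comp_memI[OF assms(1,2)] assms(4) P by simp
qed

section \<open>Upward diagrams\<close>

lemma flip_point_flip_point [simp]: "flip_point (flip_point x) = x"
  by (cases x) auto

lemma inj_flip_point: "inj flip_point"
  by (metis flip_point_flip_point injI)

lemma flip_flip [simp]: "flip (flip D) = D"
  by (simp add: flip_def image_image)

lemma flip_points: "flip_point ` points p q = points q p"
  by (auto simp: points_def image_Un image_image)

lemma flip_brauer: 
  assumes "D \<in> brauer p q"
  shows "flip D \<in> brauer q p"
  using pairing_image[of "points p q" D flip_point] inj_flip_point assms
  by (simp add: brauer_pairing flip_points flip_def inj_on_subset)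

lemma flip_point_Top_iff: "flip_point ` P \<subseteq> range Top \<longleftrightarrow> P \<subseteq> range Bot"
proof -
  have "flip_point x \<in> range Top \<longleftrightarrow> x \<in> range Bot" for x by (cases x) auto
  then show ?thesis by (simp only: image_subset_iff subset_iff[of P] Ball_def)
qed

lemma flip_point_Bot_iff: "flip_point ` P \<subseteq> range Bot \<longleftrightarrow> P \<subseteq> range Top"
proof -
  have "flip_point x \<in> range Bot \<longleftrightarrow> x \<in> range Top" for x by (cases x) auto
  then show ?thesis by (simp only: image_subset_iff subset_iff[of P] Ball_def)
qed

lemma upward_flip [simp]: "upward (flip D) \<longleftrightarrow> downward D"
  by (simp add: upward_def downward_def flip_def flip_point_Top_iff)

lemma downward_flip [simp]: "downward (flip D) \<longleftrightarrow> upward D"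
  by (simp add: upward_def downward_def flip_def flip_point_Bot_iff)

lemma level_flip [simp]: "level (flip D) \<longleftrightarrow> level D"
  by (auto simp: level_def)

lemma img_flip: "img a b (flip D) = img b a D"
proof -
  have "place a b (flip_point x) = place b a x" for x by (cases x) auto
  then show ?thesis by (simp add: img_def flip_def image_image)
qed

lemma flip_hat_comp: "flip (hat_comp f g) = hat_comp (flip g) (flip f)"
proof -
  note ap = apart_track
  have "img (track 0) (track 2) (flip (hat_comp f g)) = 
    reduct (range (track 1)) (img (track 2) (track 1) g \<union> img (track 1) (track 0) f)"
    unfolding img_flip by (rule hat_comp_img) (simp_all add: ap)
  also have "\<dots> = reduct (range (track 1)) (img (track 0) (track 1) (flip f) \<union> img (track 1) (track 2) (flip g))"
    unfolding img_flip by (simp add: Un_commute)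
  also have "\<dots> = img (track 0) (track 2) (hat_comp (flip g) (flip f))"
    by (rule hat_comp_img[symmetric]) (simp_all add: ap)
  finally show ?thesis using inj_img[OF ap, of 0 2] by (simp add: inj_eq)
qed

lemma num_loops_flip: "num_loops (flip g) (flip f) = num_loops f g"
proof -
  note ap = apart_track
  have "num_loops (flip g) (flip f) = 
    card {C \<in> blocks (img (track 0) (track 1) (flip f) \<union> img (track 1) (track 2) (flip g)). C \<subseteq> range (track 1)}"
    by (rule num_loops_img) (simp_all add: ap)
  also have "\<dots> = card {C \<in> blocks (img (track 2) (track 1) g \<union> img (track 1) (track 0) f). C \<subseteq> range (track 1)}"
    unfolding img_flip by (simp add: Un_commute)
  also have "\<dots> = num_loops f g"
    by (rule num_loops_img[symmetric]) (simp_all add: ap)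
  finally show ?thesis .
qed

lemma flip_brauer_up: "D \<in> brauer_up p q \<Longrightarrow> flip D \<in> brauer_down q p"
  by (simp add: brauer_up_def brauer_down_def flip_brauer)

lemma flip_brauer_down: "D \<in> brauer_down p q \<Longrightarrow> flip D \<in> brauer_up q p"
  by (simp add: brauer_up_def brauer_down_def flip_brauer)

lemma flip_brauer_level: "D \<in> brauer_level p q \<Longrightarrow> flip D \<in> brauer_level q p"
  by (simp add: brauer_level_def flip_brauer)

section \<open>Upward diagrams as an injection with a matching of the remaining bottom
  points\<close>

lemma pairing_Un:
  assumes "pairing X E" "pairing Y F" "X \<inter> Y = {}"
  shows "pairing (X \<union> Y) (E \<union> F)"
proof (rule pairingI)
  note U = pairing_Union[OF assms(1)] pairing_Union[OF assms(2)]
  show "\<Union>(E \<union> F) = X \<union> Y" by (simp add: U)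
  show "card P = 2" if "P \<in> E \<union> F" for P
    using that pairing_card[OF assms(1)] pairing_card[OF assms(2)] by auto
  fix P Q x assume a: "P \<in> E \<union> F" "Q \<in> E \<union> F" "x \<in> P" "x \<in> Q"
  have "x \<in> X" if "R \<in> E" "x \<in> R" for R using that U by auto
  moreover have "x \<in> Y" if "R \<in> F" "x \<in> R" for R using that U by auto
  ultimately have "P \<in> E \<and> Q \<in> E \<or> P \<in> F \<and> Q \<in> F" using a assms(3) by auto
  then show "P = Q" using a pairing_eq[OF assms(1)] pairing_eq[OF assms(2)] by metis
qed

lemma pairing_Diff:
  assumes "pairing X E" "E0 \<subseteq> E"
  shows "pairing (X - \<Union>E0) (E - E0)"
proof (rule pairingI)
  show "\<Union>(E - E0) = X - \<Union>E0"
  proof (intro Set.set_eqI iffI)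
    fix x assume "x \<in> \<Union>(E - E0)"
    then obtain P where P: "P \<in> E" "P \<notin> E0" "x \<in> P" by auto
    have "x \<notin> Q" if "Q \<in> E0" for Q
    proof
      assume "x \<in> Q"
      then have "P = Q" using pairing_eq[OF assms(1) P(1) _ P(3)] that assms(2) by auto
      with that P(2) show False by simp
    qed
    then show "x \<in> X - \<Union>E0" using P pairing_Union[OF assms(1)] by auto
  next
    fix x assume "x \<in> X - \<Union>E0"
    then show "x \<in> \<Union>(E - E0)" using pairing_Union[OF assms(1)] by auto
  qed
qed (use assms pairing_card[OF assms(1)] pairing_eq[OF assms(1)] in \<open>auto simp: subset_iff\<close>)

lemma pairing_even_card:
  assumes "pairing X E" "finite X"
  shows "even (card X)"
proof -
  have "card (\<Union>E) = sum card E"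
  proof (rule card_Union_disjoint)
    show "disjoint E" using assms(1) by (simp add: pairing_def partition_on_def)
    show "finite P" if "P \<in> E" for P using that pairing_card[OF assms(1)] by (intro card_ge_0_finite) simp
  qed
  also have "\<dots> = card E * 2" using pairing_card[OF assms(1)] by simp
  finally show ?thesis using pairing_Union[OF assms(1)] by simp
qed

definition strands :: "nat \<Rightarrow> nat \<Rightarrow> (nat \<Rightarrow> nat) \<Rightarrow> diagram \<Rightarrow> bool" where
  "strands q s J R \<longleftrightarrow> inj_on J {1..q} \<and> J ` {1..q} \<subseteq> {1..s} \<and> pairing (Bot ` ({1..s} - J ` {1..q})) R"

definition up_diagram :: "nat \<Rightarrow> (nat \<Rightarrow> nat) \<Rightarrow> diagram \<Rightarrow> diagram" where
  "up_diagram q J R = (\<lambda>i. {Top i, Bot (J i)}) ` {1..q} \<union> R"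

lemma strands_R_Bot:
  assumes "strands q s J R" "P \<in> R"
  shows "P \<subseteq> range Bot \<and> P \<noteq> {}"
proof -
  have R: "pairing (Bot ` ({1..s} - J ` {1..q})) R" using assms(1) by (simp add: strands_def)
  have "P \<subseteq> \<Union>R" using assms(2) by auto
  then have "P \<subseteq> range Bot" unfolding pairing_Union[OF R] by auto
  then show ?thesis using pairing_card[OF R assms(2)] by auto
qed

lemma pairing_strands:
  assumes "inj_on J {1..q}"
  shows "pairing (Top ` {1..q} \<union> Bot ` J ` {1..q}) ((\<lambda>i. {Top i, Bot (J i)}) ` {1..q})"
proof (rule pairingI)
  fix P Q x
  assume "P \<in> (\<lambda>i. {Top i, Bot (J i)}) ` {1..q}" "Q \<in> (\<lambda>i. {Top i, Bot (J i)}) ` {1..q}" "x \<in> P" "x \<in> Q"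
  then show "P = Q" using inj_onD[OF assms] by (cases x) auto
qed auto

lemma up_diagram_closed:
  assumes "strands q s J R"
  shows "up_diagram q J R \<in> brauer_up q s"
proof -
  have "pairing ((Top ` {1..q} \<union> Bot ` J ` {1..q}) \<union> Bot ` ({1..s} - J ` {1..q})) (up_diagram q J R)"
    unfolding up_diagram_def
  proof (rule pairing_Un)
    show "pairing (Top ` {1..q} \<union> Bot ` J ` {1..q}) ((\<lambda>i. {Top i, Bot (J i)}) ` {1..q})"
      using assms by (intro pairing_strands) (simp add: strands_def)
  qed (use assms in \<open>auto simp: strands_def\<close>)
  moreover have "(Top ` {1..q} \<union> Bot ` J ` {1..q}) \<union> Bot ` ({1..s} - J ` {1..q}) = points q s"
    using assms by (auto simp: strands_def points_def)
  moreover have "upward (up_diagram q J R)"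
    unfolding upward_def
  proof
    assume "\<exists>P\<in>up_diagram q J R. P \<subseteq> range Top"
    then obtain P where P: "P \<in> up_diagram q J R" "P \<subseteq> range Top" by auto
    then have "P \<notin> R" using strands_R_Bot[OF assms, of P] by auto
    then show False using P by (auto simp: up_diagram_def)
  qed
  ultimately show ?thesis by (simp add: brauer_up_def brauer_pairing)
qed

lemma up_diagram_ex:
  assumes "D \<in> brauer_up q s"
  obtains J R where "strands q s J R" "D = up_diagram q J R"
proof -
  have D: "pairing (points q s) D" "upward D" using assms by (auto simp: brauer_up_def brauer_pairing)
  have "\<exists>j. {Top i, Bot j} \<in> D" if "i \<in> {1..q}" for i
  proof -
    have e: "{Top i, partner D (Top i)} \<in> D"
      using pairing_edge[OF D(1), of "Top i"] that by (simp add: points_def)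
    show ?thesis
    proof (cases "partner D (Top i)")
      case (Top j)
      then have "{Top i, Top j} \<in> D" "{Top i, Top j} \<subseteq> range Top" using e by auto
      then show ?thesis using D(2) by (auto simp: upward_def)
    qed (use e in auto)
  qed
  then obtain J where J: "{Top i, Bot (J i)} \<in> D" if "i \<in> {1..q}" for i by metis
  define E0 where "E0 = (\<lambda>i. {Top i, Bot (J i)}) ` {1..q}"
  have sub: "E0 \<subseteq> D" using J by (auto simp: E0_def)
  have "inj_on J {1..q}"
  proof (rule inj_onI)
    fix i k assume ik: "i \<in> {1..q}" "k \<in> {1..q}" "J i = J k"
    have "{Top i, Bot (J i)} = {Top k, Bot (J k)}"
      by (rule pairing_eq[OF D(1) J[OF ik(1)] J[OF ik(2)], of "Bot (J i)"]) (use ik in auto)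
    then show "i = k" by (auto simp: doubleton_eq_iff)
  qed
  moreover have "J ` {1..q} \<subseteq> {1..s}"
  proof
    fix j assume "j \<in> J ` {1..q}"
    then obtain i where i: "i \<in> {1..q}" "j = J i" by auto
    then have "Bot j \<in> \<Union>D" using J[OF i(1)] by (intro UnionI[of "{Top i, Bot j}"]) auto
    then show "j \<in> {1..s}" unfolding pairing_Union[OF D(1)] by (auto simp: points_def)
  qed
  moreover have "pairing (Bot ` ({1..s} - J ` {1..q})) (D - E0)"
  proof -
    have "points q s - \<Union>E0 = Bot ` ({1..s} - J ` {1..q})"
      by (auto simp: points_def E0_def)
    then show ?thesis using pairing_Diff[OF D(1) sub] by simp
  qed
  ultimately have "strands q s J (D - E0)" by (simp add: strands_def)
  moreover have "D = up_diagram q J (D - E0)" using sub by (auto simp: up_diagram_def E0_def)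
  ultimately show ?thesis by (rule that)
qed

text \<open>The matching \<open>R\<close> is recovered as the set of pairs inside the bottom row.
  The injection is a total function, so it is determined only on \<open>{1..q}\<close>.\<close>

lemma up_diagram_unique:
  assumes "strands q s J R" "strands q s J' R'" "up_diagram q J R = up_diagram q J' R'"
  shows "R = R'" "i \<in> {1..q} \<Longrightarrow> J i = J' i"
proof -
  have char: "P \<in> R \<longleftrightarrow> P \<in> up_diagram q J R \<and> P \<subseteq> range Bot" if "strands q s J R" for J R P
    using strands_R_Bot[OF that, of P] by (auto simp: up_diagram_def)
  show "R = R'"
    by (rule Set.set_eqI) (simp only: char[OF assms(1)] char[OF assms(2)] assms(3))
  assume i: "i \<in> {1..q}"
  then have "{Top i, Bot (J i)} \<in> up_diagram q J R" unfolding up_diagram_def by (intro UnI1 imageI)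
  then have "{Top i, Bot (J i)} \<in> up_diagram q J' R'" by (simp only: assms(3))
  moreover have "{Top i, Bot (J i)} \<notin> R'" using strands_R_Bot[OF assms(2), of "{Top i, Bot (J i)}"] by auto
  ultimately obtain k where "{Top i, Bot (J i)} = {Top k, Bot (J' k)}" by (auto simp: up_diagram_def)
  then show "J i = J' i" by (auto simp: doubleton_eq_iff)
qed

lemma up_diagram_cong: "(\<And>i. i \<in> {1..q} \<Longrightarrow> J i = J' i) \<Longrightarrow> up_diagram q J R = up_diagram q J' R"
  unfolding up_diagram_def by (auto intro!: image_eqI)

text \<open>The bottom points missed by the strands are matched among themselves, which gives the
  parity.\<close>

lemma brauer_up_preceq: "D \<in> brauer_up t s \<Longrightarrow> t \<preceq>\<^sub>B s"
proof -
  assume "D \<in> brauer_up t s"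
  then obtain J R where s: "strands t s J R" by (rule up_diagram_ex)
  then have J: "card (J ` {1..t}) = t" "J ` {1..t} \<subseteq> {1..s}" by (auto simp: strands_def card_image)
  then have "t \<le> s" using card_mono[of "{1..s}" "J ` {1..t}"] by simp
  moreover have "card (Bot ` ({1..s} - J ` {1..t})) = s - t"
    using J by (simp add: card_image inj_on_def card_Diff_subset)
  moreover have "even (card (Bot ` ({1..s} - J ` {1..t})))"
    using s by (intro pairing_even_card[of _ R]) (auto simp: strands_def)
  ultimately show ?thesis by (simp add: preceq_def)
qed

fun ren :: "(nat \<Rightarrow> nat) \<Rightarrow> point \<Rightarrow> point" where
  "ren J (Top i) = Top i"
| "ren J (Bot i) = Bot (J i)"

lemma inj_on_ren: "inj_on J {1..q} \<Longrightarrow> inj_on (ren J) (points p q)"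
proof (rule inj_onI)
  fix x y assume a: "inj_on J {1..q}" "x \<in> points p q" "y \<in> points p q" "ren J x = ren J y"
  then show "x = y" by (cases x; cases y) (auto simp: points_def dest: inj_onD)
qed

lemma ren_points: "ren J ` points p q = Top ` {1..p} \<union> Bot ` J ` {1..q}"
  by (simp add: points_def image_Un image_image)

text \<open>From every middle point a strand of the upward diagram leads to the bottom row, so no
  component can stay in the middle. Composition merely carries the bottom points of \<open>g\<close>
  along \<open>J\<close> and adds \<open>R\<close>; most later computations with diagrams rest on
  this formula.\<close>

lemma hat_comp_up_diagram:
  assumes J: "strands q s J R" and g: "g \<in> brauer p q"
  shows "hat_comp (up_diagram q J R) g = (`) (ren J) ` g \<union> R" (is "?l = ?r")
    "num_loops (up_diagram q J R) g = 0"
proof -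
  let ?f = "up_diagram q J R"
  have f: "?f \<in> brauer q s" using up_diagram_closed[OF J] by (simp add: brauer_up_def)
  have gp: "pairing (points p q) g" using g by (simp add: brauer_pairing)
  have mid: "conn (stack ?f g) (Mid i) (Lower (J i))" if "i \<in> {1..q}" for i
  proof (rule conn.edge)
    show "in_lower ` {Top i, Bot (J i)} \<in> stack ?f g" unfolding stack_def up_diagram_def
      using that by (intro UnI2 imageI UnI1)
  qed auto
  have low: "conn (stack ?f g) (in_upper x) (outer (ren J x))" if "x \<in> points p q" for x
  proof (cases x)
    case (Top i)
    have "x \<in> \<Union>g" using that pairing_Union[OF gp] by simp
    then have "in_upper x \<in> \<Union>(stack ?f g)" by (auto simp: stack_def)
    then have "conn (stack ?f g) (in_upper x) (in_upper x)" by (rule conn_refl)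
    then show ?thesis using Top by simp
  next
    case (Bot i)
    then show ?thesis using mid[of i] that by (auto simp: points_def)
  qed
  show "num_loops ?f g = 0"
  proof -
    have "C \<notin> loops ?f g" for C
    proof
      assume "C \<in> loops ?f g"
      then have C: "C \<in> blocks (stack ?f g)" "C \<subseteq> range Mid" by (auto simp: loops_def components_eq)
      then obtain i where i: "Mid i \<in> C" using blocks_nonempty[OF C(1)] by auto
      then have "Mid i \<in> \<Union>(stack ?f g)" using blocks_sub[OF C(1)] by auto
      then obtain P where P: "P \<in> stack ?f g" "Mid i \<in> P" by auto
      have "i \<in> {1..q}"
      proof -
        consider Q where "Q \<in> g" "Mid i \<in> in_upper ` Q" | Q where "Q \<in> ?f" "Mid i \<in> in_lower ` Q"
          using P by (auto simp: stack_def)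
        then show ?thesis
        proof cases
          case 1
          then obtain x where x: "x \<in> Q" "Mid i = in_upper x" by auto
          then have "x \<in> points p q" using pairing_Union[OF gp] 1 by auto
          then show ?thesis using x by (cases x) (auto simp: points_def)
        next
          case 2
          then obtain x where x: "x \<in> Q" "Mid i = in_lower x" by auto
          then have "x \<in> points q s" using pairing_Union[of "points q s" ?f] f 2 by (auto simp: brauer_pairing)
          then show ?thesis using x by (cases x) (auto simp: points_def)
        qed
      qed
      then have "Lower (J i) \<in> C" using mid blocks_mem_iff[OF C(1) i] by simp
      then show False using C(2) by auto
    qed
    then have "loops ?f g = {}" by auto
    then show ?thesis by (simp add: num_loops_def)
  qed
  have "pairing ((Top ` {1..p} \<union> Bot ` J ` {1..q}) \<union> Bot ` ({1..s} - J ` {1..q})) ?r"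
  proof (rule pairing_Un)
    show "pairing (Top ` {1..p} \<union> Bot ` J ` {1..q}) ((`) (ren J) ` g)"
      unfolding ren_points[symmetric]
      by (rule pairing_image[OF gp]) (use J in \<open>simp add: strands_def inj_on_ren\<close>)
    show "pairing (Bot ` ({1..s} - J ` {1..q})) R" using J by (simp add: strands_def)
  qed auto
  moreover have "(Top ` {1..p} \<union> Bot ` J ` {1..q}) \<union> Bot ` ({1..s} - J ` {1..q}) = points p s"
    using J by (auto simp: strands_def points_def)
  ultimately have r: "?r \<in> brauer p s" by (simp add: brauer_pairing)
  show "?l = ?r"
  proof (rule hat_comp_eqI[OF f g r])
    fix x y assume xy: "{x, y} \<in> ?r" "x \<noteq> y"
    then consider "{x, y} \<in> R" | P where "P \<in> g" "{x, y} = ren J ` P" by auto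
    then show "conn (stack ?f g) (outer x) (outer y)"
    proof cases
      case 1
      then obtain a b where ab: "x = Bot a" "y = Bot b" using strands_R_Bot[OF J, of "{x, y}"] by auto
      have "in_lower ` {x, y} \<in> stack ?f g" unfolding stack_def up_diagram_def
        by (intro UnI2 imageI) (rule 1)
      then show ?thesis by (rule conn.edge) (auto simp: ab)
    next
      case 2
      have "x \<in> ren J ` P" "y \<in> ren J ` P" using 2(2) by auto
      then obtain x' y' where *: "x = ren J x'" "y = ren J y'" "x' \<in> P" "y' \<in> P" by auto
      then have "x' \<in> points p q" "y' \<in> points p q" using pairing_Union[OF gp] 2(1) by auto
      note l = low[OF this(1)] low[OF this(2)]
      have "conn (stack ?f g) (in_upper x') (in_upper y')"
      proof (rule conn.edge)
        show "in_upper ` P \<in> stack ?f g" using 2(1) by (simp add: stack_def)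
      qed (use * in auto)
      from conn_trans[OF conn_trans[OF l(2) this] conn_sym[OF l(1)]] show ?thesis by (simp add: *)
    qed
  qed
qed

section \<open>Identity and level diagrams\<close>

definition id_diagram :: "nat \<Rightarrow> diagram" where
  "id_diagram p = up_diagram p (\<lambda>i. i) {}"

lemma pairing_empty: "pairing {} R \<longleftrightarrow> R = {}"
proof
  assume p: "pairing {} R"
  show "R = {}"
  proof (rule ccontr)
    assume "R \<noteq> {}"
    then obtain P where P: "P \<in> R" by auto
    then have "P = {}" using pairing_Union[OF p] by auto
    then show False using pairing_card[OF p P] by simp
  qed
qed (rule pairingI, auto)

lemma strands_level: "bij_betw \<sigma> {1..p} {1..p} \<longleftrightarrow> strands p p \<sigma> {}"
proof
  assume "bij_betw \<sigma> {1..p} {1..p}"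
  then show "strands p p \<sigma> {}" by (simp add: strands_def bij_betw_def pairing_empty)
next
  assume "strands p p \<sigma> {}"
  then have "inj_on \<sigma> {1..p}" "\<sigma> ` {1..p} \<subseteq> {1..p}" by (auto simp: strands_def)
  then show "bij_betw \<sigma> {1..p} {1..p}" by (simp add: bij_betw_def endo_inj_surj)
qed

text \<open>An injection of a finite set into itself is surjective, so no bottom point is left for
  \<open>R\<close>.\<close>

lemma up_square_level:
  assumes "D \<in> brauer_up p p"
  obtains \<sigma> where "bij_betw \<sigma> {1..p} {1..p}" "D = up_diagram p \<sigma> {}"
proof -
  obtain J R where J: "strands p p J R" "D = up_diagram p J R" by (rule up_diagram_ex[OF assms])
  then have "inj_on J {1..p}" "J ` {1..p} \<subseteq> {1..p}" by (auto simp: strands_def)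
  then have e: "J ` {1..p} = {1..p}" by (simp add: endo_inj_surj)
  then have "R = {}" using J(1) by (simp add: strands_def pairing_empty)
  with J show ?thesis using that strands_level by simp
qed

lemma downward_up_diagram: "downward (up_diagram p \<sigma> {})"
  by (auto simp: downward_def up_diagram_def)

lemma level_diagram_closed:
  assumes "bij_betw \<sigma> {1..p} {1..p}"
  shows "up_diagram p \<sigma> {} \<in> brauer_level p p"
  using up_diagram_closed[OF assms[unfolded strands_level]] downward_up_diagram
  by (simp add: brauer_up_def brauer_level_def level_def)

lemma brauer_up_square: "brauer_up p p = brauer_level p p"
proof (intro Set.set_eqI iffI)
  fix D assume D: "D \<in> brauer_up p p"
  then obtain \<sigma> where "bij_betw \<sigma> {1..p} {1..p}" "D = up_diagram p \<sigma> {}" by (rule up_square_level)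
  then show "D \<in> brauer_level p p" by (simp add: level_diagram_closed)
qed (simp add: brauer_up_def brauer_level_def level_def)

lemma brauer_down_square: "brauer_down p p = brauer_level p p"
proof (intro Set.set_eqI iffI)
  fix D assume "D \<in> brauer_down p p"
  then have "flip D \<in> brauer_level p p" unfolding brauer_up_square[symmetric] by (rule flip_brauer_down)
  then show "D \<in> brauer_level p p" using flip_brauer_level by fastforce
qed (simp add: brauer_down_def brauer_level_def level_def)

lemma brauer_up_le: "D \<in> brauer_up p q \<Longrightarrow> p \<le> q"
  using brauer_up_preceq by (simp add: preceq_def)

lemma brauer_down_le: "D \<in> brauer_down p q \<Longrightarrow> q \<le> p"
  using brauer_up_le flip_brauer_down by metis

lemma brauer_level_eq: "D \<in> brauer_level p q \<Longrightarrow> p = q"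
  using brauer_up_le[of D p q] brauer_down_le[of D p q]
  by (simp add: brauer_level_def brauer_up_def brauer_down_def level_def)

lemma brauer_level_ex:
  assumes "D \<in> brauer_level p p"
  obtains \<sigma> where "bij_betw \<sigma> {1..p} {1..p}" "D = up_diagram p \<sigma> {}"
  using assms up_square_level brauer_up_square by metis

lemma id_level: "id_diagram p \<in> brauer_level p p"
  unfolding id_diagram_def by (rule level_diagram_closed) (simp add: bij_betw_def)

lemma id_brauer: "id_diagram p \<in> brauer p p"
  using id_level by (simp add: brauer_level_def)

lemma id_hat_comp:
  assumes "g \<in> brauer p q"
  shows "hat_comp (id_diagram q) g = g"
proof -
  have "strands q q (\<lambda>i. i) {}" using strands_level[of "\<lambda>i. i" q] by (simp add: bij_betw_def)
  note h = hat_comp_up_diagram(1)[OF this assms]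
  have "ren (\<lambda>i. i) x = x" for x by (cases x) auto
  then show ?thesis using h by (simp add: id_diagram_def)
qed

lemma flip_id: "flip (id_diagram p) = id_diagram p"
  by (simp add: id_diagram_def up_diagram_def flip_def image_image insert_commute)

lemma hat_comp_id:
  assumes "g \<in> brauer p q"
  shows "hat_comp g (id_diagram p) = g"
proof -
  have "flip (hat_comp g (id_diagram p)) = flip g"
    using id_hat_comp[OF flip_brauer[OF assms]] by (simp add: flip_hat_comp flip_id)
  then show ?thesis by (metis flip_flip)
qed

section \<open>Composites of upward, downward and level diagrams\<close>

lemma num_loops_up:
  assumes "f \<in> brauer_up q s" "g \<in> brauer p q"
  shows "num_loops f g = 0"
proof -
  obtain J R where "strands q s J R" "f = up_diagram q J R" by (rule up_diagram_ex[OF assms(1)])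
  then show ?thesis using hat_comp_up_diagram(2) assms(2) by simp
qed

lemma num_loops_down:
  assumes "f \<in> brauer q s" "g \<in> brauer_down p q"
  shows "num_loops f g = 0"
  using num_loops_up[OF flip_brauer_down[OF assms(2)] flip_brauer[OF assms(1)]] by (simp add: num_loops_flip)

lemma ren_Top: "ren J x \<in> range Top \<Longrightarrow> x \<in> range Top"
  by (cases x) auto

lemma hat_comp_up:
  assumes "f \<in> brauer_up q s" "g \<in> brauer_up p q"
  shows "hat_comp f g \<in> brauer_up p s"
proof -
  obtain J R where J: "strands q s J R" "f = up_diagram q J R" by (rule up_diagram_ex[OF assms(1)])
  have g: "g \<in> brauer p q" "upward g" using assms by (auto simp: brauer_up_def)
  have f: "f \<in> brauer q s" using assms(1) by (simp add: brauer_up_def)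
  have "upward (hat_comp f g)"
    unfolding upward_def
  proof
    assume "\<exists>P\<in>hat_comp f g. P \<subseteq> range Top"
    then obtain P where P: "P \<in> (`) (ren J) ` g \<union> R" "P \<subseteq> range Top"
      using hat_comp_up_diagram(1)[OF J(1) g(1)] J(2) by auto
    have "P \<notin> R"
    proof
      assume "P \<in> R"
      then have "P \<subseteq> range Top \<inter> range Bot" "P \<noteq> {}" using strands_R_Bot[OF J(1)] P(2) by auto
      then show False by auto
    qed
    then obtain Q where "Q \<in> g" "P = ren J ` Q" using P by auto
    then have "Q \<subseteq> range Top" using P(2) ren_Top[of J] by (auto simp: image_subset_iff)
    then show False using g(2) \<open>Q \<in> g\<close> by (auto simp: upward_def)
  qed
  then show ?thesis using hat_comp_closed[OF f g(1)] by (simp add: brauer_up_def)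
qed

lemma hat_comp_down:
  assumes "f \<in> brauer_down q s" "g \<in> brauer_down p q"
  shows "hat_comp f g \<in> brauer_down p s"
proof -
  have "hat_comp (flip g) (flip f) \<in> brauer_up s p"
    using assms by (intro hat_comp_up flip_brauer_down)
  then have "flip (hat_comp f g) \<in> brauer_up s p" by (simp add: flip_hat_comp)
  then have "flip (flip (hat_comp f g)) \<in> brauer_down p s" by (rule flip_brauer_up)
  then show ?thesis by simp
qed

lemma level_in_up: "D \<in> brauer_level p q \<Longrightarrow> D \<in> brauer_up p q"
  by (simp add: brauer_up_def brauer_level_def level_def)

lemma level_in_down: "D \<in> brauer_level p q \<Longrightarrow> D \<in> brauer_down p q"
  by (simp add: brauer_down_def brauer_level_def level_def)

lemma level_iff: "D \<in> brauer_level p q \<longleftrightarrow> D \<in> brauer_up p q \<and> D \<in> brauer_down p q"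
  by (auto simp: brauer_up_def brauer_down_def brauer_level_def level_def)

lemma hat_comp_level:
  "f \<in> brauer_level q s \<Longrightarrow> g \<in> brauer_level p q \<Longrightarrow> hat_comp f g \<in> brauer_level p s"
  unfolding level_iff using hat_comp_up hat_comp_down by auto

text \<open>A pair of top points of \<open>g\<close> is untouched by whatever is placed below.
  Non-upward diagrams are thus stable under composition on the left, which makes the projection
  action an action.\<close>

lemma not_upward_hat_comp:
  assumes "f \<in> brauer q s" "g \<in> brauer p q" "\<not> upward g"
  shows "\<not> upward (hat_comp f g)"
proof -
  obtain P where P: "P \<in> g" "P \<subseteq> range Top" using assms(3) by (auto simp: upward_def)
  have "card P = 2" using P(1) assms(2) by (simp add: brauer_def)
  then obtain x y where xy: "P = {x, y}" "x \<noteq> y" by (auto simp: card_2_iff)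
  then obtain a b where ab: "x = Top a" "y = Top b" using P(2) by auto
  have "in_upper ` P \<in> stack f g" using P(1) by (simp add: stack_def)
  then have "conn (stack f g) (outer x) (outer y)" by (rule conn.edge) (auto simp: xy ab)
  then have "P \<in> hat_comp f g" using hat_comp_memI[OF assms(1,2)] xy by simp
  with P(2) show ?thesis by (auto simp: upward_def)
qed

lemma not_downward_hat_comp:
  assumes "f \<in> brauer q s" "g \<in> brauer p q" "\<not> downward f"
  shows "\<not> downward (hat_comp f g)"
  using not_upward_hat_comp[OF flip_brauer[OF assms(2)] flip_brauer[OF assms(1)]] assms(3)
  by (simp flip: flip_hat_comp)

text \<open>On permutations flipping is inversion: each strand is followed down and then back up its
  mirror image.\<close>

lemma flip_hat_comp_level:
  assumes "\<sigma> \<in> brauer_level p p"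
  shows "hat_comp (flip \<sigma>) \<sigma> = id_diagram p"
proof -
  obtain s where s: "bij_betw s {1..p} {1..p}" "\<sigma> = up_diagram p s {}" by (rule brauer_level_ex[OF assms])
  have b: "\<sigma> \<in> brauer p p" using assms by (simp add: brauer_level_def)
  show ?thesis
  proof (rule hat_comp_eqI[OF flip_brauer[OF b] b id_brauer])
    fix x y assume "{x, y} \<in> id_diagram p" "x \<noteq> y"
    then obtain i where i: "i \<in> {1..p}" "{x, y} = {Top i, Bot i}" by (auto simp: id_diagram_def up_diagram_def)
    have P: "{Top i, Bot (s i)} \<in> \<sigma>" using i s by (auto simp: up_diagram_def)
    have "in_upper ` {Top i, Bot (s i)} \<in> stack (flip \<sigma>) \<sigma>" unfolding stack_def by (intro UnI1 imageI P)
    then have 1: "conn (stack (flip \<sigma>) \<sigma>) (Upper i) (Mid (s i))" by (rule conn.edge) auto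
    have "in_lower ` flip_point ` {Top i, Bot (s i)} \<in> stack (flip \<sigma>) \<sigma>"
      unfolding stack_def flip_def by (intro UnI2 imageI P)
    then have 2: "conn (stack (flip \<sigma>) \<sigma>) (Mid (s i)) (Lower i)" by (rule conn.edge) auto
    from conn_trans[OF 2 1] conn_sym show "conn (stack (flip \<sigma>) \<sigma>) (outer x) (outer y)"
      using i(2) by (auto simp: doubleton_eq_iff)
  qed
qed

lemma hat_comp_flip_level:
  assumes "\<sigma> \<in> brauer_level p p"
  shows "hat_comp \<sigma> (flip \<sigma>) = id_diagram p"
  using flip_hat_comp_level[OF flip_brauer_level[OF assms]] by simp

text \<open>The diagram is cut across its through strands, whose number \<open>s\<close> is the
  middle object; \<open>n\<close> receives the pairs inside the top row and \<open>m\<close> those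
  inside the bottom row.\<close>

lemma brauer_factor:
  assumes D: "D \<in> brauer p q"
  obtains s m n where "m \<in> brauer_up s q" "n \<in> brauer_down p s" "hat_comp m n = D"
proof -
  have Dp: "pairing (points p q) D" using D by (simp add: brauer_pairing)
  define T where "T = {i. \<exists>j. {Top i, Bot j} \<in> D}"
  have pts: "x \<in> points p q" if "P \<in> D" "x \<in> P" for P x using that pairing_Union[OF Dp] by auto
  have T: "T \<subseteq> {1..p}"
  proof
    fix i assume "i \<in> T"
    then obtain j where "{Top i, Bot j} \<in> D" by (auto simp: T_def)
    then show "i \<in> {1..p}" using pts[of "{Top i, Bot j}" "Top i"] by (auto simp: points_def)
  qed
  then have finT: "finite T" by (rule finite_subset) simp
  define s where "s = card T"
  \<comment> \<open>Any enumeration of the through strands will do: another choice changes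
    \<open>m\<close> and \<open>n\<close> by mutually inverse level diagrams.\<close>
  obtain e0 where e0: "bij_betw e0 {1..s} T"
    using ex_bij_betw_nat_finite_1[OF finT] by (auto simp: s_def)
  define b where "b i = (SOME j. {Top i, Bot j} \<in> D)" for i
  have b: "{Top i, Bot (b i)} \<in> D" if "i \<in> T" for i
    using that unfolding b_def T_def by (intro someI_ex[of "\<lambda>j. {Top i, Bot j} \<in> D"]) simp
  have binj: "i = k" if "i \<in> T" "k \<in> T" "b i = b k" for i k
  proof -
    have "{Top i, Bot (b i)} = {Top k, Bot (b k)}"
      by (rule pairing_eq[OF Dp b[OF that(1)] b[OF that(2)], of "Bot (b i)"]) (use that in auto)
    then show ?thesis by (auto simp: doubleton_eq_iff)
  qed
  have bq: "b i \<in> {1..q}" if "i \<in> T" for i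
    using pts[OF b[OF that], of "Bot (b i)"] by (auto simp: points_def)
  have e0T: "e0 k \<in> T" if "k \<in> {1..s}" for k using e0 that by (rule bij_betwE[rule_format])
  have e0inj: "inj_on e0 {1..s}" using e0 by (simp add: bij_betw_def)
  define TT where "TT = {P \<in> D. P \<subseteq> range Top}"
  define BB where "BB = {P \<in> D. P \<subseteq> range Bot}"
  define Th where "Th = (\<lambda>i. {Top i, Bot (b i)}) ` T"
  have through: "P \<in> Th" if "P \<in> D" "\<not> P \<subseteq> range Top" "\<not> P \<subseteq> range Bot" for P
  proof -
    have "card P = 2" using pairing_card[OF Dp that(1)] .
    then obtain x y where xy: "P = {x, y}" by (auto simp: card_2_iff)
    have "\<exists>i j. P = {Top i, Bot j}"
      using that(2,3) xy by (cases x; cases y) (auto simp: doubleton_eq_iff)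
    then obtain i j where ij: "P = {Top i, Bot j}" by auto
    then have iT: "i \<in> T" using that(1) by (auto simp: T_def)
    have "P = {Top i, Bot (b i)}"
      by (rule pairing_eq[OF Dp that(1) b[OF iT], of "Top i"]) (auto simp: ij)
    then show ?thesis using iT by (simp add: Th_def)
  qed
  have not_both: False if "P \<in> D" "P \<subseteq> range Top" "P \<subseteq> range Bot" for P
  proof -
    have "P = {}" using that(2,3) by auto
    then show False using pairing_card[OF Dp that(1)] by simp
  qed
  have ThD: "Th \<subseteq> D" using b by (auto simp: Th_def)
  have Deq: "D = TT \<union> BB \<union> Th" using through ThD by (auto simp: TT_def BB_def)
  have UTh: "\<Union>Th = Top ` T \<union> Bot ` b ` T" by (auto simp: Th_def)
  have UTT: "pairing (Top ` ({1..p} - T)) TT"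
  proof -
    have "TT = D - (BB \<union> Th)"
    proof -
      have "P \<notin> BB \<union> Th" if "P \<in> TT" for P
        using that not_both[of P] by (auto simp: TT_def BB_def Th_def)
      then show ?thesis using Deq by auto
    qed
    moreover have "points p q - \<Union>(BB \<union> Th) = Top ` ({1..p} - T)"
    proof (intro Set.set_eqI iffI)
      fix x assume x: "x \<in> points p q - \<Union>(BB \<union> Th)"
      then have "x \<in> \<Union>D" using pairing_Union[OF Dp] by simp
      then have "x \<in> \<Union>TT" using x Deq by auto
      then show "x \<in> Top ` ({1..p} - T)" using x by (auto simp: TT_def points_def UTh)
    next
      fix x assume x: "x \<in> Top ` ({1..p} - T)"
      then show "x \<in> points p q - \<Union>(BB \<union> Th)" using UTh by (auto simp: BB_def points_def)
    qed
    moreover have "BB \<union> Th \<subseteq> D" using ThD by (auto simp: BB_def)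
    ultimately show ?thesis using pairing_Diff[OF Dp, of "BB \<union> Th"] by (simp only:)
  qed
  have UBB: "pairing (Bot ` ({1..q} - b ` T)) BB"
  proof -
    have "BB = D - (TT \<union> Th)"
    proof -
      have "P \<notin> TT \<union> Th" if "P \<in> BB" for P
        using that not_both[of P] by (auto simp: TT_def BB_def Th_def)
      then show ?thesis using Deq by auto
    qed
    moreover have "points p q - \<Union>(TT \<union> Th) = Bot ` ({1..q} - b ` T)"
    proof (intro Set.set_eqI iffI)
      fix x assume x: "x \<in> points p q - \<Union>(TT \<union> Th)"
      then have "x \<in> \<Union>D" using pairing_Union[OF Dp] by simp
      then have "x \<in> \<Union>BB" using x Deq by auto
      then show "x \<in> Bot ` ({1..q} - b ` T)" using x by (auto simp: BB_def points_def UTh)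
    next
      fix x assume x: "x \<in> Bot ` ({1..q} - b ` T)"
      then show "x \<in> points p q - \<Union>(TT \<union> Th)" using UTh by (auto simp: TT_def points_def)
    qed
    moreover have "TT \<union> Th \<subseteq> D" using ThD by (auto simp: TT_def)
    ultimately show ?thesis using pairing_Diff[OF Dp, of "TT \<union> Th"] by (simp only:)
  qed
  have im: "e0 ` {1..s} = T" using e0 by (simp add: bij_betw_def)
  have bim: "(b \<circ> e0) ` {1..s} = b ` T" by (simp only: image_comp[symmetric] im)
  have sm: "strands s q (b \<circ> e0) BB"
    unfolding strands_def bim
  proof (intro conjI UBB)
    show "inj_on (b \<circ> e0) {1..s}"
    proof (rule comp_inj_on[OF e0inj])
      show "inj_on b (e0 ` {1..s})" unfolding im by (rule inj_onI) (rule binj)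
    qed
    show "b ` T \<subseteq> {1..q}" using bq by (intro image_subsetI)
  qed
  have sn: "strands s p e0 ((`) flip_point ` TT)"
    unfolding strands_def im
  proof (intro conjI e0inj T)
    have "flip_point ` Top ` ({1..p} - T) = Bot ` ({1..p} - T)" by (simp add: image_image)
    then show "pairing (Bot ` ({1..p} - T)) ((`) flip_point ` TT)"
      using pairing_image[OF UTT inj_on_subset[OF inj_flip_point subset_UNIV]] by simp
  qed
  define m where "m = up_diagram s (b \<circ> e0) BB"
  define n where "n = flip (up_diagram s e0 ((`) flip_point ` TT))"
  have n: "n \<in> brauer_down p s" unfolding n_def using up_diagram_closed[OF sn] by (rule flip_brauer_up)
  have "n = (\<lambda>k. {Top (e0 k), Bot k}) ` {1..s} \<union> TT"
    by (simp add: n_def flip_def up_diagram_def image_Un image_image insert_commute)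
  then have "(`) (ren (b \<circ> e0)) ` n = (\<lambda>k. {Top (e0 k), Bot (b (e0 k))}) ` {1..s} \<union> (`) (ren (b \<circ> e0)) ` TT"
    by (simp add: image_Un image_image)
  also have "(\<lambda>k. {Top (e0 k), Bot (b (e0 k))}) ` {1..s} = Th"
    unfolding Th_def im[symmetric] by (simp add: image_image)
  \<comment> \<open>Renaming affects bottom points only, and the pairs in \<open>TT\<close> have
    none.\<close>
  also have "(`) (ren (b \<circ> e0)) ` TT = TT"
  proof -
    have "ren (b \<circ> e0) ` P = P" if "P \<in> TT" for P
    proof -
      have "ren (b \<circ> e0) x = x" if "x \<in> P" for x
      proof -
        have "x \<in> range Top" using \<open>P \<in> TT\<close> that by (auto simp: TT_def)
        then show ?thesis by auto
      qed
      then show ?thesis by simp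
    qed
    then show ?thesis by simp
  qed
  finally have ren_n: "(`) (ren (b \<circ> e0)) ` n = Th \<union> TT" .
  have "n \<in> brauer p s" using n by (simp add: brauer_down_def)
  then have "hat_comp m n = (`) (ren (b \<circ> e0)) ` n \<union> BB"
    unfolding m_def by (rule hat_comp_up_diagram(1)[OF sm])
  then have "hat_comp m n = D" unfolding ren_n Deq by (simp only: Un_ac)
  then show ?thesis using that up_diagram_closed[OF sm, folded m_def] n by simp
qed

section \<open>Monotone diagrams as representatives modulo permutations\<close>

lemma strict_mono_on_rank:
  assumes "strict_mono_on {1..q} (J::nat \<Rightarrow> nat)" "i \<in> {1..q}"
  shows "card {x \<in> J ` {1..q}. x \<le> J i} = i"
proof -
  have inj: "inj_on J {1..q}" using assms(1) by (rule strict_mono_on_imp_inj_on)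
  have "{x \<in> J ` {1..q}. x \<le> J i} = J ` {1..i}"
  proof (intro Set.set_eqI iffI)
    fix x assume "x \<in> {x \<in> J ` {1..q}. x \<le> J i}"
    then obtain k where k: "x = J k" "k \<in> {1..q}" "J k \<le> J i" by auto
    have "k \<le> i"
    proof (rule ccontr)
      assume "\<not> k \<le> i"
      then have "J i < J k" using strict_mono_onD[OF assms(1) assms(2) k(2)] by simp
      then show False using k(3) by simp
    qed
    then show "x \<in> J ` {1..i}" using k by auto
  next
    fix x assume "x \<in> J ` {1..i}"
    then obtain k where k: "x = J k" "k \<in> {1..i}" by auto
    then have kq: "k \<in> {1..q}" using assms(2) by auto
    have "J k \<le> J i"
    proof (cases "k = i")
      case False
      then show ?thesis using strict_mono_onD[OF assms(1) kq assms(2)] k by auto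
    qed simp
    then show "x \<in> {x \<in> J ` {1..q}. x \<le> J i}" using k kq by auto
  qed
  moreover have "inj_on J {1..i}" by (rule inj_on_subset[OF inj]) (use assms(2) in auto)
  ultimately show ?thesis by (simp add: card_image)
qed

text \<open>In an increasing enumeration the index of a value is its rank in the image, so the image
  determines the enumeration.\<close>

lemma strict_mono_on_unique:
  assumes "strict_mono_on {1..q} (J::nat \<Rightarrow> nat)" "strict_mono_on {1..q} J'" "J ` {1..q} = J' ` {1..q}" "i \<in> {1..q}"
  shows "J i = J' i"
proof -
  have "J i \<in> J' ` {1..q}" unfolding assms(3)[symmetric] using assms(4) by (rule imageI)
  then obtain k where k: "k \<in> {1..q}" "J i = J' k" by auto
  have "i = card {x \<in> J ` {1..q}. x \<le> J i}" using strict_mono_on_rank[OF assms(1,4)] by simp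
  also have "\<dots> = k" unfolding assms(3) k(2) by (rule strict_mono_on_rank[OF assms(2) k(1)])
  finally show ?thesis using k by simp
qed

lemma monotone_up_diagram:
  assumes "strands q s J R"
  shows "monotone_diagram (up_diagram q J R) \<longleftrightarrow> strict_mono_on {1..q} J"
proof -
  have mem: "{Top i, Bot j} \<in> up_diagram q J R \<longleftrightarrow> i \<in> {1..q} \<and> j = J i" for i j
    using strands_R_Bot[OF assms, of "{Top i, Bot j}"] by (auto simp: up_diagram_def doubleton_eq_iff)
  show ?thesis
  proof
    assume m: "monotone_diagram (up_diagram q J R)"
    show "strict_mono_on {1..q} J"
    proof (rule strict_mono_onI)
      fix i k assume ik: "i \<in> {1..q}" "k \<in> {1..q}" "i < k"
      have "{Top i, Bot (J i)} \<noteq> {Top k, Bot (J k)}" using ik(3) by (auto simp: doubleton_eq_iff)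
      then have "(int i - int k) * (int (J i) - int (J k)) > 0"
        using m ik(1,2) mem unfolding monotone_diagram_def by metis
      then show "J i < J k" using ik(3) by (auto simp: zero_less_mult_iff)
    qed
  next
    assume m: "strict_mono_on {1..q} J"
    show "monotone_diagram (up_diagram q J R)"
      unfolding monotone_diagram_def mem
    proof (intro allI impI, elim conjE)
      fix i j k l
      assume a: "{Top i, Bot j} \<noteq> {Top k, Bot l}" "i \<in> {1..q}" "k \<in> {1..q}" "j = J i" "l = J k"
      then have "i \<noteq> k" by auto
      then consider "i < k" | "k < i" by linarith
      then show "0 < (int i - int k) * (int j - int l)"
        using strict_mono_onD[OF m a(2,3)] strict_mono_onD[OF m a(3,2)] a(4,5)
        by cases (auto simp: zero_less_mult_iff)
    qed
  qed
qed

text \<open>Sort the lower ends of the strands: \<open>f\<close> joins the top points to them in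
  increasing order, and \<open>\<sigma>\<close> is the permutation undone by sorting.\<close>

lemma brauer_up_mono_factor:
  assumes "x \<in> brauer_up t s"
  obtains f \<sigma> where "f \<in> brauer_up_mono t s" "\<sigma> \<in> brauer_level t t" "hat_comp f \<sigma> = x"
proof -
  obtain J R where J: "strands t s J R" "x = up_diagram t J R" by (rule up_diagram_ex[OF assms])
  define A where "A = J ` {1..t}"
  have inj: "inj_on J {1..t}" using J(1) by (simp add: strands_def)
  have A: "finite A" "card A = t" using inj by (simp_all add: A_def card_image)
  obtain h where h: "bij_betw h {..<card A} A" "strict_mono_on {..<card A} h"
    by (rule ex_bij_betw_strict_mono_card[OF A(1)])
  \<comment> \<open>The increasing enumeration \<open>h\<close> starts at 0, whereas points are
    numbered from 1.\<close>
  define K where "K i = h (i - 1)" for i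
  have mono: "strict_mono_on {1..t} K"
    using strict_mono_onD[OF h(2)] by (intro strict_mono_onI) (auto simp: K_def A(2))
  have im: "K ` {1..t} = A"
  proof -
    have "{..<t} = (\<lambda>i. i - 1) ` {1..t}" by (auto intro!: image_eqI[of _ _ "Suc _"])
    then have "h ` {..<t} = K ` {1..t}" by (simp add: image_image K_def)
    then show ?thesis using h(1) A(2) by (simp add: bij_betw_def)
  qed
  have injK: "inj_on K {1..t}" using mono by (rule strict_mono_on_imp_inj_on)
  have sK: "strands t s K R" using J(1) injK unfolding strands_def im unfolding A_def by simp
  \<comment> \<open>The sorting permutation, determined by \<open>K (g i) = J i\<close>.\<close>
  define g where "g i = the_inv_into {1..t} K (J i)" for i
  have g: "K (g i) = J i" "g i \<in> {1..t}" if "i \<in> {1..t}" for i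
  proof -
    have "J i \<in> K ` {1..t}" using that im by (simp add: A_def)
    then show "K (g i) = J i" "g i \<in> {1..t}"
      unfolding g_def using f_the_inv_into_f[OF injK] the_inv_into_into[OF injK _ order_refl] by auto
  qed
  have "inj_on g {1..t}"
  proof (rule inj_onI)
    fix i k assume "i \<in> {1..t}" "k \<in> {1..t}" "g i = g k"
    then have "J i = J k" using g(1) by metis
    then show "i = k" using inj \<open>i \<in> {1..t}\<close> \<open>k \<in> {1..t}\<close> by (auto dest: inj_onD)
  qed
  moreover have "g ` {1..t} \<subseteq> {1..t}" using g(2) by auto
  ultimately have bij: "bij_betw g {1..t} {1..t}" by (simp add: bij_betw_def endo_inj_surj)
  have lev: "up_diagram t g {} \<in> brauer_level t t" by (rule level_diagram_closed[OF bij])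
  have fm: "up_diagram t K R \<in> brauer_up_mono t s"
    using up_diagram_closed[OF sK] monotone_up_diagram[OF sK] mono by (simp add: brauer_up_mono_def)
  have "hat_comp (up_diagram t K R) (up_diagram t g {}) = (`) (ren K) ` up_diagram t g {} \<union> R"
    using lev by (intro hat_comp_up_diagram(1)[OF sK, of _ t]) (simp add: brauer_level_def)
  also have "(`) (ren K) ` up_diagram t g {} = (\<lambda>i. {Top i, Bot (K (g i))}) ` {1..t}"
    by (simp add: up_diagram_def image_image)
  also have "\<dots> = (\<lambda>i. {Top i, Bot (J i)}) ` {1..t}" using g(1) by (intro image_cong) auto
  finally have "hat_comp (up_diagram t K R) (up_diagram t g {}) = x" by (simp add: J(2) up_diagram_def)
  with fm lev show ?thesis by (rule that)
qed

text \<open>Composing with a permutation changes neither \<open>R\<close> nor the set of lower ends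
  of the strands, and a monotone diagram is determined by these two. Injectivity of the strands then
  identifies the permutation.\<close>

lemma brauer_up_mono_unique:
  assumes f: "f \<in> brauer_up_mono t s" "f' \<in> brauer_up_mono t s"
    and \<sigma>: "\<sigma> \<in> brauer_level t t" "\<sigma>' \<in> brauer_level t t"
    and eq: "hat_comp f \<sigma> = hat_comp f' \<sigma>'"
  shows "f = f'" "\<sigma> = \<sigma>'"
proof -
  have fu: "f \<in> brauer_up t s" "f' \<in> brauer_up t s" using f by (auto simp: brauer_up_mono_def)
  obtain J R where J: "strands t s J R" "f = up_diagram t J R" by (rule up_diagram_ex[OF fu(1)])
  obtain J' R' where J': "strands t s J' R'" "f' = up_diagram t J' R'" by (rule up_diagram_ex[OF fu(2)])
  obtain g where g: "bij_betw g {1..t} {1..t}" "\<sigma> = up_diagram t g {}" by (rule brauer_level_ex[OF \<sigma>(1)])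
  obtain g' where g': "bij_betw g' {1..t} {1..t}" "\<sigma>' = up_diagram t g' {}" by (rule brauer_level_ex[OF \<sigma>(2)])
  have comp: "hat_comp (up_diagram t J R) (up_diagram t g {}) = up_diagram t (J \<circ> g) R \<and> strands t s (J \<circ> g) R"
    if "strands t s J R" "bij_betw g {1..t} {1..t}" for J R g
  proof
    have "hat_comp (up_diagram t J R) (up_diagram t g {}) = (`) (ren J) ` up_diagram t g {} \<union> R"
      using level_diagram_closed[OF that(2)] by (intro hat_comp_up_diagram(1)[OF that(1), of _ t]) (simp add: brauer_level_def)
    then show "hat_comp (up_diagram t J R) (up_diagram t g {}) = up_diagram t (J \<circ> g) R"
      by (simp add: up_diagram_def image_image)
    have "g ` {1..t} = {1..t}" using that(2) by (simp add: bij_betw_def)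
    then show "strands t s (J \<circ> g) R"
      using that comp_inj_on[of g "{1..t}" J] unfolding strands_def bij_betw_def
      by (simp only: image_comp[symmetric])
  qed
  note c = comp[OF J(1) g(1)] comp[OF J'(1) g'(1)]
  have e: "up_diagram t (J \<circ> g) R = up_diagram t (J' \<circ> g') R'"
    using eq c by (simp add: J J' g g')
  note u = up_diagram_unique[OF conjunct2[OF c(1)] conjunct2[OF c(2)] e]
  have "J ` {1..t} = J ` g ` {1..t}" using g(1) by (simp add: bij_betw_def)
  also have "\<dots> = J' ` g' ` {1..t}" using u(2) by (auto simp: image_image intro!: image_cong)
  also have "\<dots> = J' ` {1..t}" using g'(1) by (simp add: bij_betw_def)
  finally have im: "J ` {1..t} = J' ` {1..t}" .
  have m: "strict_mono_on {1..t} J" "strict_mono_on {1..t} J'"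
    using f monotone_up_diagram[OF J(1)] monotone_up_diagram[OF J'(1)] by (auto simp: brauer_up_mono_def J(2) J'(2))
  have JJ: "J i = J' i" if "i \<in> {1..t}" for i using strict_mono_on_unique[OF m im that] .
  then show "f = f'" using u(1) J(2) J'(2) up_diagram_cong by metis
  have "g i = g' i" if i: "i \<in> {1..t}" for i
  proof -
    have gi: "g i \<in> {1..t}" "g' i \<in> {1..t}" using i g(1) g'(1) bij_betwE by metis+
    have "J (g i) = J (g' i)" using u(2)[OF i] JJ[OF gi(2)] by simp
    moreover have "inj_on J {1..t}" using J(1) by (simp add: strands_def)
    ultimately show ?thesis using gi by (auto dest: inj_onD)
  qed
  then show "\<sigma> = \<sigma>'" using g(2) g'(2) up_diagram_cong by metis
qed

section \<open>Linear extension\<close>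

definition lin :: "(('a \<Rightarrow>\<^sub>0 'k::comm_ring_1) \<Rightarrow> ('b \<Rightarrow>\<^sub>0 'k)) \<Rightarrow> bool" where
  "lin F \<longleftrightarrow> (\<forall>x y. F (x + y) = F x + F y) \<and> (\<forall>c x. F (scal c x) = scal c (F x))"

lemma scal_simps [simp]:
  "scal c (x + y) = scal c x + scal c y" "scal (c + d) x = scal c x + scal d x"
  "scal c (scal d x) = scal (c * d) x" "scal 1 x = x" "scal 0 x = 0" "scal c 0 = 0"
  "scal c (x - y) = scal c x - scal c y" "scal c (- x) = - scal c x" "scal (- c) x = - scal c x"
  by (auto intro!: poly_mapping_eqI simp: lookup_add lookup_minus algebra_simps)

lemma scal_sum: "scal c (sum f A) = (\<Sum>a\<in>A. scal c (f a))"
  by (induction A rule: infinite_finite_induct) auto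

lemma lin_add: "lin F \<Longrightarrow> F (x + y) = F x + F y"
  by (simp add: lin_def)

lemma lin_scal: "lin F \<Longrightarrow> F (scal c x) = scal c (F x)"
  by (simp add: lin_def)

lemma lin_0: "lin F \<Longrightarrow> F 0 = 0"
  using lin_scal[of F 0 0] by simp

lemma lin_uminus: "lin F \<Longrightarrow> F (- x) = - F x"
  using lin_scal[of F "-1" x] by simp

lemma lin_diff: "lin F \<Longrightarrow> F (x - y) = F x - F y"
  using lin_add[of F x "- y"] lin_uminus[of F y] by simp

lemma lin_sum: "lin F \<Longrightarrow> F (sum f A) = (\<Sum>a\<in>A. F (f a))"
  by (induction A rule: infinite_finite_induct) (auto simp: lin_add lin_0)

lemma lin_ext_alt:
  "finite A \<Longrightarrow> Poly_Mapping.keys f \<subseteq> A \<Longrightarrow> lin_ext F f = (\<Sum>a\<in>A. scal (Poly_Mapping.lookup f a) (F a))"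
  unfolding lin_ext_def by (rule sum.mono_neutral_left) (auto simp: in_keys_iff)

lemma lin_lin_ext: "lin (lin_ext F)"
  unfolding lin_def
proof (intro conjI allI)
  fix x y :: "'a \<Rightarrow>\<^sub>0 'b"
  let ?A = "Poly_Mapping.keys x \<union> Poly_Mapping.keys y"
  have "Poly_Mapping.keys (x + y) \<subseteq> ?A" by (rule Poly_Mapping.keys_add)
  then show "lin_ext F (x + y) = lin_ext F x + lin_ext F y"
    by (simp add: lin_ext_alt[of ?A] lookup_add sum.distrib)
next
  fix c and x :: "'a \<Rightarrow>\<^sub>0 'b"
  have "Poly_Mapping.keys (scal c x) \<subseteq> Poly_Mapping.keys x" by (auto simp: in_keys_iff)
  then show "lin_ext F (scal c x) = scal c (lin_ext F x)"
    by (simp add: lin_ext_alt[of "Poly_Mapping.keys x"] scal_sum)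
qed

lemmas lin_ext_simps [simp] = lin_add[OF lin_lin_ext] lin_scal[OF lin_lin_ext] lin_0[OF lin_lin_ext]
  lin_uminus[OF lin_lin_ext] lin_diff[OF lin_lin_ext] lin_sum[OF lin_lin_ext]

lemma lin_ext_gen [simp]: "lin_ext F (gen a :: _ \<Rightarrow>\<^sub>0 'k::comm_ring_1) = F a"
proof (cases "(1::'k) = 0")
  \<comment> \<open>Over the zero ring \<open>gen a\<close> has empty support, so the general
    computation fails; but then every element is 0.\<close>
  case True
  then have z: "x = 0" for x :: "'c \<Rightarrow>\<^sub>0 'k" using scal_simps(4,5)[of x] by simp
  show ?thesis using z[of "lin_ext F (gen a)"] z[of "F a"] by simp
qed (simp add: lin_ext_def)

lemma expand_gens: "x = (\<Sum>a\<in>Poly_Mapping.keys x. scal (Poly_Mapping.lookup x a) (gen a))"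
proof (rule poly_mapping_eqI)
  fix k
  have "Poly_Mapping.lookup (\<Sum>a\<in>Poly_Mapping.keys x. scal (Poly_Mapping.lookup x a) (gen a)) k
    = (\<Sum>a\<in>Poly_Mapping.keys x. Poly_Mapping.lookup x a * (if a = k then 1 else 0))"
    by (simp add: lookup_sum lookup_single when_def)
  also have "\<dots> = (\<Sum>a\<in>Poly_Mapping.keys x. if a = k then Poly_Mapping.lookup x a else 0)"
    by (intro sum.cong) auto
  also have "\<dots> = Poly_Mapping.lookup x k" by (simp add: in_keys_iff)
  finally show "Poly_Mapping.lookup x k = 
    Poly_Mapping.lookup (\<Sum>a\<in>Poly_Mapping.keys x. scal (Poly_Mapping.lookup x a) (gen a)) k" ..
qed

lemma free_on_induct [consumes 1, case_names zero gen add scal]: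
  assumes x: "x \<in> free_on A" and P: "P 0" "\<And>a. a \<in> A \<Longrightarrow> P (gen a)"
    "\<And>x y. P x \<Longrightarrow> P y \<Longrightarrow> P (x + y)" "\<And>c x. P x \<Longrightarrow> P (scal c x)"
  shows "P x"
proof -
  have "P (\<Sum>a\<in>B. scal (Poly_Mapping.lookup x a) (gen a))" if "finite B" "B \<subseteq> A" for B
    using that by (induction B rule: finite_induct) (auto intro: P)
  from this[of "Poly_Mapping.keys x"] show ?thesis
    using x expand_gens[of x] by (simp add: free_on_def)
qed

lemma free_on_0 [simp]: "0 \<in> free_on A"
  by (simp add: free_on_def)

lemma free_on_gen: "a \<in> A \<Longrightarrow> gen a \<in> free_on A"
  by (auto simp: free_on_def)

lemma free_on_iff: "x \<in> free_on A \<longleftrightarrow> (\<forall>a. a \<notin> A \<longrightarrow> Poly_Mapping.lookup x a = 0)"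
  by (auto simp: free_on_def in_keys_iff)

lemma free_on_add: "x \<in> free_on A \<Longrightarrow> y \<in> free_on A \<Longrightarrow> x + y \<in> free_on A"
  by (simp add: free_on_iff lookup_add)

lemma free_on_scal: "x \<in> free_on A \<Longrightarrow> scal c x \<in> free_on A"
  by (simp add: free_on_iff)

lemma free_on_uminus: "x \<in> free_on A \<Longrightarrow> - x \<in> free_on A"
  by (simp add: free_on_iff)

lemma free_on_diff: "x \<in> free_on A \<Longrightarrow> y \<in> free_on A \<Longrightarrow> x - y \<in> free_on A"
  by (simp add: free_on_iff lookup_minus)

lemma free_on_sum: "(\<And>i. i \<in> I \<Longrightarrow> f i \<in> free_on A) \<Longrightarrow> sum f I \<in> free_on A"
  by (induction I rule: infinite_finite_induct) (auto simp: free_on_add)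

lemma free_on_mono: "A \<subseteq> B \<Longrightarrow> x \<in> free_on A \<Longrightarrow> x \<in> free_on B"
  by (auto simp: free_on_def)

lemma free_on_empty: "x \<in> free_on {} \<Longrightarrow> x = 0"
  by (simp add: free_on_def)

lemma lin_eqI:
  assumes "lin F" "lin G" "\<And>a. a \<in> A \<Longrightarrow> F (gen a) = G (gen a)" "x \<in> free_on A"
  shows "F x = G x"
  using assms(4)
  by (induction rule: free_on_induct) (simp_all add: lin_0 lin_add lin_scal assms(1-3))

lemma lin_free_on:
  assumes "lin F" "\<And>a. a \<in> A \<Longrightarrow> F (gen a) \<in> free_on B" "x \<in> free_on A"
  shows "F x \<in> free_on B"
  using assms(3)
  by (induction rule: free_on_induct) (simp_all add: lin_0 lin_add lin_scal assms(1,2) free_on_add free_on_scal)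

section \<open>Bilinear composition and projections\<close>

lemma lin_comp_left: "lin (\<lambda>f. comp \<delta> f g)"
  unfolding comp_def by (rule lin_lin_ext)

lemma lin_comp_right: "lin (comp \<delta> f)"
  by (simp add: lin_def comp_def lin_ext_def[of _ f] sum.distrib scal_sum mult.commute)

lemmas comp_simps [simp] = lin_add[OF lin_comp_left] lin_scal[OF lin_comp_left] lin_0[OF lin_comp_left]
  lin_uminus[OF lin_comp_left] lin_diff[OF lin_comp_left] lin_sum[OF lin_comp_left]
  lin_add[OF lin_comp_right] lin_scal[OF lin_comp_right] lin_0[OF lin_comp_right]
  lin_uminus[OF lin_comp_right] lin_diff[OF lin_comp_right] lin_sum[OF lin_comp_right]

lemma comp_gen: "comp \<delta> (gen a) (gen b) = scal (\<delta> ^ num_loops a b) (gen (hat_comp a b))"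
  by (simp add: comp_def)

lemma lin_restrict: "lin (restrict_to Q)"
  unfolding restrict_to_def by (rule lin_lin_ext)

lemmas restrict_simps [simp] = lin_add[OF lin_restrict] lin_scal[OF lin_restrict] lin_0[OF lin_restrict]
  lin_uminus[OF lin_restrict] lin_diff[OF lin_restrict] lin_sum[OF lin_restrict]

lemma restrict_gen: "restrict_to Q (gen a) = (if Q a then gen a else 0)"
  by (simp add: restrict_to_def)

lemma restrict_id: "x \<in> free_on A \<Longrightarrow> (\<And>a. a \<in> A \<Longrightarrow> Q a) \<Longrightarrow> restrict_to Q x = x"
  by (induction rule: free_on_induct) (simp_all add: restrict_gen)

lemma restrict_free_on: "x \<in> free_on A \<Longrightarrow> restrict_to Q x \<in> free_on {a \<in> A. Q a}"
  by (induction rule: free_on_induct) (auto simp: restrict_gen free_on_add free_on_scal free_on_gen)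

lemma restrict_cong: "x \<in> free_on A \<Longrightarrow> (\<And>a. a \<in> A \<Longrightarrow> Q a \<longleftrightarrow> Q' a) \<Longrightarrow> restrict_to Q x = restrict_to Q' x"
  by (induction rule: free_on_induct) (simp_all add: restrict_gen)

section \<open>Spaces of upward, downward and level morphisms\<close>

abbreviation "Up p q \<equiv> free_on (brauer_up p q)"
abbreviation "Dn p q \<equiv> free_on (brauer_down p q)"
abbreviation "upw \<equiv> restrict_to upward"
abbreviation "dnw \<equiv> restrict_to downward"
abbreviation "lev \<equiv> restrict_to level"
abbreviation "idm p \<equiv> gen (id_diagram p)"

lemma hom_simps:
  "0 \<in> hom_B p q" "x \<in> hom_B p q \<Longrightarrow> y \<in> hom_B p q \<Longrightarrow> x + y \<in> hom_B p q"
  "x \<in> hom_B p q \<Longrightarrow> scal c x \<in> hom_B p q"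
  "0 \<in> hom_S p q" "x \<in> hom_S p q \<Longrightarrow> y \<in> hom_S p q \<Longrightarrow> x + y \<in> hom_S p q"
  "x \<in> hom_S p q \<Longrightarrow> scal c x \<in> hom_S p q"
  by (simp_all add: hom_B_def hom_S_def free_on_add free_on_scal)

lemma comp_free_on:
  assumes "f \<in> free_on A" "g \<in> free_on B" "\<And>a b. a \<in> A \<Longrightarrow> b \<in> B \<Longrightarrow> hat_comp a b \<in> C"
  shows "comp \<delta> f g \<in> free_on C"
proof (rule lin_free_on[OF lin_comp_left _ assms(1)])
  fix a assume "a \<in> A"
  then show "comp \<delta> (gen a) g \<in> free_on C"
    by (intro lin_free_on[OF lin_comp_right _ assms(2)]) (simp add: comp_gen free_on_scal free_on_gen assms(3))
qed

lemma comp_hom_B: "f \<in> hom_B q s \<Longrightarrow> g \<in> hom_B p q \<Longrightarrow> comp \<delta> f g \<in> hom_B p s"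
  unfolding hom_B_def by (erule (1) comp_free_on) (rule hat_comp_closed)

lemma comp_Up: "f \<in> Up q s \<Longrightarrow> g \<in> Up p q \<Longrightarrow> comp \<delta> f g \<in> Up p s"
  by (erule (1) comp_free_on) (rule hat_comp_up)

lemma comp_Dn: "f \<in> Dn q s \<Longrightarrow> g \<in> Dn p q \<Longrightarrow> comp \<delta> f g \<in> Dn p s"
  by (erule (1) comp_free_on) (rule hat_comp_down)

lemma comp_hom_S: "f \<in> hom_S q s \<Longrightarrow> g \<in> hom_S p q \<Longrightarrow> comp \<delta> f g \<in> hom_S p s"
  unfolding hom_S_def by (erule (1) comp_free_on) (rule hat_comp_level)

lemma comp_eqI2:
  assumes "f \<in> free_on A" "g \<in> free_on B"
    and "\<And>g. lin (\<lambda>f. F f g)" "\<And>f. lin (F f)" "\<And>g. lin (\<lambda>f. G f g)" "\<And>f. lin (G f)"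
    and "\<And>a b. a \<in> A \<Longrightarrow> b \<in> B \<Longrightarrow> F (gen a) (gen b) = G (gen a) (gen b)"
  shows "F f g = G f g"
proof (rule lin_eqI[of "\<lambda>f. F f g" "\<lambda>f. G f g", OF assms(3) assms(5) _ assms(1)])
  fix a assume "a \<in> A"
  then show "F (gen a) g = G (gen a) g"
    by (intro lin_eqI[of "F (gen a)" "G (gen a)", OF assms(4) assms(6) _ assms(2)]) (rule assms(7))
qed

text \<open>The numbers of loops at the two stages differ between the bracketings and only their
  totals agree, so the powers of \<open>\<delta>\<close> are compared after multiplication.\<close>

lemma comp_assoc:
  assumes "f \<in> hom_B r s" "g \<in> hom_B q r" "h \<in> hom_B p q"
  shows "comp \<delta> (comp \<delta> f g) h = comp \<delta> f (comp \<delta> g h)"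
proof -
  have *: "comp \<delta> (comp \<delta> (gen a) (gen b)) h = comp \<delta> (gen a) (comp \<delta> (gen b) h)"
    if "a \<in> brauer r s" "b \<in> brauer q r" for a b
  proof (rule lin_eqI[of "comp \<delta> (comp \<delta> (gen a) (gen b))" "\<lambda>h. comp \<delta> (gen a) (comp \<delta> (gen b) h)"])
    show "h \<in> free_on (brauer p q)" using assms(3) by (simp add: hom_B_def)
    fix c assume c: "c \<in> brauer p q"
    show "comp \<delta> (comp \<delta> (gen a) (gen b)) (gen c) = comp \<delta> (gen a) (comp \<delta> (gen b) (gen c))"
      using num_loops_assoc[OF brauer_finite_Union[OF that(1)] brauer_finite_Union[OF that(2)] brauer_finite_Union[OF c]]
      by (simp add: comp_gen hat_comp_assoc flip: power_add)
  qed (simp_all add: lin_def)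
  show ?thesis
    by (rule comp_eqI2[of f "brauer r s" g "brauer q r" "\<lambda>f g. comp \<delta> (comp \<delta> f g) h" "\<lambda>f g. comp \<delta> f (comp \<delta> g h)"])
      (use assms * in \<open>simp_all add: lin_def hom_B_def\<close>)
qed

lemma one_hom_S: "idm p \<in> hom_S p p"
  unfolding hom_S_def by (rule free_on_gen[OF id_level])

lemma num_loops_id: "g \<in> brauer p q \<Longrightarrow> num_loops (id_diagram q) g = 0" 
  "g \<in> brauer p q \<Longrightarrow> num_loops g (id_diagram p) = 0"
  by (rule num_loops_up[OF level_in_up[OF id_level]], assumption) (rule num_loops_down[OF _ level_in_down[OF id_level]])

lemma one_comp: "f \<in> hom_B p q \<Longrightarrow> comp \<delta> (idm q) f = f"
  unfolding hom_B_def by (induction rule: free_on_induct) (simp_all add: comp_gen num_loops_id id_hat_comp)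

lemma comp_one: "f \<in> hom_B p q \<Longrightarrow> comp \<delta> f (idm p) = f"
  unfolding hom_B_def by (induction rule: free_on_induct) (simp_all add: comp_gen num_loops_id hat_comp_id)

lemma Up_hom: "f \<in> Up p q \<Longrightarrow> f \<in> hom_B p q"
  unfolding hom_B_def by (erule free_on_mono[rotated]) (auto simp: brauer_up_def)

lemma Dn_hom: "f \<in> Dn p q \<Longrightarrow> f \<in> hom_B p q"
  unfolding hom_B_def by (erule free_on_mono[rotated]) (auto simp: brauer_down_def)

lemma hom_S_Up: "f \<in> hom_S p q \<Longrightarrow> f \<in> Up p q"
  unfolding hom_S_def by (erule free_on_mono[rotated]) (auto intro: level_in_up)

lemma hom_S_Dn: "f \<in> hom_S p q \<Longrightarrow> f \<in> Dn p q"
  unfolding hom_S_def by (erule free_on_mono[rotated]) (auto intro: level_in_down)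

lemma hom_S_hom: "f \<in> hom_S p q \<Longrightarrow> f \<in> hom_B p q"
  by (rule Up_hom[OF hom_S_Up])

lemma one_hom: "idm p \<in> hom_B p p" by (rule hom_S_hom[OF one_hom_S])
lemma one_Up: "idm p \<in> Up p p" by (rule hom_S_Up[OF one_hom_S])
lemma one_Dn: "idm p \<in> Dn p p" by (rule hom_S_Dn[OF one_hom_S])

lemma Up_square: "Up p p = hom_S p p" by (simp add: brauer_up_square hom_S_def)
lemma Up_zero: "q < p \<Longrightarrow> f \<in> Up p q \<Longrightarrow> f = 0"
proof -
  assume "q < p" "f \<in> Up p q"
  moreover have "brauer_up p q = {}" using brauer_up_le[of _ p q] \<open>q < p\<close> by (meson equals0I leD)
  ultimately show ?thesis by (simp add: free_on_empty)
qed

lemma Dn_zero: "p < q \<Longrightarrow> f \<in> Dn p q \<Longrightarrow> f = 0"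
proof -
  assume "p < q" "f \<in> Dn p q"
  moreover have "brauer_down p q = {}" using brauer_down_le[of _ p q] \<open>p < q\<close> by (meson equals0I leD)
  ultimately show ?thesis by (simp add: free_on_empty)
qed

lemma hom_S_zero: "p \<noteq> q \<Longrightarrow> f \<in> hom_S p q \<Longrightarrow> f = 0"
proof -
  assume "p \<noteq> q" "f \<in> hom_S p q"
  moreover have "brauer_level p q = {}" using brauer_level_eq[of _ p q] \<open>p \<noteq> q\<close> by (meson equals0I)
  ultimately show ?thesis by (simp add: hom_S_def free_on_empty)
qed

lemma upw_Up: "f \<in> hom_B p q \<Longrightarrow> upw f \<in> Up p q"
  unfolding hom_B_def brauer_up_def by (rule restrict_free_on)

lemma dnw_Dn: "f \<in> hom_B p q \<Longrightarrow> dnw f \<in> Dn p q"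
  unfolding hom_B_def brauer_down_def by (rule restrict_free_on)

lemma lev_hom_S: "f \<in> hom_B p q \<Longrightarrow> lev f \<in> hom_S p q"
  unfolding hom_B_def hom_S_def brauer_level_def by (rule restrict_free_on)

lemma upw_id: "f \<in> Up p q \<Longrightarrow> upw f = f"
  by (erule restrict_id) (simp add: brauer_up_def)

lemma dnw_id: "f \<in> Dn p q \<Longrightarrow> dnw f = f"
  by (erule restrict_id) (simp add: brauer_down_def)

lemma lev_id: "f \<in> hom_S p q \<Longrightarrow> lev f = f"
  unfolding hom_S_def by (erule restrict_id) (simp add: brauer_level_def)

lemma upw_square: "f \<in> hom_B p p \<Longrightarrow> upw f = lev f"
proof -
  assume f: "f \<in> hom_B p p"
  have "upward D \<longleftrightarrow> level D" if "D \<in> brauer p p" for D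
    using that brauer_up_square[of p] by (auto simp: brauer_up_def brauer_level_def)
  with f show ?thesis unfolding hom_B_def by (intro restrict_cong[of f "brauer p p"])
qed

lemma dnw_square: "f \<in> hom_B p p \<Longrightarrow> dnw f = lev f"
proof -
  assume f: "f \<in> hom_B p p"
  have "downward D \<longleftrightarrow> level D" if "D \<in> brauer p p" for D
    using that brauer_down_square[of p] by (auto simp: brauer_down_def brauer_level_def)
  with f show ?thesis unfolding hom_B_def by (intro restrict_cong[of f "brauer p p"])
qed

text \<open>What a projection discards in the inner factor can never become upward, downward or
  level again after composing. Together with \<open>comp_assoc\<close> this yields associativity of
  the projection actions and of the pairing \<open>pr\<close> introduced below.\<close>

lemma restrict_comp_eq:
  assumes "f \<in> hom_B q s" "g \<in> hom_B p q"
  shows "upw (comp \<delta> f g) = upw (comp \<delta> f (upw g))"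
    "dnw (comp \<delta> f g) = dnw (comp \<delta> (dnw f) g)"
    "lev (comp \<delta> f g) = lev (comp \<delta> f (upw g))"
    "lev (comp \<delta> f g) = lev (comp \<delta> (dnw f) g)"
proof -
  note r = comp_eqI2[of f "brauer q s" g "brauer p q"]
  note fg = assms[unfolded hom_B_def]
  show "upw (comp \<delta> f g) = upw (comp \<delta> f (upw g))"
    by (rule r[of "\<lambda>f g. upw (comp \<delta> f g)" "\<lambda>f g. upw (comp \<delta> f (upw g))", OF fg])
      (auto simp: lin_def restrict_gen comp_gen not_upward_hat_comp)
  show "dnw (comp \<delta> f g) = dnw (comp \<delta> (dnw f) g)"
    by (rule r[of "\<lambda>f g. dnw (comp \<delta> f g)" "\<lambda>f g. dnw (comp \<delta> (dnw f) g)", OF fg])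
      (auto simp: lin_def restrict_gen comp_gen not_downward_hat_comp)
  show "lev (comp \<delta> f g) = lev (comp \<delta> f (upw g))"
    by (rule r[of "\<lambda>f g. lev (comp \<delta> f g)" "\<lambda>f g. lev (comp \<delta> f (upw g))", OF fg])
      (auto simp: lin_def restrict_gen comp_gen level_def not_upward_hat_comp)
  show "lev (comp \<delta> f g) = lev (comp \<delta> (dnw f) g)"
    by (rule r[of "\<lambda>f g. lev (comp \<delta> f g)" "\<lambda>f g. lev (comp \<delta> (dnw f) g)", OF fg])
      (auto simp: lin_def restrict_gen comp_gen level_def not_downward_hat_comp)
qed

text \<open>With fewer middle than top points, two top points are already joined above the middle
  row.\<close>

lemma upw_comp_through:
  assumes "f \<in> hom_B q s" "g \<in> hom_B p q" "q < p"
  shows "upw (comp \<delta> f g) = 0"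
  using restrict_comp_eq(1)[OF assms(1,2)] Up_zero[OF assms(3) upw_Up[OF assms(2)]] by simp

lemma upw_comp_Up:
  assumes "f \<in> Up q s" "g \<in> hom_B p q"
  shows "upw (comp \<delta> f g) = comp \<delta> f (upw g)"
  using restrict_comp_eq(1)[OF Up_hom[OF assms(1)] assms(2)] upw_id[OF comp_Up[OF assms(1) upw_Up[OF assms(2)]]]
  by simp

text \<open>Off the diagonal both level parts vanish for lack of level diagrams; on it the level
  part of \<open>g\<close> is its upward part.\<close>

lemma lev_comp_left:
  assumes "f \<in> hom_S q q" "g \<in> hom_B p q"
  shows "lev (comp \<delta> f g) = comp \<delta> f (lev g)"
proof -
  have "lev (comp \<delta> f g) = lev (comp \<delta> f (upw g))"
    by (rule restrict_comp_eq(3)[OF hom_S_hom[OF assms(1)] assms(2)])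
  also have "\<dots> = comp \<delta> f (lev g)"
  proof (cases "p = q")
    case True
    then have "upw g = lev g" "lev g \<in> hom_S q q" using assms(2) upw_square lev_hom_S by auto
    then show ?thesis using lev_id[OF comp_hom_S[OF assms(1)]] by simp
  next
    case False
    have "comp \<delta> f (upw g) \<in> hom_B p q"
      by (rule comp_hom_B[OF hom_S_hom[OF assms(1)] Up_hom[OF upw_Up[OF assms(2)]]])
    from hom_S_zero[OF False lev_hom_S[OF this]] hom_S_zero[OF False lev_hom_S[OF assms(2)]]
    show ?thesis by simp
  qed
  finally show ?thesis .
qed

lemma lev_comp_right:
  assumes "f \<in> hom_B q s" "g \<in> hom_S q q"
  shows "lev (comp \<delta> f g) = comp \<delta> (lev f) g"
proof -
  have "lev (comp \<delta> f g) = lev (comp \<delta> (dnw f) g)"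
    by (rule restrict_comp_eq(4)[OF assms(1) hom_S_hom[OF assms(2)]])
  also have "\<dots> = comp \<delta> (lev f) g"
  proof (cases "q = s")
    case True
    then have "dnw f = lev f" "lev f \<in> hom_S q q" using assms(1) dnw_square lev_hom_S by auto
    then show ?thesis using lev_id[OF comp_hom_S[OF _ assms(2)]] by simp
  next
    case False
    have "comp \<delta> (dnw f) g \<in> hom_B q s"
      by (rule comp_hom_B[OF Dn_hom[OF dnw_Dn[OF assms(1)]] hom_S_hom[OF assms(2)]])
    from hom_S_zero[OF False lev_hom_S[OF this]] hom_S_zero[OF False lev_hom_S[OF assms(1)]]
    show ?thesis by simp
  qed
  finally show ?thesis .
qed

section \<open>The Gram matrix and dual bases\<close>

lemma det_on_inverse:
  fixes A :: "'i \<Rightarrow> 'i \<Rightarrow> 'a::comm_ring_1"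
  assumes I: "finite I" and d: "det_on I A dvd 1"
  obtains N where
    "\<And>i k. i \<in> I \<Longrightarrow> k \<in> I \<Longrightarrow> (\<Sum>j\<in>I. N i j * A j k) = (if i = k then 1 else 0)"
    "\<And>i k. i \<in> I \<Longrightarrow> k \<in> I \<Longrightarrow> (\<Sum>j\<in>I. A i j * N j k) = (if i = k then 1 else 0)"
proof -
  define n where "n = card I"
  define e where "e = from_nat_into I"
  define AA where "AA = mat n n (\<lambda>(i, j). A (e i) (e j))"
  have bij: "bij_betw e {..<n} I" unfolding e_def n_def by (rule bij_betw_from_nat_into_finite[OF I])
  have AA: "AA \<in> carrier_mat n n" by (simp add: AA_def)
  obtain c where c: "1 = det AA * c" using d by (auto simp: det_on_def AA_def n_def e_def)
  note adj = adj_mat[OF AA]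
  define ix where "ix = the_inv_into {..<n} e"
  have inj: "inj_on e {..<n}" and im: "e ` {..<n} = I" using bij by (auto simp: bij_betw_def)
  have ixe: "ix (e k) = k" if "k < n" for k using the_inv_into_f_f[OF inj] that by (simp add: ix_def)
  have exI: "\<exists>k<n. i = e k" if "i \<in> I" for i using that im by auto
  \<comment> \<open>The adjugate divided by the determinant, carried from positions back to indices
    by \<open>ix\<close>.\<close>
  define N where "N i j = c * adj_mat AA $$ (ix i, ix j)" for i j
  have re: "(\<Sum>j\<in>I. g j) = (\<Sum>k<n. g (e k))" for g :: "'i \<Rightarrow> 'a"
    by (rule sum.reindex_bij_betw[OF bij, symmetric])
  have eq: "e a = e b \<longleftrightarrow> a = b" if "a < n" "b < n" for a b using inj that by (auto dest: inj_onD)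
  show ?thesis
  proof (rule that[of N])
    fix i k assume "i \<in> I" "k \<in> I"
    then obtain a b where ab: "a < n" "b < n" "i = e a" "k = e b" using exI[of i] exI[of k] by auto
    have "(\<Sum>j\<in>I. N i j * A j k) = c * (\<Sum>l<n. adj_mat AA $$ (a, l) * AA $$ (l, b))"
      unfolding re sum_distrib_left
      by (rule sum.cong) (auto simp: N_def ab ixe AA_def mult.assoc)
    also have "(\<Sum>l<n. adj_mat AA $$ (a, l) * AA $$ (l, b)) = (adj_mat AA * AA) $$ (a, b)"
      using adj(1) AA ab by (simp add: times_mat_def scalar_prod_def lessThan_atLeast0)
    also have "c * \<dots> = (if i = k then 1 else 0)" using adj(3) c ab by (simp add: mult.commute eq)
    finally show "(\<Sum>j\<in>I. N i j * A j k) = (if i = k then 1 else 0)" .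
    have "(\<Sum>j\<in>I. A i j * N j k) = c * (\<Sum>l<n. AA $$ (a, l) * adj_mat AA $$ (l, b))"
      unfolding re sum_distrib_left
      by (rule sum.cong) (auto simp: N_def ab ixe AA_def mult_ac)
    also have "(\<Sum>l<n. AA $$ (a, l) * adj_mat AA $$ (l, b)) = (AA * adj_mat AA) $$ (a, b)"
      using adj(1) AA ab by (simp add: times_mat_def scalar_prod_def lessThan_atLeast0)
    also have "c * \<dots> = (if i = k then 1 else 0)" using adj(2) c ab by (simp add: mult.commute eq)
    finally show "(\<Sum>j\<in>I. A i j * N j k) = (if i = k then 1 else 0)" .
  qed
qed

lemma det_on_left_inverse:
  fixes A :: "'i \<Rightarrow> 'i \<Rightarrow> 'a::comm_ring_1"
  assumes I: "finite I"
    and N: "\<And>i k. i \<in> I \<Longrightarrow> k \<in> I \<Longrightarrow> (\<Sum>j\<in>I. N i j * A j k) = (if i = k then 1 else 0)"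
  shows "det_on I A dvd 1"
proof -
  define n where "n = card I"
  define e where "e = from_nat_into I"
  define AA where "AA = mat n n (\<lambda>(i, j). A (e i) (e j))"
  define NN where "NN = mat n n (\<lambda>(i, j). N (e i) (e j))"
  have bij: "bij_betw e {..<n} I" unfolding e_def n_def by (rule bij_betw_from_nat_into_finite[OF I])
  then have inj: "inj_on e {..<n}" and im: "e ` {..<n} = I" by (auto simp: bij_betw_def)
  have eq: "e a = e b \<longleftrightarrow> a = b" if "a < n" "b < n" for a b using inj that by (auto dest: inj_onD)
  have "NN * AA = 1\<^sub>m n"
  proof (rule eq_matI)
    fix a b assume "a < dim_row (1\<^sub>m n :: 'a mat)" "b < dim_col (1\<^sub>m n :: 'a mat)"
    then have ab: "a < n" "b < n" by auto
    then have "(NN * AA) $$ (a, b) = (\<Sum>l<n. N (e a) (e l) * A (e l) (e b))"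
      by (simp add: times_mat_def scalar_prod_def lessThan_atLeast0 NN_def AA_def)
    also have "\<dots> = (\<Sum>j\<in>I. N (e a) j * A j (e b))"
      by (rule sum.reindex_bij_betw[OF bij])
    also have "\<dots> = (if e a = e b then 1 else 0)" by (rule N) (use ab im in auto)
    finally show "(NN * AA) $$ (a, b) = 1\<^sub>m n $$ (a, b)" using ab by (simp add: eq)
  qed (simp_all add: NN_def AA_def)
  then have "det (NN * AA) = 1" by simp
  moreover have "det (NN * AA) = det NN * det AA" by (rule det_mult[of _ n]) (simp_all add: NN_def AA_def)
  ultimately have "1 = det AA * det NN" by (simp add: mult.commute)
  then show ?thesis unfolding det_on_def AA_def n_def e_def by (rule dvdI)
qed

lemma (in comm_ring_hom) det_on_hom: "hom (det_on I A) = det_on I (\<lambda>i j. hom (A i j))"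
proof -
  have "map_mat hom (mat (card I) (card I) (\<lambda>(i, j). A (from_nat_into I i) (from_nat_into I j))) =
    mat (card I) (card I) (\<lambda>(i, j). hom (A (from_nat_into I i) (from_nat_into I j)))"
    by (intro eq_matI) auto
  then show ?thesis by (simp add: det_on_def flip: hom_det)
qed

section \<open>The Gram matrix over the coefficient ring\<close>

abbreviation pr :: "'k::comm_ring_1 \<Rightarrow> 'k morphism \<Rightarrow> 'k morphism \<Rightarrow> 'k morphism" where
  "pr \<delta> n x \<equiv> lev (comp \<delta> n x)"

definition gram :: "'k::comm_ring_1 \<Rightarrow> diagram \<times> diagram \<Rightarrow> diagram \<times> diagram \<Rightarrow> 'k" where
  "gram \<delta> = (\<lambda>(f, \<sigma>) (g, \<tau>). Poly_Mapping.lookup (comp \<delta> (pr \<delta> (gen (flip f)) (gen g)) (gen \<tau>)) \<sigma>)"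

definition gram_index :: "nat \<Rightarrow> nat \<Rightarrow> (diagram \<times> diagram) set" where
  "gram_index p q = brauer_up_mono p q \<times> brauer_level p p"

text \<open>Each entry is zero or a product of powers of the parameter, under a condition on
  diagrams alone. Evaluating the polynomial matrix at \<open>\<delta>\<close> is therefore entrywise
  substitution.\<close>

lemma gram_formula: "gram \<delta> (f, \<sigma>) (g, \<tau>) =
  (if level (hat_comp (flip f) g) \<and> hat_comp (hat_comp (flip f) g) \<tau> = \<sigma> 
   then \<delta> ^ num_loops (flip f) g * \<delta> ^ num_loops (hat_comp (flip f) g) \<tau> else 0)"
  by (simp add: gram_def comp_gen restrict_gen lookup_single when_def)

lemma gram_block_entry_eq: "gram_block_entry = gram [:0, 1:]"
  by (auto intro!: ext simp: gram_block_entry_def gram_def gram_entry_def comp_gen restrict_gen)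

lemma finite_brauer: "finite (brauer p q)"
proof (rule finite_subset)
  show "brauer p q \<subseteq> Pow (Pow (points p q))"
  proof
    fix D assume "D \<in> brauer p q"
    then have "\<Union>D = points p q" by (simp add: brauer_pairing pairing_Union)
    then show "D \<in> Pow (Pow (points p q))" by auto
  qed
  show "finite (Pow (Pow (points p q)))" by (simp add: finite_points)
qed

lemma finite_gram_index: "finite (gram_index p q)"
proof -
  have "brauer_up_mono p q \<subseteq> brauer p q" "brauer_level p p \<subseteq> brauer p p"
    by (auto simp: brauer_up_mono_def brauer_up_def brauer_level_def)
  then show ?thesis unfolding gram_index_def
    using finite_subset[OF _ finite_brauer] by (intro finite_cartesian_product) metis+
qed

lemma finite_mono: "finite (brauer_up_mono p q)"
  by (rule finite_subset[OF _ finite_brauer[of p q]]) (auto simp: brauer_up_mono_def brauer_up_def)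

lemma eval_comm_ring_hom: "comm_ring_hom (\<lambda>P. poly (map_poly of_int P) (\<delta>::'k::comm_ring_1))"
proof -
  let ?ev = "\<lambda>P. poly (map_poly of_int P) \<delta>"
  have pC: "?ev (pCons a P) = of_int a + \<delta> * ?ev P" for a P by (simp add: map_poly_pCons)
  have add: "?ev (P + Q) = ?ev P + ?ev Q" for P Q
  proof -
    have "map_poly of_int (P + Q) = map_poly of_int P + (map_poly of_int Q :: 'k poly)"
      by (rule poly_eqI) (simp add: coeff_map_poly)
    then show ?thesis by simp
  qed
  have smult: "?ev (smult a P) = of_int a * ?ev P" for a P
    by (induction P) (simp_all add: pC algebra_simps)
  have "?ev (P * Q) = ?ev P * ?ev Q" for P Q
    by (induction P) (simp_all add: pC add smult algebra_simps)
  with add show ?thesis by unfold_locales simp_all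
qed

lemma gram_det_eval:
  "poly (map_poly of_int (gram_det p q)) (\<delta>::'k::comm_ring_1) = det_on (gram_index p q) (gram \<delta>)"
proof -
  interpret ev: comm_ring_hom "\<lambda>P. poly (map_poly of_int P) \<delta>" by (rule eval_comm_ring_hom)
  have x: "poly (map_poly of_int [:0, 1:]) \<delta> = \<delta>" by (simp add: map_poly_pCons)
  have "poly (map_poly of_int (gram [:0, 1:] i j)) \<delta> = gram \<delta> i j" for i j
    by (cases i; cases j) (simp only: gram_formula ev.hom_mult ev.hom_power x ev.hom_zero if_distrib[of "\<lambda>P. poly (map_poly of_int P) \<delta>"])
  then show ?thesis
    unfolding gram_det_def gram_block_entry_eq gram_index_def[symmetric] ev.det_on_hom by simp
qed

lemma non_singular_iff: 
  "non_singular (\<delta>::'k::comm_ring_1) \<longleftrightarrow> (\<forall>p q. p \<preceq>\<^sub>B q \<longrightarrow> det_on (gram_index p q) (gram \<delta>) dvd 1)"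
  by (simp add: non_singular_def gram_det_eval)

text \<open>The families \<open>bas\<close> and \<open>dbas\<close> are the bases of upward and downward diagrams for which \<open>gram\<close>
  is the matrix of the form taking \<open>n, x\<close> to the coefficient of the identity in \<open>pr \<delta> n x\<close>.\<close>

definition bas :: "diagram \<times> diagram \<Rightarrow> 'k::comm_ring_1 morphism" where
  "bas = (\<lambda>(g, \<tau>). gen (hat_comp g \<tau>))"

definition dbas :: "diagram \<times> diagram \<Rightarrow> 'k::comm_ring_1 morphism" where
  "dbas = (\<lambda>(f, \<sigma>). gen (hat_comp (flip \<sigma>) (flip f)))"

lemma mono_up: "f \<in> brauer_up_mono p q \<Longrightarrow> f \<in> brauer_up p q"
  by (simp add: brauer_up_mono_def)

lemma gen_up: "f \<in> brauer_up_mono p q \<Longrightarrow> gen f \<in> Up p q"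
  by (rule free_on_gen[OF mono_up])

lemma gen_flip_dn: "f \<in> brauer_up_mono p q \<Longrightarrow> gen (flip f) \<in> Dn q p"
  by (rule free_on_gen[OF flip_brauer_up[OF mono_up]])

lemma gen_level: "\<sigma> \<in> brauer_level p p \<Longrightarrow> gen \<sigma> \<in> hom_S p p"
  unfolding hom_S_def by (rule free_on_gen)

lemma comp_gen_level:
  "\<sigma> \<in> brauer_level p p \<Longrightarrow> f \<in> brauer p q \<Longrightarrow> comp \<delta> (gen f) (gen \<sigma>) = gen (hat_comp f \<sigma>)"
  "\<sigma> \<in> brauer_level q q \<Longrightarrow> f \<in> brauer p q \<Longrightarrow> comp \<delta> (gen \<sigma>) (gen f) = gen (hat_comp \<sigma> f)"
  by (simp_all add: comp_gen num_loops_down[OF _ level_in_down] num_loops_up[OF level_in_up])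

lemma bas_comp:
  assumes "(g, \<tau>) \<in> gram_index p q"
  shows "bas (g, \<tau>) = comp \<delta> (gen g) (gen \<tau>)"
proof -
  have "g \<in> brauer p q" using assms by (simp add: gram_index_def brauer_up_mono_def brauer_up_def)
  then show ?thesis using assms comp_gen_level(1)[of \<tau> p g q \<delta>] by (simp add: bas_def gram_index_def)
qed

lemma dbas_comp:
  assumes "(f, \<sigma>) \<in> gram_index p q"
  shows "dbas (f, \<sigma>) = comp \<delta> (gen (flip \<sigma>)) (gen (flip f))"
proof -
  have "f \<in> brauer p q" using assms by (simp add: gram_index_def brauer_up_mono_def brauer_up_def)
  then show ?thesis using assms comp_gen_level(2)[OF flip_brauer_level flip_brauer, of \<sigma> p f q \<delta>]
    by (simp add: dbas_def gram_index_def)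
qed

lemma bas_Up: "j \<in> gram_index p q \<Longrightarrow> bas j \<in> Up p q"
  unfolding gram_index_def bas_def
  by (cases j) (auto intro!: free_on_gen hat_comp_up[OF mono_up level_in_up])

lemma dbas_Dn: "j \<in> gram_index p q \<Longrightarrow> dbas j \<in> Dn q p"
  unfolding gram_index_def dbas_def
  by (cases j) (auto intro!: free_on_gen hat_comp_down[OF flip_brauer_up[OF level_in_up] flip_brauer_up[OF mono_up]])

lemma free_on_span:
  assumes x: "x \<in> free_on A" and e: "\<And>a. a \<in> A \<Longrightarrow> \<exists>i\<in>I. gen a = b i" and I: "finite I"
  shows "\<exists>c. x = (\<Sum>i\<in>I. scal (c i) (b i))"
  using x
proof (induction rule: free_on_induct)
  case zero
  show ?case by (rule exI[of _ "\<lambda>i. 0"]) simp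
next
  case (gen a)
  then obtain i where "i \<in> I" "gen a = b i" using e by auto
  then have "gen a = (\<Sum>j\<in>I. if j = i then b j else 0)" using I by simp
  also have "\<dots> = (\<Sum>j\<in>I. scal (if j = i then 1 else 0) (b j))"
    by (rule sum.cong) auto
  finally show ?case by (rule exI[of _ "\<lambda>j. if j = i then 1 else 0"])
next
  case (add x y)
  then obtain c d where "x = (\<Sum>i\<in>I. scal (c i) (b i))" "y = (\<Sum>i\<in>I. scal (d i) (b i))" by auto
  then have "x + y = (\<Sum>i\<in>I. scal (c i + d i) (b i))" by (simp add: sum.distrib)
  then show ?case by (rule exI[of _ "\<lambda>i. c i + d i"])
next
  case (scal k x)
  then obtain c where "x = (\<Sum>i\<in>I. scal (c i) (b i))" by auto
  then have "scal k x = (\<Sum>i\<in>I. scal (k * c i) (b i))" by (simp add: scal_sum)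
  then show ?case by (rule exI[of _ "\<lambda>i. k * c i"])
qed

lemma bas_span:
  assumes "x \<in> Up p q"
  shows "\<exists>c. x = (\<Sum>j\<in>gram_index p q. scal (c j) (bas j))"
proof (rule free_on_span[OF assms _ finite_gram_index])
  fix D assume "D \<in> brauer_up p q"
  then obtain f \<sigma> where "f \<in> brauer_up_mono p q" "\<sigma> \<in> brauer_level p p" "hat_comp f \<sigma> = D"
    by (rule brauer_up_mono_factor)
  then show "\<exists>j\<in>gram_index p q. gen D = bas j"
    by (intro bexI[of _ "(f, \<sigma>)"]) (auto simp: bas_def gram_index_def)
qed

lemma dbas_span:
  assumes "x \<in> Dn q p"
  shows "\<exists>c. x = (\<Sum>j\<in>gram_index p q. scal (c j) (dbas j))"
proof (rule free_on_span[OF assms _ finite_gram_index])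
  fix D assume "D \<in> brauer_down q p"
  then have "flip D \<in> brauer_up p q" by (rule flip_brauer_down)
  then obtain f \<sigma> where f: "f \<in> brauer_up_mono p q" "\<sigma> \<in> brauer_level p p" "hat_comp f \<sigma> = flip D"
    by (rule brauer_up_mono_factor)
  then have "hat_comp (flip \<sigma>) (flip f) = D" by (metis flip_hat_comp flip_flip)
  then show "\<exists>j\<in>gram_index p q. gen D = dbas j"
    using f by (intro bexI[of _ "(f, \<sigma>)"]) (auto simp: dbas_def gram_index_def)
qed

lemma pr_hom_S: "n \<in> Dn q p \<Longrightarrow> x \<in> Up p q \<Longrightarrow> pr \<delta> n x \<in> hom_S p p"
  by (rule lev_hom_S[OF comp_hom_B[OF Dn_hom Up_hom]])

lemma pr_comp_right:
  assumes "n \<in> Dn q p" "x \<in> Up p q" "c \<in> hom_S p p"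
  shows "pr \<delta> n (comp \<delta> x c) = comp \<delta> (pr \<delta> n x) c"
  using lev_comp_right[OF comp_hom_B[OF Dn_hom[OF assms(1)] Up_hom[OF assms(2)]] assms(3)]
    comp_assoc[OF Dn_hom[OF assms(1)] Up_hom[OF assms(2)] hom_S_hom[OF assms(3)]] by metis

lemma pr_comp_left:
  assumes "n \<in> Dn q p" "x \<in> Up p q" "c \<in> hom_S p p"
  shows "pr \<delta> (comp \<delta> c n) x = comp \<delta> c (pr \<delta> n x)"
  using lev_comp_left[OF assms(3) comp_hom_B[OF Dn_hom[OF assms(1)] Up_hom[OF assms(2)]]]
    comp_assoc[OF hom_S_hom[OF assms(3)] Dn_hom[OF assms(1)] Up_hom[OF assms(2)]] by metis

lemma level_cancel:
  assumes "\<rho> \<in> brauer_level p p" "\<sigma> \<in> brauer_level p p"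
  shows "hat_comp \<rho> (flip \<sigma>) = id_diagram p \<longleftrightarrow> \<rho> = \<sigma>" "hat_comp (flip \<sigma>) \<rho> = id_diagram p \<longleftrightarrow> \<rho> = \<sigma>"
proof -
  have b: "\<rho> \<in> brauer p p" "\<sigma> \<in> brauer p p" using assms by (auto simp: brauer_level_def)
  show "hat_comp \<rho> (flip \<sigma>) = id_diagram p \<longleftrightarrow> \<rho> = \<sigma>"
  proof
    assume "hat_comp \<rho> (flip \<sigma>) = id_diagram p"
    then have "hat_comp (hat_comp \<rho> (flip \<sigma>)) \<sigma> = \<sigma>" using id_hat_comp[OF b(2)] by simp
    then show "\<rho> = \<sigma>" by (simp add: hat_comp_assoc flip_hat_comp_level[OF assms(2)] hat_comp_id[OF b(1)])
  qed (simp add: hat_comp_flip_level[OF assms(2)])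
  show "hat_comp (flip \<sigma>) \<rho> = id_diagram p \<longleftrightarrow> \<rho> = \<sigma>"
  proof
    assume "hat_comp (flip \<sigma>) \<rho> = id_diagram p"
    then have "hat_comp \<sigma> (hat_comp (flip \<sigma>) \<rho>) = \<sigma>" using hat_comp_id[OF b(2)] by simp
    then show "\<rho> = \<sigma>"
      by (simp add: hat_comp_flip_level[OF assms(2)] id_hat_comp[OF b(1)] flip: hat_comp_assoc)
  qed (simp add: flip_hat_comp_level[OF assms(2)])
qed

text \<open>Multiplying by the inverse of \<open>\<sigma>\<close>, which is its flip, moves the
  coefficient of \<open>\<sigma>\<close> to the identity. A level morphism is thus determined by
  scalars of the trace form.\<close>

lemma lookup_level:
  assumes c: "c \<in> hom_S p p" and \<sigma>: "\<sigma> \<in> brauer_level p p"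
  shows "Poly_Mapping.lookup (comp \<delta> c (gen (flip \<sigma>))) (id_diagram p) = Poly_Mapping.lookup c \<sigma>"
    "Poly_Mapping.lookup (comp \<delta> (gen (flip \<sigma>)) c) (id_diagram p) = Poly_Mapping.lookup c \<sigma>"
proof -
  have b: "\<rho> \<in> brauer p p" if "\<rho> \<in> brauer_level p p" for \<rho> using that by (simp add: brauer_level_def)
  note fl = flip_brauer_level[OF \<sigma>]
  from c show "Poly_Mapping.lookup (comp \<delta> c (gen (flip \<sigma>))) (id_diagram p) = Poly_Mapping.lookup c \<sigma>"
    unfolding hom_S_def
    by (induction rule: free_on_induct)
      (simp_all add: lookup_add comp_gen_level(1)[OF fl b] lookup_single when_def level_cancel[OF _ \<sigma>])
  from c show "Poly_Mapping.lookup (comp \<delta> (gen (flip \<sigma>)) c) (id_diagram p) = Poly_Mapping.lookup c \<sigma>"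
    unfolding hom_S_def
    by (induction rule: free_on_induct)
      (simp_all add: lookup_add comp_gen_level(2)[OF fl b] lookup_single when_def level_cancel[OF _ \<sigma>])
qed

definition form :: "'k::comm_ring_1 \<Rightarrow> nat \<Rightarrow> 'k morphism \<Rightarrow> 'k morphism \<Rightarrow> 'k" where
  "form \<delta> p n x = Poly_Mapping.lookup (pr \<delta> n x) (id_diagram p)"

lemma form_simps:
  "form \<delta> p (\<Sum>i\<in>I. scal (c i) (b i)) x = (\<Sum>i\<in>I. c i * form \<delta> p (b i) x)"
  "form \<delta> p n (\<Sum>i\<in>I. scal (c i) (y i)) = (\<Sum>i\<in>I. c i * form \<delta> p n (y i))"
  by (simp_all add: form_def lookup_sum)

text \<open>The flip of \<open>\<sigma>\<close> in \<open>dbas\<close> becomes a left factor of the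
  pairing and selects the coefficient of \<open>\<sigma>\<close>, as the left regular representation
  does.\<close>

lemma form_bas:
  assumes i: "i \<in> gram_index p q" and j: "j \<in> gram_index p q"
  shows "form \<delta> p (dbas i) (bas j) = gram \<delta> i j"
proof -
  obtain f \<sigma> g \<tau> where ij: "i = (f, \<sigma>)" "j = (g, \<tau>)" by (cases i; cases j)
  have m: "f \<in> brauer_up_mono p q" "\<sigma> \<in> brauer_level p p" "g \<in> brauer_up_mono p q" "\<tau> \<in> brauer_level p p"
    using i j by (auto simp: gram_index_def ij)
  note n = gen_flip_dn[OF m(1)] and x = gen_up[OF m(3)] and s = gen_level[OF flip_brauer_level[OF m(2)]] and t = gen_level[OF m(4)]
  have "pr \<delta> (dbas i) (bas j) = comp \<delta> (gen (flip \<sigma>)) (comp \<delta> (pr \<delta> (gen (flip f)) (gen g)) (gen \<tau>))"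
    unfolding ij bas_comp[OF j[unfolded ij], of \<delta>] dbas_comp[OF i[unfolded ij], of \<delta>]
    by (simp add: pr_comp_left[OF n comp_Up[OF x hom_S_Up[OF t]] s] pr_comp_right[OF n x t])
  then show ?thesis
    by (simp add: form_def gram_def ij lookup_level(2)[OF comp_hom_S[OF pr_hom_S[OF n x] t] m(2)])
qed

lemma lookup_pr:
  assumes "n \<in> Dn q p" "x \<in> Up p q" "\<sigma> \<in> brauer_level p p"
  shows "Poly_Mapping.lookup (pr \<delta> n x) \<sigma> = form \<delta> p n (comp \<delta> x (gen (flip \<sigma>)))"
  by (simp add: form_def pr_comp_right[OF assms(1,2) gen_level[OF flip_brauer_level[OF assms(3)]]]
      lookup_level(1)[OF pr_hom_S[OF assms(1,2)] assms(3)])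

text \<open>The first expansion writes an upward morphism in the monotone diagrams with level
  coefficients on the right; the second writes a downward one in the dual elements with level
  coefficients on the left.\<close>

lemma dual_basis:
  fixes \<delta> :: "'k::comm_ring_1"
  assumes d: "det_on (gram_index p q) (gram \<delta>) dvd 1"
  obtains y where "\<And>f. f \<in> brauer_up_mono p q \<Longrightarrow> y f \<in> Dn q p"
    "\<And>x. x \<in> Up p q \<Longrightarrow> (\<Sum>f\<in>brauer_up_mono p q. comp \<delta> (gen f) (pr \<delta> (y f) x)) = x"
    "\<And>n. n \<in> Dn q p \<Longrightarrow> (\<Sum>f\<in>brauer_up_mono p q. comp \<delta> (pr \<delta> n (gen f)) (y f)) = n"
proof -
  let ?I = "gram_index p q" and ?F = "brauer_up_mono p q"
  obtain N where N:
    "\<And>i k. i \<in> ?I \<Longrightarrow> k \<in> ?I \<Longrightarrow> (\<Sum>j\<in>?I. N i j * gram \<delta> j k) = (if i = k then 1 else 0)"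
    "\<And>i k. i \<in> ?I \<Longrightarrow> k \<in> ?I \<Longrightarrow> (\<Sum>j\<in>?I. gram \<delta> i j * N j k) = (if i = k then 1 else 0)"
    by (rule det_on_inverse[OF finite_gram_index d]) (rule that)
  \<comment> \<open>The coefficients form the row of the inverse matrix at
    \<open>(f, id_diagram p)\<close>. The remaining rows would only give multiples of
    \<open>y f\<close> by level diagrams.\<close>
  define y :: "diagram \<Rightarrow> 'k morphism" where "y f = (\<Sum>j\<in>?I. scal (N (f, id_diagram p) j) (dbas j))" for f
  have yD: "y f \<in> Dn q p" for f
    unfolding y_def by (intro free_on_sum free_on_scal dbas_Dn)
  have idx: "(f, id_diagram p) \<in> ?I" if "f \<in> ?F" for f
    using that id_level by (simp add: gram_index_def)
  have form_y: "form \<delta> p (y f) (bas k) = (if (f, id_diagram p) = k then 1 else 0)" if "f \<in> ?F" "k \<in> ?I" for f k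
    using N(1)[OF idx[OF that(1)] that(2)] that(2)
    by (simp add: y_def form_simps form_bas cong: sum.cong)
  \<comment> \<open>The scalar form sees only the identity coefficient. Testing against
    \<open>bas (g, flip \<rho>)\<close> for all level \<open>\<rho>\<close> recovers the whole level
    part.\<close>
  have pr_y: "pr \<delta> (y f) (gen g) = (if f = g then idm p else 0)" if "f \<in> ?F" "g \<in> ?F" for f g
  proof (rule poly_mapping_eqI)
    fix \<rho>
    show "Poly_Mapping.lookup (pr \<delta> (y f) (gen g)) \<rho> = Poly_Mapping.lookup (if f = g then idm p else 0) \<rho>"
    proof (cases "\<rho> \<in> brauer_level p p")
      case True
      have i: "(g, flip \<rho>) \<in> ?I" using that(2) flip_brauer_level[OF True] by (simp add: gram_index_def)
      have "Poly_Mapping.lookup (pr \<delta> (y f) (gen g)) \<rho> = form \<delta> p (y f) (bas (g, flip \<rho>))"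
        using lookup_pr[OF yD gen_up[OF that(2)] True] by (simp add: bas_comp[OF i, of \<delta>])
      also have "\<dots> = (if f = g \<and> id_diagram p = flip \<rho> then 1 else 0)" using form_y[OF that(1) i] by simp
      also have "id_diagram p = flip \<rho> \<longleftrightarrow> \<rho> = id_diagram p" using flip_id flip_flip by (metis (no_types))
      finally show ?thesis by (auto simp: lookup_single when_def)
    next
      case False
      have "pr \<delta> (y f) (gen g) \<in> hom_S p p" by (rule pr_hom_S[OF yD gen_up[OF that(2)]])
      then have "Poly_Mapping.lookup (pr \<delta> (y f) (gen g)) \<rho> = 0" using False by (simp add: hom_S_def free_on_iff)
      moreover have "\<rho> \<noteq> id_diagram p" using False id_level by metis
      ultimately show ?thesis by (simp add: lookup_single when_def)
    qed
  qed
  have A: "(\<Sum>f\<in>?F. comp \<delta> (gen f) (pr \<delta> (y f) x)) = x" if x: "x \<in> Up p q" for x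
  proof -
    obtain c where c: "x = (\<Sum>j\<in>?I. scal (c j) (bas j))" using bas_span[OF x] by auto
    have l: "lin (\<lambda>x. \<Sum>f\<in>?F. comp \<delta> (gen f) (pr \<delta> (y f) x))"
      by (simp add: lin_def sum.distrib scal_sum)
    have b: "(\<Sum>f\<in>?F. comp \<delta> (gen f) (pr \<delta> (y f) (bas j))) = bas j" if "j \<in> ?I" for j
    proof -
      obtain g \<tau> where j': "j = (g, \<tau>)" by (cases j)
      then have j: "j = (g, \<tau>)" "g \<in> ?F" "\<tau> \<in> brauer_level p p" using that by (simp_all add: gram_index_def)
      note t = gen_level[OF j(3)] and g = gen_up[OF j(2)]
      have "(\<Sum>f\<in>?F. comp \<delta> (gen f) (pr \<delta> (y f) (bas j))) =
        (\<Sum>f\<in>?F. if f = g then comp \<delta> (gen g) (gen \<tau>) else 0)"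
      proof (rule sum.cong[OF refl])
        fix f assume f: "f \<in> ?F"
        have "pr \<delta> (y f) (bas j) = comp \<delta> (if f = g then idm p else 0) (gen \<tau>)"
          using that unfolding j(1) by (simp add: bas_comp[of _ _ p q \<delta>] pr_comp_right[OF yD g t] pr_y[OF f j(2)])
        then show "comp \<delta> (gen f) (pr \<delta> (y f) (bas j)) = (if f = g then comp \<delta> (gen g) (gen \<tau>) else 0)"
          by (simp add: one_comp[OF hom_S_hom[OF t]])
      qed
      also have "\<dots> = bas j" using that j by (simp add: finite_mono bas_comp[of _ _ p q \<delta>])
      finally show ?thesis .
    qed
    show ?thesis unfolding c lin_sum[OF l] lin_scal[OF l] using b by simp
  qed
  \<comment> \<open>Both sides pair equally with every upward \<open>x\<close>, by the first
    expansion. The other inverse identity of the Gram matrix shows that the pairing has no left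
    kernel, so they are equal.\<close>
  have B: "(\<Sum>f\<in>?F. comp \<delta> (pr \<delta> n (gen f)) (y f)) = n" if n: "n \<in> Dn q p" for n
  proof -
    let ?n = "(\<Sum>f\<in>?F. comp \<delta> (pr \<delta> n (gen f)) (y f))"
    have sn: "?n \<in> Dn q p"
      by (intro free_on_sum comp_Dn[OF hom_S_Dn[OF pr_hom_S[OF n gen_up]] yD])
    have "pr \<delta> ?n x = pr \<delta> n x" if x: "x \<in> Up p q" for x
    proof -
      have "pr \<delta> ?n x = (\<Sum>f\<in>?F. comp \<delta> (pr \<delta> n (gen f)) (pr \<delta> (y f) x))"
        by (simp, rule sum.cong[OF refl], rule pr_comp_left[OF yD x pr_hom_S[OF n gen_up]])
      also have "\<dots> = (\<Sum>f\<in>?F. pr \<delta> n (comp \<delta> (gen f) (pr \<delta> (y f) x)))"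
        by (rule sum.cong[OF refl], rule pr_comp_right[OF n gen_up pr_hom_S[OF yD x], symmetric])
      also have "\<dots> = pr \<delta> n (\<Sum>f\<in>?F. comp \<delta> (gen f) (pr \<delta> (y f) x))" by simp
      also have "\<dots> = pr \<delta> n x" by (simp only: A[OF x])
      finally show ?thesis .
    qed
    then have z: "form \<delta> p (?n - n) x = 0" if "x \<in> Up p q" for x
      using that by (simp add: form_def)
    obtain c where c: "?n - n = (\<Sum>j\<in>?I. scal (c j) (dbas j))"
      using dbas_span[OF free_on_diff[OF sn n]] by auto
    have row: "(\<Sum>i\<in>?I. c i * gram \<delta> i j) = 0" if "j \<in> ?I" for j
      using z[OF bas_Up[OF that]] that by (simp add: c form_simps form_bas cong: sum.cong)
    have "c k = 0" if k: "k \<in> ?I" for k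
    proof -
      have "0 = (\<Sum>j\<in>?I. (\<Sum>i\<in>?I. c i * gram \<delta> i j) * N j k)" using row by simp
      also have "\<dots> = (\<Sum>i\<in>?I. c i * (\<Sum>j\<in>?I. gram \<delta> i j * N j k))"
        unfolding sum_distrib_right sum_distrib_left by (subst sum.swap) (simp add: mult.assoc)
      also have "\<dots> = (\<Sum>i\<in>?I. if i = k then c i else 0)"
        by (rule sum.cong[OF refl]) (simp add: N(2)[OF _ k])
      also have "\<dots> = c k" using k by (simp add: finite_gram_index)
      finally show ?thesis ..
    qed
    then show ?thesis using c by simp
  qed
  show ?thesis by (rule that[of y, OF yD A B])
qed

text \<open>The expansion of every \<open>x\<close> through the pairings with the flipped monotone
  diagrams is a left inverse of the Gram matrix in disguise: the columns of \<open>N\<close> are the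
  coordinates of \<open>v h\<close> composed with level diagrams.\<close>

lemma det_on_gram_unit:
  fixes \<delta> :: "'k::comm_ring_1"
  assumes v: "\<And>h. h \<in> brauer_up_mono p q \<Longrightarrow> v h \<in> Up p q"
    and x: "\<And>x. x \<in> Up p q \<Longrightarrow> x = (\<Sum>h\<in>brauer_up_mono p q. comp \<delta> (v h) (pr \<delta> (gen (flip h)) x))"
  shows "det_on (gram_index p q) (gram \<delta>) dvd 1"
proof -
  let ?I = "gram_index p q" and ?F = "brauer_up_mono p q" and ?L = "brauer_level p p"
  define N where "N i j = (case i of (f, \<rho>) \<Rightarrow> case j of (h, \<sigma>) \<Rightarrow>
    Poly_Mapping.lookup (comp \<delta> (v h) (gen \<sigma>)) (hat_comp f \<rho>))" for i j
  have finL: "finite ?L" by (rule finite_subset[OF _ finite_brauer[of p p]]) (auto simp: brauer_level_def)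
  show ?thesis
  proof (rule det_on_left_inverse[OF finite_gram_index, of _ _ N])
    fix i k assume i: "i \<in> ?I" and k: "k \<in> ?I"
    obtain f \<rho> where i': "i = (f, \<rho>)" "f \<in> ?F" "\<rho> \<in> ?L" using i by (auto simp: gram_index_def)
    obtain g \<tau> where k': "k = (g, \<tau>)" "g \<in> ?F" "\<tau> \<in> ?L" using k by (auto simp: gram_index_def)
    \<comment> \<open>For fixed \<open>h\<close>, the entries of a Gram column are the coordinates
      of a level morphism, so summing over \<open>\<sigma>\<close> rebuilds the pairing.\<close>
    have inner: "(\<Sum>\<sigma>\<in>?L. scal (gram \<delta> (h, \<sigma>) k) (gen \<sigma>)) = pr \<delta> (gen (flip h)) (bas k)" if "h \<in> ?F" for h
    proof -
      let ?c = "pr \<delta> (gen (flip h)) (bas k)"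
      have "?c = comp \<delta> (pr \<delta> (gen (flip h)) (gen g)) (gen \<tau>)"
        using k pr_comp_right[OF gen_flip_dn[OF that] gen_up[OF k'(2)] gen_level[OF k'(3)]]
        by (simp add: k'(1) bas_comp[of _ _ p q \<delta>])
      then have g: "gram \<delta> (h, \<sigma>) k = Poly_Mapping.lookup ?c \<sigma>" for \<sigma> by (simp add: gram_def k'(1))
      have "?c \<in> hom_S p p" by (rule pr_hom_S[OF gen_flip_dn[OF that] bas_Up[OF k]])
      then have keys: "Poly_Mapping.keys ?c \<subseteq> ?L" by (simp add: hom_S_def free_on_def)
      have "lin_ext gen ?c = ?c" using expand_gens[of ?c] by (simp add: lin_ext_def)
      then show ?thesis unfolding g using lin_ext_alt[OF finL keys, of gen] by simp
    qed
    have "(\<Sum>j\<in>?I. N i j * gram \<delta> j k) = (\<Sum>h\<in>?F. \<Sum>\<sigma>\<in>?L. N i (h, \<sigma>) * gram \<delta> (h, \<sigma>) k)"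
      unfolding gram_index_def by (simp add: sum.cartesian_product case_prod_unfold)
    also have "\<dots> = (\<Sum>h\<in>?F. Poly_Mapping.lookup (comp \<delta> (v h) (pr \<delta> (gen (flip h)) (bas k))) (hat_comp f \<rho>))"
      by (rule sum.cong[OF refl]) (simp add: N_def i'(1) lookup_sum mult.commute flip: inner)
    also have "\<dots> = Poly_Mapping.lookup (bas k) (hat_comp f \<rho>)"
      unfolding lookup_sum[symmetric] x[OF bas_Up[OF k], symmetric] ..
    also have "\<dots> = (if hat_comp g \<tau> = hat_comp f \<rho> then 1 else 0)"
      by (simp add: k'(1) bas_def lookup_single when_def)
    also have "hat_comp g \<tau> = hat_comp f \<rho> \<longleftrightarrow> i = k"
    proof
      assume "hat_comp g \<tau> = hat_comp f \<rho>"
      then show "i = k" using brauer_up_mono_unique[OF i'(2) k'(2) i'(3) k'(3)] by (simp add: i'(1) k'(1))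
    qed (simp add: i'(1) k'(1))
    finally show "(\<Sum>j\<in>?I. N i j * gram \<delta> j k) = (if i = k then 1 else 0)" .
  qed
qed

text \<open>A level diagram is invertible, so composing with it on the right neither creates nor
  destroys pairs of top points. This makes the action of \<open>B\<close> on upward morphisms
  commute with that of the level category.\<close>

lemma upw_comp_endo:
  assumes "f \<in> hom_B p q" "c \<in> hom_S p p"
  shows "upw (comp \<delta> f c) = comp \<delta> (upw f) c"
proof -
  have u: "upward (hat_comp a b) \<longleftrightarrow> upward a" if a: "a \<in> brauer p q" and b: "b \<in> brauer_level p p" for a b
  proof -
    have r: "upward (hat_comp a b)" if "upward a" "a \<in> brauer p q" "b \<in> brauer_level p p" for a b
      using hat_comp_up[of a p q b p] that level_in_up by (auto simp: brauer_up_def)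
    have bb: "b \<in> brauer p p" using b by (simp add: brauer_level_def)
    have "hat_comp (hat_comp a b) (flip b) = a"
      by (simp add: hat_comp_assoc hat_comp_flip_level[OF b] hat_comp_id[OF a])
    then show ?thesis
      using r[OF _ a b] r[OF _ hat_comp_closed[OF a bb] flip_brauer_level[OF b]] by auto
  qed
  show ?thesis
    by (rule comp_eqI2[of f "brauer p q" c "brauer_level p p" "\<lambda>f c. upw (comp \<delta> f c)" "\<lambda>f c. comp \<delta> (upw f) c"])
      (use assms in \<open>auto simp: hom_B_def hom_S_def lin_def restrict_gen comp_gen u\<close>)
qed

lemma dnw_endo_comp:
  assumes "f \<in> hom_B p q" "c \<in> hom_S q q"
  shows "dnw (comp \<delta> c f) = comp \<delta> c (dnw f)"
proof -
  have u: "downward (hat_comp b a) \<longleftrightarrow> downward a" if a: "a \<in> brauer p q" and b: "b \<in> brauer_level q q" for a b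
  proof -
    have r: "downward (hat_comp b a)" if "downward a" "a \<in> brauer p q" "b \<in> brauer_level q q" for a b
      using hat_comp_down[of b q q a p] that level_in_down by (auto simp: brauer_down_def)
    have bb: "b \<in> brauer q q" using b by (simp add: brauer_level_def)
    have "hat_comp (flip b) (hat_comp b a) = a"
      by (simp add: flip_hat_comp_level[OF b] id_hat_comp[OF a] flip: hat_comp_assoc)
    then show ?thesis
      using r[OF _ a b] r[OF _ hat_comp_closed[OF bb a] flip_brauer_level[OF b]] by auto
  qed
  show ?thesis
    by (rule comp_eqI2[of c "brauer_level q q" f "brauer p q" "\<lambda>c f. dnw (comp \<delta> c f)" "\<lambda>c f. comp \<delta> c (dnw f)"])
      (use assms in \<open>auto simp: hom_B_def hom_S_def lin_def restrict_gen comp_gen u\<close>)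
qed

lemma hom_S_square: "h \<in> hom_S p q \<Longrightarrow> p = q \<or> h = 0"
  using hom_S_zero by auto

lemma upw_comp_level: 
  assumes "f \<in> hom_B p q" "c \<in> hom_S p' p"
  shows "upw (comp \<delta> f c) = comp \<delta> (upw f) c"
  using hom_S_square[OF assms(2)] upw_comp_endo[OF assms(1)] assms(2) by (elim disjE) simp_all

lemma dnw_level_comp: 
  assumes "f \<in> hom_B p q" "c \<in> hom_S q q'"
  shows "dnw (comp \<delta> c f) = comp \<delta> c (dnw f)"
  using hom_S_square[OF assms(2)] dnw_endo_comp[OF assms(1)] assms(2) by (elim disjE) simp_all

section \<open>Cosets\<close>

lemma coset_mem: "y \<in> x +o K \<longleftrightarrow> y - x \<in> K" for K :: "'a::ab_group_add set"
  by (auto simp: elt_set_plus_def intro!: bexI[of _ "y - x"])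

lemma coset_eq_iff:
  assumes "free_module.subspace (K :: ('a \<Rightarrow>\<^sub>0 'k::comm_ring_1) set)"
  shows "x +o K = y +o K \<longleftrightarrow> x - y \<in> K"
proof
  assume "x +o K = y +o K"
  moreover have "x \<in> x +o K" using free_module.subspace_0[OF assms] by (simp add: coset_mem)
  ultimately show "x - y \<in> K" by (simp add: coset_mem)
next
  assume d: "x - y \<in> K"
  have "z - x \<in> K \<longleftrightarrow> z - y \<in> K" for z
    using free_module.subspace_add[OF assms d, of "z - x"] free_module.subspace_diff[OF assms _ d, of "z - y"]
    by (auto simp: algebra_simps)
  then show "x +o K = y +o K" by (intro Set.set_eqI) (simp add: coset_mem)
qed

text \<open>The unions defining the operations of \<open>tensor\<close> run over nonempty families
  of equal cosets and collapse to the coset of any representative.\<close>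

lemma coset_map:
  assumes K: "free_module.subspace K" and K': "free_module.subspace K'" and F: "lin F"
    and FK: "\<And>x. x \<in> K \<Longrightarrow> F x \<in> K'"
  shows "(\<Union>y\<in>x +o K. F y +o K') = F x +o K'"
proof -
  have "F y +o K' = F x +o K'" if "y \<in> x +o K" for y
    using FK[of "y - x"] that by (simp add: coset_eq_iff[OF K'] coset_mem lin_diff[OF F])
  then have "(\<Union>y\<in>x +o K. F y +o K') = (\<Union>y\<in>x +o K. F x +o K')" by (rule SUP_cong[OF refl])
  moreover have "x \<in> x +o K" using free_module.subspace_0[OF K] by (simp add: coset_mem)
  then have "x +o K \<noteq> {}" by auto
  ultimately show ?thesis by simp
qed

lemma subspace_preimage:
  assumes "free_module.subspace K" "lin F"
  shows "free_module.subspace {x. F x \<in> K}"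
  using assms by (auto simp: free_module.subspace_def lin_add lin_scal lin_0)

lemma span_map:
  assumes "free_module.subspace K" "lin F" "\<And>r. r \<in> R \<Longrightarrow> F r \<in> K" "x \<in> free_module.span R"
  shows "F x \<in> K"
proof -
  have "R \<subseteq> {x. F x \<in> K}" by (intro subsetI CollectI assms(3))
  then have "free_module.span R \<subseteq> {x. F x \<in> K}"
    using subspace_preimage[OF assms(1,2)] by (rule free_module.span_minimal)
  then show ?thesis using assms(4) by auto
qed

section \<open>Tensor products\<close>

lemma subspace_tensor_ker: "free_module.subspace (tensor_ker H M N p q)"
  unfolding tensor_ker_def by (rule free_module.subspace_span)

lemma tensor_relI:
  assumes "r \<in> tensor_rels H M N p q"
  shows "r \<in> tensor_ker H M N p q"
  using assms unfolding tensor_ker_def by (rule free_module.span_base)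

lemma tensor_ker_rels:
  "m \<in> elts M s q \<Longrightarrow> m' \<in> elts M s q \<Longrightarrow> n \<in> elts N p s \<Longrightarrow>
    gen (s, plus_m M s q m m', n) - gen (s, m, n) - gen (s, m', n) \<in> tensor_ker H M N p q"
  "m \<in> elts M s q \<Longrightarrow> n \<in> elts N p s \<Longrightarrow> n' \<in> elts N p s \<Longrightarrow>
    gen (s, m, plus_m N p s n n') - gen (s, m, n) - gen (s, m, n') \<in> tensor_ker H M N p q"
  "m \<in> elts M s q \<Longrightarrow> n \<in> elts N p s \<Longrightarrow>
    gen (s, scal_m M s q c m, n) - scal c (gen (s, m, n)) \<in> tensor_ker H M N p q"
  "m \<in> elts M s q \<Longrightarrow> n \<in> elts N p s \<Longrightarrow>
    gen (s, m, scal_m N p s c n) - scal c (gen (s, m, n)) \<in> tensor_ker H M N p q"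
  "m \<in> elts M t q \<Longrightarrow> h \<in> H s t \<Longrightarrow> n \<in> elts N p s \<Longrightarrow>
    gen (s, ract M s t q m h, n) - gen (t, m, lact N p s t h n) \<in> tensor_ker H M N p q"
  subgoal by (rule tensor_relI, unfold tensor_rels_def, rule UnI1, rule UnI1, rule UnI1, rule UnI1, rule CollectI, intro exI conjI, rule refl, assumption+)
  subgoal by (rule tensor_relI, unfold tensor_rels_def, rule UnI1, rule UnI1, rule UnI1, rule UnI2, rule CollectI, intro exI conjI, rule refl, assumption+)
  subgoal by (rule tensor_relI, unfold tensor_rels_def, rule UnI1, rule UnI1, rule UnI2, rule CollectI, intro exI conjI, rule refl, assumption+)
  subgoal by (rule tensor_relI, unfold tensor_rels_def, rule UnI1, rule UnI2, rule CollectI, intro exI conjI, rule refl, assumption+)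
  subgoal by (rule tensor_relI, unfold tensor_rels_def, rule UnI2, rule CollectI, intro exI conjI, rule refl, assumption+)
  done

lemma tensor_rels_cases:
  assumes "r \<in> tensor_rels H M N p q"
    and "\<And>s m m' n. m \<in> elts M s q \<Longrightarrow> m' \<in> elts M s q \<Longrightarrow> n \<in> elts N p s \<Longrightarrow>
      P (gen (s, plus_m M s q m m', n) - gen (s, m, n) - gen (s, m', n))"
    and "\<And>s m n n'. m \<in> elts M s q \<Longrightarrow> n \<in> elts N p s \<Longrightarrow> n' \<in> elts N p s \<Longrightarrow>
      P (gen (s, m, plus_m N p s n n') - gen (s, m, n) - gen (s, m, n'))"
    and "\<And>s c m n. m \<in> elts M s q \<Longrightarrow> n \<in> elts N p s \<Longrightarrow>
      P (gen (s, scal_m M s q c m, n) - scal c (gen (s, m, n)))"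
    and "\<And>s c m n. m \<in> elts M s q \<Longrightarrow> n \<in> elts N p s \<Longrightarrow>
      P (gen (s, m, scal_m N p s c n) - scal c (gen (s, m, n)))"
    and "\<And>s t m h n. m \<in> elts M t q \<Longrightarrow> h \<in> H s t \<Longrightarrow> n \<in> elts N p s \<Longrightarrow>
      P (gen (s, ract M s t q m h, n) - gen (t, m, lact N p s t h n))"
  shows "P r"
  using assms(1) unfolding tensor_rels_def
  by (elim UnE CollectE exE conjE) (simp_all only: assms(2-6))

section \<open>Functoriality and balanced maps of tensor products\<close>

lemma tensor_ker_left_map:
  assumes U: "\<And>s m. m \<in> elts M s q \<Longrightarrow> U s m \<in> elts M s q'"
    "\<And>s m m'. m \<in> elts M s q \<Longrightarrow> m' \<in> elts M s q \<Longrightarrow> U s (plus_m M s q m m') = plus_m M s q' (U s m) (U s m')"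
    "\<And>s m c. m \<in> elts M s q \<Longrightarrow> U s (scal_m M s q c m) = scal_m M s q' c (U s m)"
    "\<And>s t m h. m \<in> elts M t q \<Longrightarrow> h \<in> H s t \<Longrightarrow> U s (ract M s t q m h) = ract M s t q' (U t m) h"
    and x: "x \<in> tensor_ker H M N p q"
  shows "lin_ext (\<lambda>(s, m, n). gen (s, U s m, n)) x \<in> tensor_ker H M N p q'"
proof (rule span_map[OF subspace_tensor_ker lin_lin_ext _ x[unfolded tensor_ker_def]])
  fix r assume "r \<in> tensor_rels H M N p q"
  then show "lin_ext (\<lambda>(s, m, n). gen (s, U s m, n)) r \<in> tensor_ker H M N p q'"
    by (rule tensor_rels_cases) (simp_all add: U tensor_ker_rels)
qed

lemma tensor_ker_right_map:
  assumes V: "\<And>s n. n \<in> elts N p s \<Longrightarrow> V s n \<in> elts N p' s"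
    "\<And>s n n'. n \<in> elts N p s \<Longrightarrow> n' \<in> elts N p s \<Longrightarrow> V s (plus_m N p s n n') = plus_m N p' s (V s n) (V s n')"
    "\<And>s n c. n \<in> elts N p s \<Longrightarrow> V s (scal_m N p s c n) = scal_m N p' s c (V s n)"
    "\<And>s t n h. n \<in> elts N p s \<Longrightarrow> h \<in> H s t \<Longrightarrow> V t (lact N p s t h n) = lact N p' s t h (V s n)"
    and x: "x \<in> tensor_ker H M N p q"
  shows "lin_ext (\<lambda>(s, m, n). gen (s, m, V s n)) x \<in> tensor_ker H M N p' q"
proof (rule span_map[OF subspace_tensor_ker lin_lin_ext _ x[unfolded tensor_ker_def]])
  fix r assume "r \<in> tensor_rels H M N p q"
  then show "lin_ext (\<lambda>(s, m, n). gen (s, m, V s n)) r \<in> tensor_ker H M N p' q"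
    by (rule tensor_rels_cases) (simp_all add: V tensor_ker_rels)
qed

lemma tensor_ker_vanish:
  assumes E: "\<And>s m m' n. m \<in> elts M s q \<Longrightarrow> m' \<in> elts M s q \<Longrightarrow> n \<in> elts N p s \<Longrightarrow>
      E s (plus_m M s q m m') n = E s m n + E s m' n"
    "\<And>s m n n'. m \<in> elts M s q \<Longrightarrow> n \<in> elts N p s \<Longrightarrow> n' \<in> elts N p s \<Longrightarrow>
      E s m (plus_m N p s n n') = E s m n + E s m n'"
    "\<And>s c m n. m \<in> elts M s q \<Longrightarrow> n \<in> elts N p s \<Longrightarrow> E s (scal_m M s q c m) n = scal c (E s m n)"
    "\<And>s c m n. m \<in> elts M s q \<Longrightarrow> n \<in> elts N p s \<Longrightarrow> E s m (scal_m N p s c n) = scal c (E s m n)"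
    "\<And>s t m h n. m \<in> elts M t q \<Longrightarrow> h \<in> H s t \<Longrightarrow> n \<in> elts N p s \<Longrightarrow>
      E s (ract M s t q m h) n = E t m (lact N p s t h n)"
    and x: "x \<in> tensor_ker H M N p q"
  shows "lin_ext (\<lambda>(s, m, n). E s m n) x = 0"
proof -
  have "lin_ext (\<lambda>(s, m, n). E s m n) x \<in> {0}"
  proof (rule span_map[OF _ lin_lin_ext _ x[unfolded tensor_ker_def]])
    show "free_module.subspace {0}" by (simp add: free_module.subspace_def)
    fix r assume "r \<in> tensor_rels H M N p q"
    then show "lin_ext (\<lambda>(s, m, n). E s m n) r \<in> {0}"
      by (rule tensor_rels_cases) (simp_all add: E)
  qed
  then show ?thesis by simp
qed

lemma elts_tensor: "elts (tensor H M N) p q = (\<lambda>x. x +o tensor_ker H M N p q) ` free_on (tensor_gens M N p q)"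
  by (auto simp: tensor_def)

lemma plus_tensor:
  "plus_m (tensor H M N) p q (x +o tensor_ker H M N p q) (y +o tensor_ker H M N p q) = (x + y) +o tensor_ker H M N p q"
proof -
  let ?K = "tensor_ker H M N p q"
  note K = subspace_tensor_ker[of H M N p q]
  have "(a + b) +o ?K = (x + y) +o ?K" if "a \<in> x +o ?K" "b \<in> y +o ?K" for a b
    using free_module.subspace_add[OF K, of "a - x" "b - y"] that
    by (simp add: coset_mem coset_eq_iff[OF K] algebra_simps)
  then have "(\<Union>a\<in>x +o ?K. \<Union>b\<in>y +o ?K. (a + b) +o ?K) = (\<Union>a\<in>x +o ?K. \<Union>b\<in>y +o ?K. (x + y) +o ?K)"
    by (intro SUP_cong refl)
  moreover have "x \<in> x +o ?K" for x using free_module.subspace_0[OF K] by (simp add: coset_mem)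
  then have "x +o ?K \<noteq> {}" for x by (metis empty_iff)
  ultimately show ?thesis by (simp add: tensor_def)
qed

lemma scal_tensor:
  "scal_m (tensor H M N) p q c (x +o tensor_ker H M N p q) = scal c x +o tensor_ker H M N p q"
proof -
  have "lin (scal c)" by (simp add: lin_def mult.commute)
  then show ?thesis unfolding tensor_def bimodule.simps
    by (rule coset_map[OF subspace_tensor_ker subspace_tensor_ker])
      (rule free_module.subspace_scale[OF subspace_tensor_ker])
qed

text \<open>Maps into a set of cosets are given by formulas, whereas maps out of it require
  representatives. This allows both isomorphisms with the tensor products to be constructed in the
  convenient direction; closure of \<open>N\<close> under its operations is used to apply the
  inverse.\<close>

lemma bimodule_iso_inv:
  assumes bij: "\<And>p q. bij_betw (\<Phi> p q) (elts N p q) (elts M p q)"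
    and add: "\<And>p q x y. x \<in> elts N p q \<Longrightarrow> y \<in> elts N p q \<Longrightarrow>
      plus_m N p q x y \<in> elts N p q \<and> \<Phi> p q (plus_m N p q x y) = plus_m M p q (\<Phi> p q x) (\<Phi> p q y)"
    and scal: "\<And>p q c x. x \<in> elts N p q \<Longrightarrow>
      scal_m N p q c x \<in> elts N p q \<and> \<Phi> p q (scal_m N p q c x) = scal_m M p q c (\<Phi> p q x)"
    and lact: "\<And>p q q' h x. h \<in> H q q' \<Longrightarrow> x \<in> elts N p q \<Longrightarrow>
      lact N p q q' h x \<in> elts N p q' \<and> \<Phi> p q' (lact N p q q' h x) = lact M p q q' h (\<Phi> p q x)"
    and ract: "\<And>p' p q h x. h \<in> H p' p \<Longrightarrow> x \<in> elts N p q \<Longrightarrow>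
      ract N p' p q x h \<in> elts N p' q \<and> \<Phi> p' q (ract N p' p q x h) = ract M p' p q (\<Phi> p q x) h"
  shows "bimodule_iso H M N"
proof -
  define \<phi> where "\<phi> p q = the_inv_into (elts N p q) (\<Phi> p q)" for p q
  have inj: "inj_on (\<Phi> p q) (elts N p q)" and im: "\<Phi> p q ` elts N p q = elts M p q" for p q
    using bij[of p q] by (auto simp: bij_betw_def)
  have inv: "\<phi> p q (\<Phi> p q x) = x" if "x \<in> elts N p q" for p q x
    unfolding \<phi>_def by (rule the_inv_into_f_f[OF inj that])
  have ex: "\<exists>x\<in>elts N p q. X = \<Phi> p q x" if "X \<in> elts M p q" for p q X
    using that im[of p q] by auto
  show ?thesis unfolding bimodule_iso_def
  proof (intro exI[of _ \<phi>] conjI allI ballI)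
    fix p q show "bij_betw (\<phi> p q) (elts M p q) (elts N p q)"
      unfolding \<phi>_def by (rule bij_betw_the_inv_into[OF bij])
  next
    fix p q X Y assume "X \<in> elts M p q" "Y \<in> elts M p q"
    then obtain x y where "x \<in> elts N p q" "y \<in> elts N p q" "X = \<Phi> p q x" "Y = \<Phi> p q y" using ex by metis
    then show "\<phi> p q (plus_m M p q X Y) = plus_m N p q (\<phi> p q X) (\<phi> p q Y)"
      using add[of x p q y] inv[of "plus_m N p q x y" p q] by (simp add: inv)
  next
    fix p q c X assume "X \<in> elts M p q"
    then obtain x where "x \<in> elts N p q" "X = \<Phi> p q x" using ex by metis
    then show "\<phi> p q (scal_m M p q c X) = scal_m N p q c (\<phi> p q X)"
      using scal[of x p q c] inv[of "scal_m N p q c x" p q] by (simp add: inv)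
  next
    fix p q q' h X assume h: "h \<in> H q q'" and "X \<in> elts M p q"
    then obtain x where "x \<in> elts N p q" "X = \<Phi> p q x" using ex by metis
    then show "\<phi> p q' (lact M p q q' h X) = lact N p q q' h (\<phi> p q X)"
      using lact[OF h, of x p] inv[of "lact N p q q' h x" p q'] by (simp add: inv)
  next
    fix p' p q h X assume h: "h \<in> H p' p" and "X \<in> elts M p q"
    then obtain x where "x \<in> elts N p q" "X = \<Phi> p q x" using ex by metis
    then show "\<phi> p' q (ract M p' p q X h) = ract N p' p q (\<phi> p q X) h"
      using ract[OF h, of x q] inv[of "ract N p' p q x h" p' q] by (simp add: inv)
  qed
qed

lemma B_bimodule_simps [simp]:
  "elts (B_bimodule \<delta>) = hom_B" "plus_m (B_bimodule \<delta>) = (\<lambda>p q. (+))" "scal_m (B_bimodule \<delta>) = (\<lambda>p q. scal)"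
  "lact (B_bimodule \<delta>) = (\<lambda>p q q' h f. comp \<delta> h f)" "ract (B_bimodule \<delta>) = (\<lambda>p' p q f h. comp \<delta> f h)"
  by (simp_all add: B_bimodule_def)

lemma S_bimodule_simps [simp]:
  "elts (S_bimodule \<delta>) = hom_S" "plus_m (S_bimodule \<delta>) = (\<lambda>p q. (+))" "scal_m (S_bimodule \<delta>) = (\<lambda>p q. scal)"
  "lact (S_bimodule \<delta>) = (\<lambda>p q q' h f. comp \<delta> h f)" "ract (S_bimodule \<delta>) = (\<lambda>p' p q f h. comp \<delta> f h)"
  by (simp_all add: S_bimodule_def)

lemma B_plus_simps [simp]:
  "elts (B_plus \<delta>) = Up" "plus_m (B_plus \<delta>) = (\<lambda>p q. (+))" "scal_m (B_plus \<delta>) = (\<lambda>p q. scal)"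
  "lact (B_plus \<delta>) = (\<lambda>p q q' h f. upw (comp \<delta> h f))" "ract (B_plus \<delta>) = (\<lambda>p' p q f h. comp \<delta> f h)"
  by (simp_all add: B_plus_def)

lemma B_minus_simps [simp]:
  "elts (B_minus \<delta>) = Dn" "plus_m (B_minus \<delta>) = (\<lambda>p q. (+))" "scal_m (B_minus \<delta>) = (\<lambda>p q. scal)"
  "lact (B_minus \<delta>) = (\<lambda>p q q' h f. comp \<delta> h f)" "ract (B_minus \<delta>) = (\<lambda>p' p q f h. dnw (comp \<delta> f h))"
  by (simp_all add: B_minus_def)

section \<open>The tensor product over the Brauer category\<close>

context
  fixes \<delta> :: "'k::comm_ring_1"
begin

abbreviation "minus_plus \<equiv> tensor hom_B (B_minus \<delta>) (B_plus \<delta>)"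
abbreviation "minus_plus_ker \<equiv> tensor_ker hom_B (B_minus \<delta>) (B_plus \<delta>)"

lemma lact_minus_plus:
  assumes h: "h \<in> hom_S q q'"
  shows "lact minus_plus p q q' h (x +o minus_plus_ker p q) = lin_ext (\<lambda>(s, m, n). gen (s, comp \<delta> h m, n)) x +o minus_plus_ker p q'"
proof -
  have "lin_ext (\<lambda>(s, m, n). gen (s, comp \<delta> h m, n)) y \<in> minus_plus_ker p q'" if "y \<in> minus_plus_ker p q" for y
  proof (rule tensor_ker_left_map[where U = "\<lambda>s m. comp \<delta> h m", OF _ _ _ _ that]; simp)
    fix s and m :: "'k morphism" assume "m \<in> Dn s q"
    then show "comp \<delta> h m \<in> Dn s q'" by (rule comp_Dn[OF hom_S_Dn[OF h]])
  next
    fix s t and m g :: "'k morphism" assume m: "m \<in> Dn t q" and g: "g \<in> hom_B s t"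
    show "comp \<delta> h (dnw (comp \<delta> m g)) = dnw (comp \<delta> (comp \<delta> h m) g)"
      by (simp add: dnw_level_comp[OF comp_hom_B[OF Dn_hom[OF m] g] h] comp_assoc[OF hom_S_hom[OF h] Dn_hom[OF m] g])
  qed
  from coset_map[OF subspace_tensor_ker subspace_tensor_ker lin_lin_ext this]
  show ?thesis by (simp add: tensor_def)
qed

lemma ract_minus_plus:
  assumes h: "h \<in> hom_S p' p"
  shows "ract minus_plus p' p q (x +o minus_plus_ker p q) h = lin_ext (\<lambda>(s, m, n). gen (s, m, comp \<delta> n h)) x +o minus_plus_ker p' q"
proof -
  have "lin_ext (\<lambda>(s, m, n). gen (s, m, comp \<delta> n h)) y \<in> minus_plus_ker p' q" if "y \<in> minus_plus_ker p q" for y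
  proof (rule tensor_ker_right_map[where V = "\<lambda>s n. comp \<delta> n h", OF _ _ _ _ that]; simp)
    fix s and n :: "'k morphism" assume "n \<in> Up p s"
    then show "comp \<delta> n h \<in> Up p' s" by (rule comp_Up[OF _ hom_S_Up[OF h]])
  next
    fix s t and n g :: "'k morphism" assume n: "n \<in> Up p s" and g: "g \<in> hom_B s t"
    show "comp \<delta> (upw (comp \<delta> g n)) h = upw (comp \<delta> g (comp \<delta> n h))"
      by (simp add: upw_comp_level[OF comp_hom_B[OF g Up_hom[OF n]] h, symmetric] comp_assoc[OF g Up_hom[OF n] hom_S_hom[OF h]])
  qed
  from coset_map[OF subspace_tensor_ker subspace_tensor_ker lin_lin_ext this]
  show ?thesis by (simp add: tensor_def)
qed

lemma minus_plus_ker_balanced: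
  assumes "m \<in> Dn t q" "h \<in> hom_B s t" "n \<in> Up p s"
  shows "gen (s, dnw (comp \<delta> m h), n) - gen (t, m, upw (comp \<delta> h n)) \<in> minus_plus_ker p q"
  using tensor_ker_rels(5)[where M = "B_minus \<delta>" and N = "B_plus \<delta>" and H = hom_B] assms by simp

lemma minus_plus_ker_right:
  "m \<in> Dn s q \<Longrightarrow> n \<in> Up p s \<Longrightarrow> n' \<in> Up p s \<Longrightarrow>
    gen (s, m, n + n') - gen (s, m, n) - gen (s, m, n') \<in> minus_plus_ker p q"
  "m \<in> Dn s q \<Longrightarrow> n \<in> Up p s \<Longrightarrow> gen (s, m, scal c n) - scal c (gen (s, m, n)) \<in> minus_plus_ker p q"
  using tensor_ker_rels(2,4)[where M = "B_minus \<delta>" and N = "B_plus \<delta>" and H = hom_B] by simp_all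

definition level_comp :: "((nat \<times> 'k morphism \<times> 'k morphism) \<Rightarrow>\<^sub>0 'k) \<Rightarrow> 'k morphism" where
  "level_comp = lin_ext (\<lambda>(s, m, n). lev (comp \<delta> m n))"

lemma lin_level_comp: "lin level_comp"
  unfolding level_comp_def by (rule lin_lin_ext)

text \<open>Balancedness over \<open>B\<close>: both sides are the level part of
  \<open>m h n\<close>, since neither projection affects it.\<close>

lemma level_comp_vanish: "x \<in> minus_plus_ker p q \<Longrightarrow> level_comp x = 0"
  unfolding level_comp_def
proof (rule tensor_ker_vanish[where E = "\<lambda>s m n. lev (comp \<delta> m n)"]; simp)
  fix s t and m h n :: "'k morphism" assume m: "m \<in> Dn t q" and h: "h \<in> hom_B s t" and n: "n \<in> Up p s"
  show "lev (comp \<delta> (dnw (comp \<delta> m h)) n) = lev (comp \<delta> m (upw (comp \<delta> h n)))"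
    using restrict_comp_eq(4)[OF comp_hom_B[OF Dn_hom[OF m] h] Up_hom[OF n], of \<delta> \<delta>]
      restrict_comp_eq(3)[OF Dn_hom[OF m] comp_hom_B[OF h Up_hom[OF n]], of \<delta> \<delta>]
      comp_assoc[OF Dn_hom[OF m] h Up_hom[OF n], of \<delta>] by simp
qed

lemma dnw_upw: "dnw (upw f) = lev f"
proof -
  have "f \<in> free_on UNIV" by (simp add: free_on_def)
  then show ?thesis by (induction rule: free_on_induct) (simp_all add: restrict_gen level_def)
qed

lemma level_comp_class:
  assumes "x \<in> free_on (tensor_gens (B_minus \<delta>) (B_plus \<delta>) p q)"
  shows "level_comp x \<in> hom_S p q \<and> x - gen (q, idm q, level_comp x) \<in> minus_plus_ker p q"
  using assms
proof (induction rule: free_on_induct)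
  case zero
  \<comment> \<open>The symbol with third entry 0 is a generator of the free module; the scalar
    relation at 0 shows that its class vanishes.\<close>
  have "gen (q, idm q, scal 0 0) - scal 0 (gen (q, idm q, 0)) \<in> minus_plus_ker p q"
    by (rule minus_plus_ker_right(2)[OF one_Dn free_on_0])
  then have "- gen (q, idm q, 0) \<in> minus_plus_ker p q"
    using free_module.subspace_neg[OF subspace_tensor_ker] by fastforce
  then show ?case by (simp add: lin_0[OF lin_level_comp] hom_simps)
next
  case (gen a)
  obtain s m n where a: "a = (s, m, n)" by (cases a)
  have m: "m \<in> Dn s q" and n: "n \<in> Up p s" using gen by (simp_all add: tensor_gens_def a)
  let ?mn = "comp \<delta> m n"
  have mn: "?mn \<in> hom_B p q" by (rule comp_hom_B[OF Dn_hom[OF m] Up_hom[OF n]])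
  have c: "lev ?mn \<in> hom_S p q" by (rule lev_hom_S[OF mn])
  have u: "upw ?mn \<in> Up p q" by (rule upw_Up[OF mn])
  \<comment> \<open>Writing u for \<open>upw (m n)\<close>, the chain is m \<otimes> n = 1 \<otimes>
    u = \<open>lev (m n)\<close> \<otimes> 1 = 1 \<otimes> \<open>lev (m n)\<close>. Moving a
    morphism to the right applies the upward projection, moving it back the downward one, and
    together they leave the level part.\<close>
  have 1: "gen (s, m, n) - gen (q, idm q, upw ?mn) \<in> minus_plus_ker p q"
    using minus_plus_ker_balanced[OF one_Dn Dn_hom[OF m] n] by (simp add: one_comp[OF Dn_hom[OF m]] dnw_id[OF m])
  have 2: "gen (p, lev ?mn, idm p) - gen (q, idm q, upw ?mn) \<in> minus_plus_ker p q"
    using minus_plus_ker_balanced[OF one_Dn Up_hom[OF u] one_Up]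
    by (simp add: one_comp[OF Up_hom[OF u]] comp_one[OF Up_hom[OF u]] dnw_upw upw_id[OF u])
  have 3: "gen (p, lev ?mn, idm p) - gen (q, idm q, lev ?mn) \<in> minus_plus_ker p q"
    using minus_plus_ker_balanced[OF one_Dn hom_S_hom[OF c] one_Up]
    by (simp add: one_comp[OF hom_S_hom[OF c]] comp_one[OF hom_S_hom[OF c]] dnw_id[OF hom_S_Dn[OF c]] upw_id[OF hom_S_Up[OF c]])
  note K = subspace_tensor_ker[of hom_B "B_minus \<delta>" "B_plus \<delta>" p q]
  from free_module.subspace_add[OF K free_module.subspace_diff[OF K 1 2] 3]
  show ?case using c by (simp add: level_comp_def a)
next
  case (add x y)
  note K = subspace_tensor_ker[of hom_B "B_minus \<delta>" "B_plus \<delta>" p q]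
  have "gen (q, idm q, level_comp x + level_comp y) - gen (q, idm q, level_comp x) - gen (q, idm q, level_comp y) \<in> minus_plus_ker p q"
    using add by (intro minus_plus_ker_right(1)[OF one_Dn] hom_S_Up) simp_all
  from free_module.subspace_diff[OF K free_module.subspace_add[OF K conjunct2[OF add(1)] conjunct2[OF add(2)]] this]
  show ?case using add by (simp add: lin_add[OF lin_level_comp] hom_simps algebra_simps)
next
  case (scal c x)
  note K = subspace_tensor_ker[of hom_B "B_minus \<delta>" "B_plus \<delta>" p q]
  have "gen (q, idm q, scal c (level_comp x)) - scal c (gen (q, idm q, level_comp x)) \<in> minus_plus_ker p q"
    using scal by (intro minus_plus_ker_right(2)[OF one_Dn] hom_S_Up) simp_all
  from free_module.subspace_diff[OF K free_module.subspace_scale[OF K conjunct2[OF scal], of c] this]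
  show ?case using scal by (simp add: lin_scal[OF lin_level_comp] hom_simps)
qed

lemma tensor_over_B_iso: "bimodule_iso hom_S minus_plus (S_bimodule \<delta>)"
proof (rule bimodule_iso_inv[where \<Phi> = "\<lambda>p q c. gen (q, idm q, c) +o minus_plus_ker p q"])
  note K = subspace_tensor_ker[of hom_B "B_minus \<delta>" "B_plus \<delta>"]
  have g: "gen (q, idm q, c) \<in> free_on (tensor_gens (B_minus \<delta>) (B_plus \<delta>) p q)" if "c \<in> hom_S p q" for c p q
    using one_Dn hom_S_Up[OF that] by (intro free_on_gen) (simp add: tensor_gens_def)
  have e: "level_comp (gen (q, idm q, c)) = c" if "c \<in> hom_S p q" for c p q
    by (simp add: level_comp_def one_comp[OF hom_S_hom[OF that]] lev_id[OF that])
  fix p q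
  show "bij_betw (\<lambda>c. gen (q, idm q, c) +o minus_plus_ker p q) (elts (S_bimodule \<delta>) p q) (elts minus_plus p q)"
  proof (rule bij_betw_imageI)
    show "inj_on (\<lambda>c. gen (q, idm q, c) +o minus_plus_ker p q) (elts (S_bimodule \<delta>) p q)"
    proof (rule inj_onI)
      fix c d assume cd: "c \<in> elts (S_bimodule \<delta>) p q" "d \<in> elts (S_bimodule \<delta>) p q"
        "gen (q, idm q, c) +o minus_plus_ker p q = gen (q, idm q, d) +o minus_plus_ker p q"
      then have "gen (q, idm q, c) - gen (q, idm q, d) \<in> minus_plus_ker p q" by (simp only: coset_eq_iff[OF K])
      from level_comp_vanish[OF this] show "c = d" using cd by (simp add: lin_diff[OF lin_level_comp] e)
    qed
    show "(\<lambda>c. gen (q, idm q, c) +o minus_plus_ker p q) ` elts (S_bimodule \<delta>) p q = elts minus_plus p q"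
      unfolding elts_tensor
    proof (intro subset_antisym image_subsetI)
      fix c assume "c \<in> elts (S_bimodule \<delta>) p q"
      then have "gen (q, idm q, c) \<in> free_on (tensor_gens (B_minus \<delta>) (B_plus \<delta>) p q)" by (simp add: g)
      then show "gen (q, idm q, c) +o minus_plus_ker p q \<in> (\<lambda>x. x +o minus_plus_ker p q) ` free_on (tensor_gens (B_minus \<delta>) (B_plus \<delta>) p q)"
        by (rule imageI)
    next
      fix x :: "(nat \<times> 'k morphism \<times> 'k morphism) \<Rightarrow>\<^sub>0 'k"
      assume "x \<in> free_on (tensor_gens (B_minus \<delta>) (B_plus \<delta>) p q)"
      note level_comp_class[OF this]
      then have "level_comp x \<in> elts (S_bimodule \<delta>) p q" "x +o minus_plus_ker p q = gen (q, idm q, level_comp x) +o minus_plus_ker p q"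
        by (simp_all add: coset_eq_iff[OF K])
      then show "x +o minus_plus_ker p q \<in> (\<lambda>c. gen (q, idm q, c) +o minus_plus_ker p q) ` elts (S_bimodule \<delta>) p q"
        by (intro image_eqI)
    qed
  qed
  {
    fix x y :: "'k morphism" assume "x \<in> elts (S_bimodule \<delta>) p q" "y \<in> elts (S_bimodule \<delta>) p q"
    then have xy: "x \<in> hom_S p q" "y \<in> hom_S p q" by simp_all
    have "gen (q, idm q, x + y) - gen (q, idm q, x) - gen (q, idm q, y) \<in> minus_plus_ker p q"
      using xy by (intro minus_plus_ker_right(1)[OF one_Dn] hom_S_Up)
    then show "plus_m (S_bimodule \<delta>) p q x y \<in> elts (S_bimodule \<delta>) p q \<and>
      gen (q, idm q, plus_m (S_bimodule \<delta>) p q x y) +o minus_plus_ker p q =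
      plus_m minus_plus p q (gen (q, idm q, x) +o minus_plus_ker p q) (gen (q, idm q, y) +o minus_plus_ker p q)"
      using xy by (simp add: plus_tensor coset_eq_iff[OF K] hom_simps diff_diff_eq)
  next
    fix c and x :: "'k morphism" assume "x \<in> elts (S_bimodule \<delta>) p q"
    then have x: "x \<in> hom_S p q" by simp
    have "gen (q, idm q, scal c x) - scal c (gen (q, idm q, x)) \<in> minus_plus_ker p q"
      using x by (intro minus_plus_ker_right(2)[OF one_Dn] hom_S_Up)
    then show "scal_m (S_bimodule \<delta>) p q c x \<in> elts (S_bimodule \<delta>) p q \<and>
      gen (q, idm q, scal_m (S_bimodule \<delta>) p q c x) +o minus_plus_ker p q = scal_m minus_plus p q c (gen (q, idm q, x) +o minus_plus_ker p q)"
      using x by (simp add: scal_tensor coset_eq_iff[OF K] hom_simps)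
  next
    fix q' and h x :: "'k morphism" assume h: "h \<in> hom_S q q'" and "x \<in> elts (S_bimodule \<delta>) p q"
    then have x: "x \<in> hom_S p q" by simp
    have hx: "comp \<delta> h x \<in> hom_S p q'" by (rule comp_hom_S[OF h x])
    \<comment> \<open>The left action produces h \<otimes> x, which has to be brought back to the
      form 1 \<otimes> c; the right action preserves that form.\<close>
    have "gen (q, h, x) \<in> free_on (tensor_gens (B_minus \<delta>) (B_plus \<delta>) p q')"
      using hom_S_Dn[OF h] hom_S_Up[OF x] by (intro free_on_gen) (simp add: tensor_gens_def)
    from level_comp_class[OF this] have "gen (q, h, x) - gen (q', idm q', comp \<delta> h x) \<in> minus_plus_ker p q'"
      by (simp add: level_comp_def lev_id[OF hx])
    then show "lact (S_bimodule \<delta>) p q q' h x \<in> elts (S_bimodule \<delta>) p q' \<and>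
      gen (q', idm q', lact (S_bimodule \<delta>) p q q' h x) +o minus_plus_ker p q' = lact minus_plus p q q' h (gen (q, idm q, x) +o minus_plus_ker p q)"
      using hx by (simp add: lact_minus_plus[OF h] comp_one[OF hom_S_hom[OF h]] coset_eq_iff[OF K, symmetric])
  next
    fix p' and h x :: "'k morphism" assume h: "h \<in> hom_S p' p" and "x \<in> elts (S_bimodule \<delta>) p q"
    then have x: "x \<in> hom_S p q" by simp
    show "ract (S_bimodule \<delta>) p' p q x h \<in> elts (S_bimodule \<delta>) p' q \<and>
      gen (q, idm q, ract (S_bimodule \<delta>) p' p q x h) +o minus_plus_ker p' q = ract minus_plus p' p q (gen (q, idm q, x) +o minus_plus_ker p q) h"
      by (simp add: ract_minus_plus[OF h] comp_hom_S[OF x h])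
  }
qed

end

section \<open>The tensor product over the level category\<close>

context
  fixes \<delta> :: "'k::comm_ring_1"
begin

abbreviation "plus_minus \<equiv> tensor hom_S (B_plus \<delta>) (B_minus \<delta>)"
abbreviation "plus_minus_ker \<equiv> tensor_ker hom_S (B_plus \<delta>) (B_minus \<delta>)"

lemma lact_plus_minus:
  assumes h: "h \<in> hom_B q q'"
  shows "lact plus_minus p q q' h (x +o plus_minus_ker p q) = lin_ext (\<lambda>(s, m, n). gen (s, upw (comp \<delta> h m), n)) x +o plus_minus_ker p q'"
proof -
  have "lin_ext (\<lambda>(s, m, n). gen (s, upw (comp \<delta> h m), n)) y \<in> plus_minus_ker p q'" if "y \<in> plus_minus_ker p q" for y
  proof (rule tensor_ker_left_map[where U = "\<lambda>s m. upw (comp \<delta> h m)", OF _ _ _ _ that]; simp)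
    fix s and m :: "'k morphism" assume "m \<in> Up s q"
    then show "upw (comp \<delta> h m) \<in> Up s q'" by (intro upw_Up comp_hom_B[OF h] Up_hom)
  next
    fix s t and m g :: "'k morphism" assume m: "m \<in> Up t q" and g: "g \<in> hom_S s t"
    show "upw (comp \<delta> h (comp \<delta> m g)) = comp \<delta> (upw (comp \<delta> h m)) g"
      by (simp add: upw_comp_level[OF comp_hom_B[OF h Up_hom[OF m]] g, symmetric] comp_assoc[OF h Up_hom[OF m] hom_S_hom[OF g]])
  qed
  from coset_map[OF subspace_tensor_ker subspace_tensor_ker lin_lin_ext this]
  show ?thesis by (simp add: tensor_def)
qed

lemma ract_plus_minus:
  assumes h: "h \<in> hom_B p' p"
  shows "ract plus_minus p' p q (x +o plus_minus_ker p q) h = lin_ext (\<lambda>(s, m, n). gen (s, m, dnw (comp \<delta> n h))) x +o plus_minus_ker p' q"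
proof -
  have "lin_ext (\<lambda>(s, m, n). gen (s, m, dnw (comp \<delta> n h))) y \<in> plus_minus_ker p' q" if "y \<in> plus_minus_ker p q" for y
  proof (rule tensor_ker_right_map[where V = "\<lambda>s n. dnw (comp \<delta> n h)", OF _ _ _ _ that]; simp)
    fix s and n :: "'k morphism" assume "n \<in> Dn p s"
    then show "dnw (comp \<delta> n h) \<in> Dn p' s" by (intro dnw_Dn comp_hom_B[OF _ h] Dn_hom)
  next
    fix s t and n g :: "'k morphism" assume n: "n \<in> Dn p s" and g: "g \<in> hom_S s t"
    show "dnw (comp \<delta> (comp \<delta> g n) h) = comp \<delta> g (dnw (comp \<delta> n h))"
      by (simp add: dnw_level_comp[OF comp_hom_B[OF Dn_hom[OF n] h] g, symmetric] comp_assoc[OF hom_S_hom[OF g] Dn_hom[OF n] h])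
  qed
  from coset_map[OF subspace_tensor_ker subspace_tensor_ker lin_lin_ext this]
  show ?thesis by (simp add: tensor_def)
qed

section \<open>Calculating modulo the relations of the tensor product\<close>

definition tcong :: "nat \<Rightarrow> nat \<Rightarrow> ((nat \<times> 'k morphism \<times> 'k morphism) \<Rightarrow>\<^sub>0 'k) \<Rightarrow> _ \<Rightarrow> bool" where
  "tcong p q x y \<longleftrightarrow> x - y \<in> plus_minus_ker p q"

lemma subspace_plus_minus_ker: "free_module.subspace (plus_minus_ker p q)"
  by (rule subspace_tensor_ker)

lemma tcong_coset: "x +o plus_minus_ker p q = y +o plus_minus_ker p q \<longleftrightarrow> tcong p q x y"
  unfolding tcong_def by (rule coset_eq_iff[OF subspace_plus_minus_ker])

lemma tcong_refl [simp]: "tcong p q x x"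
  using free_module.subspace_0[OF subspace_plus_minus_ker] by (simp add: tcong_def)

lemma tcong_sym: "tcong p q x y \<Longrightarrow> tcong p q y x"
  using free_module.subspace_neg[OF subspace_plus_minus_ker, of "x - y"] by (simp add: tcong_def)

lemma tcong_trans [trans]: "tcong p q x y \<Longrightarrow> tcong p q y z \<Longrightarrow> tcong p q x z"
  using free_module.subspace_add[OF subspace_plus_minus_ker, of "x - y" p q "y - z"] by (simp add: tcong_def)

lemma tcong_add: "tcong p q x y \<Longrightarrow> tcong p q x' y' \<Longrightarrow> tcong p q (x + x') (y + y')"
  using free_module.subspace_add[OF subspace_plus_minus_ker, of "x - y" p q "x' - y'"] by (simp add: tcong_def algebra_simps)

lemma tcong_scal: "tcong p q x y \<Longrightarrow> tcong p q (scal c x) (scal c y)"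
  using free_module.subspace_scale[OF subspace_plus_minus_ker, of "x - y" p q c] by (simp add: tcong_def)

lemma tcong_diff: "tcong p q x y \<Longrightarrow> tcong p q x' y' \<Longrightarrow> tcong p q (x - x') (y - y')"
  using free_module.subspace_diff[OF subspace_plus_minus_ker, of "x - y" p q "x' - y'"] by (simp add: tcong_def algebra_simps)

lemma tcong_sum: "(\<And>i. i \<in> I \<Longrightarrow> tcong p q (f i) (g i)) \<Longrightarrow> tcong p q (sum f I) (sum g I)"
  by (induction I rule: infinite_finite_induct) (auto intro: tcong_add)

lemma tcong_rels:
  "m \<in> Up s q \<Longrightarrow> m' \<in> Up s q \<Longrightarrow> n \<in> Dn p s \<Longrightarrow> tcong p q (gen (s, m + m', n)) (gen (s, m, n) + gen (s, m', n))"
  "m \<in> Up s q \<Longrightarrow> n \<in> Dn p s \<Longrightarrow> n' \<in> Dn p s \<Longrightarrow> tcong p q (gen (s, m, n + n')) (gen (s, m, n) + gen (s, m, n'))"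
  "m \<in> Up s q \<Longrightarrow> n \<in> Dn p s \<Longrightarrow> tcong p q (gen (s, scal c m, n)) (scal c (gen (s, m, n)))"
  "m \<in> Up s q \<Longrightarrow> n \<in> Dn p s \<Longrightarrow> tcong p q (gen (s, m, scal c n)) (scal c (gen (s, m, n)))"
  "m \<in> Up t q \<Longrightarrow> h \<in> hom_S s t \<Longrightarrow> n \<in> Dn p s \<Longrightarrow> tcong p q (gen (s, comp \<delta> m h, n)) (gen (t, m, comp \<delta> h n))"
  using tensor_ker_rels[where M = "B_plus \<delta>" and N = "B_minus \<delta>" and H = hom_S]
  by (simp_all add: tcong_def diff_diff_eq)

lemma tcong_zero:
  "n \<in> Dn p s \<Longrightarrow> tcong p q (gen (s, 0, n)) 0" "m \<in> Up s q \<Longrightarrow> tcong p q (gen (s, m, 0)) 0"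
  using tcong_rels(3)[of 0 s q n p 0] tcong_rels(4)[of m s q 0 p 0] by simp_all

lemma tcong_sum_left:
  assumes "\<And>i. i \<in> I \<Longrightarrow> m i \<in> Up s q" "n \<in> Dn p s"
  shows "tcong p q (gen (s, sum m I, n)) (\<Sum>i\<in>I. gen (s, m i, n))"
  using assms(1)
proof (induction I rule: infinite_finite_induct)
  case (insert i I)
  then have "tcong p q (gen (s, m i + sum m I, n)) (gen (s, m i, n) + gen (s, sum m I, n))"
    by (intro tcong_rels(1) free_on_sum assms(2)) simp_all
  also have "tcong p q \<dots> (gen (s, m i, n) + (\<Sum>i\<in>I. gen (s, m i, n)))"
    using insert by (intro tcong_add) simp_all
  finally show ?case using insert by simp
qed (simp_all add: tcong_zero assms(2))

lemma tcong_sum_right: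
  assumes "\<And>i. i \<in> I \<Longrightarrow> n i \<in> Dn p s" "m \<in> Up s q"
  shows "tcong p q (gen (s, m, sum n I)) (\<Sum>i\<in>I. gen (s, m, n i))"
  using assms(1)
proof (induction I rule: infinite_finite_induct)
  case (insert i I)
  then have "tcong p q (gen (s, m, n i + sum n I)) (gen (s, m, n i) + gen (s, m, sum n I))"
    by (intro tcong_rels(2) free_on_sum assms(2)) simp_all
  also have "tcong p q \<dots> (gen (s, m, n i) + (\<Sum>i\<in>I. gen (s, m, n i)))"
    using insert by (intro tcong_add) simp_all
  finally show ?case using insert by simp
qed (simp_all add: tcong_zero assms(2))

section \<open>Gluing and the filtration by the middle object\<close>

definition glue :: "((nat \<times> 'k morphism \<times> 'k morphism) \<Rightarrow>\<^sub>0 'k) \<Rightarrow> 'k morphism" where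
  "glue = lin_ext (\<lambda>(s, m, n). comp \<delta> m n)"

lemma lin_glue: "lin glue"
  unfolding glue_def by (rule lin_lin_ext)

abbreviation "plus_minus_gens \<equiv> tensor_gens (B_plus \<delta>) (B_minus \<delta>)"

lemma glue_surj:
  assumes "d \<in> hom_B p q"
  shows "\<exists>x\<in>free_on (plus_minus_gens p q). glue x = d"
  using assms unfolding hom_B_def
proof (induction rule: free_on_induct)
  case zero
  then show ?case by (intro bexI[of _ 0]) (simp_all add: lin_0[OF lin_glue])
next
  case (gen D)
  then obtain s m n where m: "m \<in> brauer_up s q" and n: "n \<in> brauer_down p s" and D: "hat_comp m n = D"
    by (rule brauer_factor)
  have "num_loops m n = 0" using m n by (intro num_loops_up[of m s q n p]) (simp_all add: brauer_down_def)
  then have "glue (gen (s, gen m, gen n)) = gen D" by (simp add: glue_def comp_gen D)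
  moreover have "gen (s, gen m, gen n) \<in> free_on (plus_minus_gens p q)"
    using m n by (intro free_on_gen) (simp add: tensor_gens_def free_on_gen)
  ultimately show ?case by (rule bexI)
next
  case (add x y)
  then obtain u v where "u \<in> free_on (plus_minus_gens p q)" "glue u = x" "v \<in> free_on (plus_minus_gens p q)" "glue v = y" by auto
  then show ?case by (intro bexI[of _ "u + v"]) (simp_all add: lin_add[OF lin_glue] free_on_add)
next
  case (scal c x)
  then obtain u where "u \<in> free_on (plus_minus_gens p q)" "glue u = x" by auto
  then show ?case by (intro bexI[of _ "scal c u"]) (simp_all add: lin_scal[OF lin_glue] free_on_scal)
qed

lemma glue_hom_B:
  assumes "x \<in> free_on (plus_minus_gens p q)"
  shows "glue x \<in> hom_B p q"
  unfolding hom_B_def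
proof (rule lin_free_on[OF lin_glue _ assms])
  fix a assume "a \<in> plus_minus_gens p q"
  then show "glue (gen a) \<in> free_on (brauer p q)"
    by (cases a) (auto simp: glue_def tensor_gens_def hom_B_def[symmetric] intro!: comp_hom_B[OF Up_hom Dn_hom])
qed

lemma glue_vanish:
  assumes "x \<in> plus_minus_ker p q"
  shows "glue x = 0"
  unfolding glue_def
proof (rule tensor_ker_vanish[where E = "\<lambda>s m n. comp \<delta> m n", OF _ _ _ _ _ assms]; simp)
  fix s t and m h n :: "'k morphism" assume "m \<in> Up t q" and h: "h \<in> hom_S s t" and "n \<in> Dn p s"
  then show "comp \<delta> (comp \<delta> m h) n = comp \<delta> m (comp \<delta> h n)"
    using comp_assoc[OF Up_hom hom_S_hom Dn_hom] by metis
qed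

lemma glue_tcong: "tcong p q x y \<Longrightarrow> glue x = glue y"
  using glue_vanish[of "x - y" p q] by (simp add: tcong_def lin_diff[OF lin_glue])

text \<open>The strict bound makes the bottom step of the filtration zero, which serves as the base
  of the inductions on \<open>k\<close>.\<close>

definition low :: "nat \<Rightarrow> nat \<Rightarrow> nat \<Rightarrow> (nat \<times> 'k morphism \<times> 'k morphism) set" where
  "low p q k = {(s, m, n). (s, m, n) \<in> plus_minus_gens p q \<and> s < k}"

text \<open>No bound can be read off from \<open>p\<close> and \<open>q\<close>, because symbols
  with zero entries exist for every middle object; finiteness of the support provides one.\<close>

lemma gens_low:
  assumes "x \<in> free_on (plus_minus_gens p q)"
  shows "\<exists>k. x \<in> free_on (low p q k)"
  using assms
proof (induction rule: free_on_induct)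
  case (gen a)
  then have "a \<in> low p q (Suc (fst a))" by (cases a) (simp add: low_def)
  then show ?case using free_on_gen by metis
next
  case (add x y)
  then obtain k l where "x \<in> free_on (low p q k)" "y \<in> free_on (low p q l)" by auto
  then have "x \<in> free_on (low p q (max k l))" "y \<in> free_on (low p q (max k l))"
    by (auto elim!: free_on_mono[rotated] simp: low_def)
  then show ?case using free_on_add by metis
next
  case (scal c x)
  then show ?case using free_on_scal by metis
qed simp

lemma low_0: "x \<in> free_on (low p q 0) \<Longrightarrow> x = 0"
proof -
  have "low p q 0 = {}" by (auto simp: low_def)
  then show "x \<in> free_on (low p q 0) \<Longrightarrow> x = 0" by (simp add: free_on_empty)
qed

lemma low_sub: "x \<in> free_on (low p q k) \<Longrightarrow> x \<in> free_on (plus_minus_gens p q)"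
  by (erule free_on_mono[rotated]) (auto simp: low_def)

end

section \<open>The comparison map built from dual bases\<close>

locale dual_bases =
  fixes \<delta> :: "'k::comm_ring_1" and y :: "nat \<Rightarrow> nat \<Rightarrow> diagram \<Rightarrow> 'k morphism"
  assumes y_Dn: "\<And>t p f. f \<in> brauer_up_mono t p \<Longrightarrow> y t p f \<in> Dn p t"
    and y_up: "\<And>t p x. x \<in> Up t p \<Longrightarrow> (\<Sum>f\<in>brauer_up_mono t p. comp \<delta> (gen f) (pr \<delta> (y t p f) x)) = x"
    and y_dn: "\<And>t p n. n \<in> Dn p t \<Longrightarrow> (\<Sum>f\<in>brauer_up_mono t p. comp \<delta> (pr \<delta> n (gen f)) (y t p f)) = n"
begin

text \<open>A morphism \<open>h\<close> is encoded by its action on the spaces of upward diagrams; \<open>rep_at t p h\<close>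
  is the endomorphism of degree \<open>t\<close> written in terms of the dual bases.\<close>

definition rep_at :: "nat \<Rightarrow> nat \<Rightarrow> 'k morphism \<Rightarrow> ((nat \<times> 'k morphism \<times> 'k morphism) \<Rightarrow>\<^sub>0 'k)" where
  "rep_at t p h = (\<Sum>f\<in>brauer_up_mono t p. gen (t, upw (comp \<delta> h (gen f)), y t p f))"

definition rep :: "nat \<Rightarrow> 'k morphism \<Rightarrow> ((nat \<times> 'k morphism \<times> 'k morphism) \<Rightarrow>\<^sub>0 'k)" where
  "rep p h = (\<Sum>t\<le>p. rep_at t p h)"

text \<open>There are no upward diagrams from \<open>t\<close> to \<open>p\<close> when
  \<open>t > p\<close>. Sums for different sources can thus be compared over a common range.\<close>

lemma rep_range: "p \<le> r \<Longrightarrow> rep p h = (\<Sum>t\<le>r. rep_at t p h)"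
  unfolding rep_def
proof (rule sum.mono_neutral_left)
  show "\<forall>i\<in>{..r} - {..p}. rep_at i p h = 0"
  proof
    fix t assume "t \<in> {..r} - {..p}"
    then have "brauer_up_mono t p = {}" using mono_up[of _ t p] brauer_up_le[of _ t p] by fastforce
    then show "rep_at t p h = 0" by (simp add: rep_at_def)
  qed
qed auto

lemma act_Up: "h \<in> hom_B p q \<Longrightarrow> f \<in> brauer_up_mono t p \<Longrightarrow> upw (comp \<delta> h (gen f)) \<in> Up t q"
  by (intro upw_Up comp_hom_B[OF _ Up_hom[OF gen_up]])

lemma rep_at_gens: "h \<in> hom_B p q \<Longrightarrow> rep_at t p h \<in> free_on {a \<in> plus_minus_gens \<delta> p q. fst a = t}"
  unfolding rep_at_def by (intro free_on_sum free_on_gen) (simp add: tensor_gens_def act_Up y_Dn)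

lemma rep_gens: "h \<in> hom_B p q \<Longrightarrow> rep p h \<in> free_on (plus_minus_gens \<delta> p q)"
  unfolding rep_def
  by (intro free_on_sum, rule free_on_mono[OF _ rep_at_gens]) auto

lemma rep_add:
  assumes "h \<in> hom_B p q" "h' \<in> hom_B p q"
  shows "tcong \<delta> p q (rep p (h + h')) (rep p h + rep p h')"
  unfolding rep_def rep_at_def sum.distrib[symmetric]
  by (intro tcong_sum) (simp add: tcong_rels(1) act_Up[OF assms(1)] act_Up[OF assms(2)] y_Dn)

lemma rep_scal:
  assumes "h \<in> hom_B p q"
  shows "tcong \<delta> p q (rep p (scal c h)) (scal c (rep p h))"
  unfolding rep_def rep_at_def scal_sum
  by (intro tcong_sum) (simp add: tcong_rels(3) act_Up[OF assms(1)] y_Dn)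

lemma rep_zero: "tcong \<delta> p q (rep p 0) 0"
  using rep_scal[OF hom_simps(1), of p q 0] by simp

lemma rep_diff:
  assumes "h \<in> hom_B p q" "h' \<in> hom_B p q"
  shows "tcong \<delta> p q (rep p (h - h')) (rep p h - rep p h')"
proof -
  have "tcong \<delta> p q (rep p (h + scal (-1) h')) (rep p h + rep p (scal (-1) h'))"
    by (intro rep_add assms hom_simps)
  also have "tcong \<delta> p q \<dots> (rep p h + scal (-1) (rep p h'))"
    by (intro tcong_add tcong_refl rep_scal assms)
  finally show ?thesis by simp
qed

text \<open>The left action touches only first entries, so compatibility is an equality of
  representatives and not just a congruence.\<close>

lemma rep_left:
  assumes h: "h \<in> hom_B p q" and h': "h' \<in> hom_B q q'"
  shows "lin_ext (\<lambda>(s, m, n). gen (s, upw (comp \<delta> h' m), n)) (rep p h) = rep p (comp \<delta> h' h)"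
proof -
  have "upw (comp \<delta> h' (upw (comp \<delta> h (gen f)))) = upw (comp \<delta> (comp \<delta> h' h) (gen f))"
    if "f \<in> brauer_up_mono t p" for t f
  proof -
    note f = Up_hom[OF gen_up[OF that]]
    show ?thesis
      using restrict_comp_eq(1)[OF h' comp_hom_B[OF h f], of \<delta> \<delta>] comp_assoc[OF h' h f, of \<delta>] by simp
  qed
  then show ?thesis by (simp add: rep_def rep_at_def cong: sum.cong)
qed

text \<open>This is the action of \<open>h\<close> on the expansion \<open>y_up\<close> of
  \<open>x\<close>; the coefficients are level and pass through the projection.\<close>

lemma upw_action:
  assumes h: "h \<in> hom_B p q" and x: "x \<in> Up t p"
  shows "(\<Sum>g\<in>brauer_up_mono t p. comp \<delta> (upw (comp \<delta> h (gen g))) (pr \<delta> (y t p g) x)) = upw (comp \<delta> h x)"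
proof -
  have "comp \<delta> (upw (comp \<delta> h (gen g))) (pr \<delta> (y t p g) x) = upw (comp \<delta> h (comp \<delta> (gen g) (pr \<delta> (y t p g) x)))"
    if g: "g \<in> brauer_up_mono t p" for g
  proof -
    note gh = Up_hom[OF gen_up[OF g]] and c = pr_hom_S[OF y_Dn[OF g] x, of \<delta>]
    show ?thesis
      using upw_comp_endo[OF comp_hom_B[OF h gh] c, of \<delta> \<delta>] comp_assoc[OF h gh hom_S_hom[OF c], of \<delta>] by simp
  qed
  then have "(\<Sum>g\<in>brauer_up_mono t p. comp \<delta> (upw (comp \<delta> h (gen g))) (pr \<delta> (y t p g) x)) =
    upw (comp \<delta> h (\<Sum>g\<in>brauer_up_mono t p. comp \<delta> (gen g) (pr \<delta> (y t p g) x)))"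
    by simp
  then show ?thesis by (simp only: y_up[OF x])
qed

text \<open>The Casimir argument: expand each \<open>y_g h'\<close> in the dual elements for
  \<open>p'\<close>, move the level coefficients across the tensor sign, and recognise the sums in
  the first entries as actions of \<open>h\<close> on \<open>h' f\<close>.\<close>

lemma rep_right_at:
  assumes h: "h \<in> hom_B p q" and h': "h' \<in> hom_B p' p"
  shows "tcong \<delta> p' q (lin_ext (\<lambda>(s, m, n). gen (s, m, dnw (comp \<delta> n h'))) (rep_at t p h)) (rep_at t p' (comp \<delta> h h'))"
proof -
  let ?F = "brauer_up_mono t p" and ?F' = "brauer_up_mono t p'"
  let ?a = "\<lambda>g. upw (comp \<delta> h (gen g))" and ?b = "\<lambda>g. dnw (comp \<delta> (y t p g) h')"
  let ?x = "\<lambda>f. upw (comp \<delta> h' (gen f))"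
  have a: "?a g \<in> Up t q" if "g \<in> ?F" for g using act_Up[OF h that] .
  have b: "?b g \<in> Dn p' t" if "g \<in> ?F" for g by (intro dnw_Dn comp_hom_B[OF Dn_hom[OF y_Dn[OF that]] h'])
  have x: "?x f \<in> Up t p" if "f \<in> ?F'" for f using act_Up[OF h' that] .
  \<comment> \<open>The two projection actions are adjoint for the pairing, so the coefficients of
    \<open>y_g h'\<close> are also those of \<open>h' f\<close> in the monotone diagrams.\<close>
  have pr: "pr \<delta> (?b g) (gen f) = pr \<delta> (y t p g) (?x f)" if g: "g \<in> ?F" and f: "f \<in> ?F'" for g f
  proof -
    note yg = Dn_hom[OF y_Dn[OF g]] and gf = Up_hom[OF gen_up[OF f]]
    show ?thesis
      using restrict_comp_eq(4)[OF comp_hom_B[OF yg h'] gf, of \<delta> \<delta>]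
        restrict_comp_eq(3)[OF yg comp_hom_B[OF h' gf], of \<delta> \<delta>] comp_assoc[OF yg h' gf, of \<delta>] by simp
  qed
  have c: "pr \<delta> (?b g) (gen f) \<in> hom_S t t" if "g \<in> ?F" "f \<in> ?F'" for g f
    by (rule pr_hom_S[OF b[OF that(1)] gen_up[OF that(2)]])
  have "lin_ext (\<lambda>(s, m, n). gen (s, m, dnw (comp \<delta> n h'))) (rep_at t p h) = (\<Sum>g\<in>?F. gen (t, ?a g, ?b g))"
    by (simp add: rep_at_def)
  also have "tcong \<delta> p' q \<dots> (\<Sum>g\<in>?F. \<Sum>f\<in>?F'. gen (t, comp \<delta> (?a g) (pr \<delta> (?b g) (gen f)), y t p' f))"
  proof (rule tcong_sum)
    fix g assume g: "g \<in> ?F"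
    have "tcong \<delta> p' q (gen (t, ?a g, \<Sum>f\<in>?F'. comp \<delta> (pr \<delta> (?b g) (gen f)) (y t p' f)))
      (\<Sum>f\<in>?F'. gen (t, ?a g, comp \<delta> (pr \<delta> (?b g) (gen f)) (y t p' f)))"
      by (intro tcong_sum_right a g comp_Dn[OF hom_S_Dn[OF c]] y_Dn)
    also have "tcong \<delta> p' q \<dots> (\<Sum>f\<in>?F'. gen (t, comp \<delta> (?a g) (pr \<delta> (?b g) (gen f)), y t p' f))"
      by (intro tcong_sum tcong_sym[OF tcong_rels(5)] a g c y_Dn)
    finally show "tcong \<delta> p' q (gen (t, ?a g, ?b g)) \<dots>" by (simp only: y_dn[OF b[OF g]])
  qed
  also have "(\<Sum>g\<in>?F. \<Sum>f\<in>?F'. gen (t, comp \<delta> (?a g) (pr \<delta> (?b g) (gen f)), y t p' f)) =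
    (\<Sum>f\<in>?F'. \<Sum>g\<in>?F. gen (t, comp \<delta> (?a g) (pr \<delta> (?b g) (gen f)), y t p' f))"
    by (rule sum.swap)
  also have "tcong \<delta> p' q \<dots> (\<Sum>f\<in>?F'. gen (t, \<Sum>g\<in>?F. comp \<delta> (?a g) (pr \<delta> (?b g) (gen f)), y t p' f))"
    by (intro tcong_sum tcong_sym[OF tcong_sum_left] comp_Up[OF a hom_S_Up[OF c]] y_Dn)
  also have "\<dots> = rep_at t p' (comp \<delta> h h')"
    unfolding rep_at_def
  proof (rule sum.cong[OF refl])
    fix f assume f: "f \<in> ?F'"
    note gf = Up_hom[OF gen_up[OF f]]
    have "(\<Sum>g\<in>?F. comp \<delta> (?a g) (pr \<delta> (?b g) (gen f))) = (\<Sum>g\<in>?F. comp \<delta> (?a g) (pr \<delta> (y t p g) (?x f)))"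
      by (rule sum.cong[OF refl]) (simp only: pr f)
    also have "\<dots> = upw (comp \<delta> h (?x f))" by (rule upw_action[OF h x[OF f]])
    also have "\<dots> = upw (comp \<delta> (comp \<delta> h h') (gen f))"
      using restrict_comp_eq(1)[OF h comp_hom_B[OF h' gf], of \<delta> \<delta>] comp_assoc[OF h h' gf, of \<delta>] by simp
    finally show "gen (t, \<Sum>g\<in>?F. comp \<delta> (?a g) (pr \<delta> (?b g) (gen f)), y t p' f) =
      gen (t, upw (comp \<delta> (comp \<delta> h h') (gen f)), y t p' f)" by simp
  qed
  finally show ?thesis .
qed

lemma rep_right:
  assumes h: "h \<in> hom_B p q" and h': "h' \<in> hom_B p' p"
  shows "tcong \<delta> p' q (lin_ext (\<lambda>(s, m, n). gen (s, m, dnw (comp \<delta> n h'))) (rep p h)) (rep p' (comp \<delta> h h'))"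
  unfolding rep_range[of p "max p p'" h, simplified] rep_range[of p' "max p p'", simplified] lin_ext_simps
  by (intro tcong_sum rep_right_at h h')

text \<open>Gluing followed by \<open>rep\<close> is unitriangular for the filtration by the middle object.\<close>

lemma rep_glue_gen:
  assumes m: "m \<in> Up s q" and n: "n \<in> Dn p s"
  shows "\<exists>x'\<in>free_on (low \<delta> p q s). tcong \<delta> p q (rep p (comp \<delta> m n)) (gen (s, m, n) + x')"
proof -
  let ?r = "max p s" and ?h = "comp \<delta> m n"
  have mn: "?h \<in> hom_B p q" by (rule comp_hom_B[OF Up_hom[OF m] Dn_hom[OF n]])
  \<comment> \<open>Since \<open>m\<close> is upward it comes out of the projection. Only the upward
    part of \<open>n \<circ> f\<close>, a morphism from \<open>t\<close> to \<open>s\<close>,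
    matters.\<close>
  have u: "upw (comp \<delta> ?h (gen f)) = comp \<delta> m (upw (comp \<delta> n (gen f)))" 
    and nf: "comp \<delta> n (gen f) \<in> hom_B t s" if "f \<in> brauer_up_mono t p" for t f
  proof -
    note gf = Up_hom[OF gen_up[OF that]]
    show nf: "comp \<delta> n (gen f) \<in> hom_B t s" by (rule comp_hom_B[OF Dn_hom[OF n] gf])
    show "upw (comp \<delta> ?h (gen f)) = comp \<delta> m (upw (comp \<delta> n (gen f)))"
      using upw_comp_Up[OF m nf, of \<delta>] comp_assoc[OF Up_hom[OF m] Dn_hom[OF n] gf, of \<delta>] by simp
  qed
  have high: "tcong \<delta> p q (rep_at t p ?h) 0" if "s < t" for t
  proof -
    have "tcong \<delta> p q (rep_at t p ?h) (\<Sum>f\<in>brauer_up_mono t p. 0)"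
      unfolding rep_at_def
    proof (rule tcong_sum)
      fix f assume f: "f \<in> brauer_up_mono t p"
      have "upw (comp \<delta> n (gen f)) = 0" using Up_zero[OF that upw_Up[OF nf[OF f]]] .
      then show "tcong \<delta> p q (gen (t, upw (comp \<delta> ?h (gen f)), y t p f)) 0"
        by (simp add: u[OF f] tcong_zero y_Dn[OF f])
    qed
    then show ?thesis by simp
  qed
  \<comment> \<open>In degree \<open>s\<close> the upward part of \<open>n \<circ> f\<close> is
    level. It crosses the tensor sign, and \<open>y_dn\<close> reassembles \<open>n\<close>.\<close>
  have mid: "tcong \<delta> p q (rep_at s p ?h) (gen (s, m, n))"
  proof -
    let ?F = "brauer_up_mono s p"
    have c: "pr \<delta> n (gen f) \<in> hom_S s s" if "f \<in> ?F" for f by (rule pr_hom_S[OF n gen_up[OF that]])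
    have "rep_at s p ?h = (\<Sum>f\<in>?F. gen (s, comp \<delta> m (pr \<delta> n (gen f)), y s p f))"
      unfolding rep_at_def by (rule sum.cong[OF refl]) (simp add: u upw_square[OF nf])
    also have "tcong \<delta> p q \<dots> (\<Sum>f\<in>?F. gen (s, m, comp \<delta> (pr \<delta> n (gen f)) (y s p f)))"
      by (intro tcong_sum tcong_rels(5) m c y_Dn)
    also have "tcong \<delta> p q \<dots> (gen (s, m, \<Sum>f\<in>?F. comp \<delta> (pr \<delta> n (gen f)) (y s p f)))"
      by (intro tcong_sym[OF tcong_sum_right] m comp_Dn[OF hom_S_Dn[OF c]] y_Dn)
    finally show ?thesis by (simp only: y_dn[OF n])
  qed
  define x' where "x' = (\<Sum>t<s. rep_at t p ?h)"
  have "x' \<in> free_on (low \<delta> p q s)"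
    unfolding x'_def
    by (intro free_on_sum, rule free_on_mono[OF _ rep_at_gens[OF mn]]) (auto simp: low_def)
  moreover have "tcong \<delta> p q (rep p ?h) (gen (s, m, n) + x')"
  proof -
    have "{..?r} = insert s ({..<s} \<union> {s<..?r})" by auto
    then have "rep p ?h = rep_at s p ?h + (x' + (\<Sum>t\<in>{s<..?r}. rep_at t p ?h))"
      using rep_range[of p ?r ?h] by (simp add: x'_def sum.union_disjoint Int_def)
    also have "tcong \<delta> p q \<dots> (gen (s, m, n) + (x' + (\<Sum>t\<in>{s<..?r}. 0)))"
      by (intro tcong_add mid tcong_refl tcong_sum high) simp
    finally show ?thesis by simp
  qed
  ultimately show ?thesis by (rule bexI[rotated])
qed

lemma rep_glue:
  assumes "x \<in> free_on (low \<delta> p q (Suc k))"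
  shows "\<exists>x'\<in>free_on (low \<delta> p q k). tcong \<delta> p q (rep p (glue \<delta> x)) (x + x')"
proof -
  have hom: "glue \<delta> x \<in> hom_B p q" if "x \<in> free_on (low \<delta> p q (Suc k))" for x
    by (rule glue_hom_B[OF low_sub[OF that]])
  \<comment> \<open>Membership is carried through the induction because \<open>rep\<close> respects
    sums and scalars only for actual morphisms from \<open>p\<close> to \<open>q\<close>.\<close>
  have "x \<in> free_on (low \<delta> p q (Suc k)) \<and> 
    (\<exists>x'\<in>free_on (low \<delta> p q k). tcong \<delta> p q (rep p (glue \<delta> x)) (x + x'))"
    using assms
  proof (induction rule: free_on_induct)
    case zero
    show ?case by (auto intro!: bexI[of _ 0] simp: lin_0[OF lin_glue] rep_zero)
  next
    case (gen a)
    then obtain s m n where a: "a = (s, m, n)" "m \<in> Up s q" "n \<in> Dn p s" "s \<le> k"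
      by (cases a) (auto simp: low_def tensor_gens_def)
    obtain x' where x': "x' \<in> free_on (low \<delta> p q s)" "tcong \<delta> p q (rep p (comp \<delta> m n)) (gen (s, m, n) + x')"
      using rep_glue_gen[OF a(2,3)] by auto
    have "x' \<in> free_on (low \<delta> p q k)" using x'(1) a(4) by (elim free_on_mono[rotated]) (auto simp: low_def)
    then show ?case using x'(2) free_on_gen[OF gen] by (auto simp: a(1) glue_def)
  next
    case (add x z)
    then obtain x' z' where *: "x' \<in> free_on (low \<delta> p q k)" "tcong \<delta> p q (rep p (glue \<delta> x)) (x + x')"
      "z' \<in> free_on (low \<delta> p q k)" "tcong \<delta> p q (rep p (glue \<delta> z)) (z + z')" by auto
    have "tcong \<delta> p q (rep p (glue \<delta> (x + z))) (rep p (glue \<delta> x) + rep p (glue \<delta> z))"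
      using add by (simp add: lin_add[OF lin_glue] rep_add hom)
    also have "tcong \<delta> p q \<dots> ((x + x') + (z + z'))" by (intro tcong_add *)
    finally show ?case using add * by (auto intro!: bexI[of _ "x' + z'"] simp: free_on_add add_ac)
  next
    case (scal c x)
    then obtain x' where *: "x' \<in> free_on (low \<delta> p q k)" "tcong \<delta> p q (rep p (glue \<delta> x)) (x + x')" by auto
    have "tcong \<delta> p q (rep p (glue \<delta> (scal c x))) (scal c (rep p (glue \<delta> x)))"
      using scal by (simp add: lin_scal[OF lin_glue] rep_scal hom)
    also have "tcong \<delta> p q \<dots> (scal c (x + x'))" by (intro tcong_scal *)
    finally show ?case using scal * by (auto intro!: bexI[of _ "scal c x'"] simp: free_on_scal)
  qed
  then show ?thesis ..
qed

text \<open>If \<open>rep\<close> kills the glued element, then \<open>x\<close> is congruent to the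
  lower element \<open>- x'\<close> and glues to the same morphism, so the filtration can be
  descended. The conclusion concerns \<open>glue \<delta> x\<close>, because \<open>x\<close> itself
  may be a nonzero relation.\<close>

lemma rep_inj_low:
  "x \<in> free_on (low \<delta> p q k) \<Longrightarrow> tcong \<delta> p q (rep p (glue \<delta> x)) 0 \<Longrightarrow> glue \<delta> x = 0"
proof (induction k arbitrary: x)
  case 0
  then have "x = 0" by (simp add: low_0)
  then show ?case by (simp add: lin_0[OF lin_glue])
next
  case (Suc k)
  obtain x' where x': "x' \<in> free_on (low \<delta> p q k)" "tcong \<delta> p q (rep p (glue \<delta> x)) (x + x')"
    using rep_glue[OF Suc.prems(1)] by auto
  have "tcong \<delta> p q (x + x') 0" using tcong_trans[OF tcong_sym[OF x'(2)] Suc.prems(2)] .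
  then have "tcong \<delta> p q x (- x')" by (simp add: tcong_def)
  then have e: "glue \<delta> x = glue \<delta> (- x')" by (rule glue_tcong)
  show ?case unfolding e
    by (rule Suc.IH) (use x'(1) Suc.prems(2) e in \<open>simp_all add: free_on_uminus\<close>)
qed

lemma rep_inj:
  assumes d: "d \<in> hom_B p q" and "tcong \<delta> p q (rep p d) 0"
  shows "d = 0"
proof -
  obtain x where x: "x \<in> free_on (plus_minus_gens \<delta> p q)" "glue \<delta> x = d" using glue_surj[OF d] by auto
  obtain k where "x \<in> free_on (low \<delta> p q k)" using gens_low[OF x(1)] by auto
  from rep_inj_low[OF this] show ?thesis using assms(2) x(2) by simp
qed

text \<open>The leading term is hit by the glued element; the lower error is a value of
  \<open>rep\<close> by induction and is subtracted.\<close>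

lemma rep_surj_low:
  "x \<in> free_on (low \<delta> p q k) \<Longrightarrow> \<exists>h\<in>hom_B p q. tcong \<delta> p q (rep p h) x"
proof (induction k arbitrary: x)
  case 0
  then have "x = 0" by (simp add: low_0)
  then show ?case using rep_zero by (intro bexI[OF _ hom_simps(1)]) simp
next
  case (Suc k)
  obtain x' where x': "x' \<in> free_on (low \<delta> p q k)" "tcong \<delta> p q (rep p (glue \<delta> x)) (x + x')"
    using rep_glue[OF Suc.prems(1)] by auto
  obtain h where h: "h \<in> hom_B p q" "tcong \<delta> p q (rep p h) x'" using Suc.IH[OF x'(1)] by auto
  have g: "glue \<delta> x \<in> hom_B p q" by (rule glue_hom_B[OF low_sub[OF Suc.prems]])
  have "tcong \<delta> p q (rep p (glue \<delta> x - h)) (rep p (glue \<delta> x) - rep p h)" by (rule rep_diff[OF g h(1)])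
  also have "tcong \<delta> p q \<dots> (x + x' - x')" by (intro tcong_diff x'(2) h(2))
  finally have "tcong \<delta> p q (rep p (glue \<delta> x - h)) x" by simp
  moreover have "glue \<delta> x - h \<in> hom_B p q" using g h(1) by (simp add: hom_B_def free_on_diff)
  ultimately show ?case by (rule bexI)
qed

lemma rep_surj:
  assumes "x \<in> free_on (plus_minus_gens \<delta> p q)"
  shows "\<exists>h\<in>hom_B p q. tcong \<delta> p q (rep p h) x"
  using gens_low[OF assms] rep_surj_low by metis

lemma tensor_over_S_iso: "bimodule_iso hom_B (plus_minus \<delta>) (B_bimodule \<delta>)"
proof (rule bimodule_iso_inv[where \<Phi> = "\<lambda>p q h. rep p h +o plus_minus_ker \<delta> p q"])
  fix p q
  show "bij_betw (\<lambda>h. rep p h +o plus_minus_ker \<delta> p q) (elts (B_bimodule \<delta>) p q) (elts (plus_minus \<delta>) p q)"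
  proof (rule bij_betw_imageI)
    show "inj_on (\<lambda>h. rep p h +o plus_minus_ker \<delta> p q) (elts (B_bimodule \<delta>) p q)"
    proof (rule inj_onI)
      fix c d assume cd: "c \<in> elts (B_bimodule \<delta>) p q" "d \<in> elts (B_bimodule \<delta>) p q"
        "rep p c +o plus_minus_ker \<delta> p q = rep p d +o plus_minus_ker \<delta> p q"
      then have cd': "c \<in> hom_B p q" "d \<in> hom_B p q" "tcong \<delta> p q (rep p c) (rep p d)"
        by (simp_all add: tcong_coset)
      have "tcong \<delta> p q (rep p (c - d)) (rep p c - rep p d)" by (rule rep_diff[OF cd'(1,2)])
      also have "tcong \<delta> p q \<dots> (rep p d - rep p d)" by (intro tcong_diff cd'(3) tcong_refl)
      finally have "tcong \<delta> p q (rep p (c - d)) 0" by simp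
      then have "c - d = 0" by (rule rep_inj[rotated]) (use cd' in \<open>simp add: hom_B_def free_on_diff\<close>)
      then show "c = d" by simp
    qed
    show "(\<lambda>h. rep p h +o plus_minus_ker \<delta> p q) ` elts (B_bimodule \<delta>) p q = elts (plus_minus \<delta>) p q"
      unfolding elts_tensor
    proof (intro subset_antisym image_subsetI)
      fix h :: "'k morphism" assume "h \<in> elts (B_bimodule \<delta>) p q"
      then have "rep p h \<in> free_on (plus_minus_gens \<delta> p q)" by (simp add: rep_gens)
      then show "rep p h +o plus_minus_ker \<delta> p q \<in> (\<lambda>x. x +o plus_minus_ker \<delta> p q) ` free_on (plus_minus_gens \<delta> p q)" by (rule imageI)
    next
      fix x :: "(nat \<times> 'k morphism \<times> 'k morphism) \<Rightarrow>\<^sub>0 'k"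
      assume "x \<in> free_on (plus_minus_gens \<delta> p q)"
      then obtain h where "h \<in> hom_B p q" "tcong \<delta> p q (rep p h) x" using rep_surj[of x p q] by auto
      then have "h \<in> elts (B_bimodule \<delta>) p q" "x +o plus_minus_ker \<delta> p q = rep p h +o plus_minus_ker \<delta> p q"
        by (simp_all add: tcong_coset tcong_sym)
      then show "x +o plus_minus_ker \<delta> p q \<in> (\<lambda>h. rep p h +o plus_minus_ker \<delta> p q) ` elts (B_bimodule \<delta>) p q"
        by (intro image_eqI)
    qed
  qed
next
  fix p q and x z :: "'k morphism" assume "x \<in> elts (B_bimodule \<delta>) p q" "z \<in> elts (B_bimodule \<delta>) p q"
  then show "plus_m (B_bimodule \<delta>) p q x z \<in> elts (B_bimodule \<delta>) p q \<and>
    rep p (plus_m (B_bimodule \<delta>) p q x z) +o plus_minus_ker \<delta> p q = plus_m (plus_minus \<delta>) p q (rep p x +o plus_minus_ker \<delta> p q) (rep p z +o plus_minus_ker \<delta> p q)"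
    by (simp add: plus_tensor tcong_coset rep_add hom_simps)
next
  fix p q c and x :: "'k morphism" assume "x \<in> elts (B_bimodule \<delta>) p q"
  then show "scal_m (B_bimodule \<delta>) p q c x \<in> elts (B_bimodule \<delta>) p q \<and>
    rep p (scal_m (B_bimodule \<delta>) p q c x) +o plus_minus_ker \<delta> p q = scal_m (plus_minus \<delta>) p q c (rep p x +o plus_minus_ker \<delta> p q)"
    by (simp add: scal_tensor tcong_coset rep_scal hom_simps)
next
  fix p q q' and h x :: "'k morphism" assume h: "h \<in> hom_B q q'" and "x \<in> elts (B_bimodule \<delta>) p q"
  then have x: "x \<in> hom_B p q" by simp
  show "lact (B_bimodule \<delta>) p q q' h x \<in> elts (B_bimodule \<delta>) p q' \<and>
    rep p (lact (B_bimodule \<delta>) p q q' h x) +o plus_minus_ker \<delta> p q' = lact (plus_minus \<delta>) p q q' h (rep p x +o plus_minus_ker \<delta> p q)"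
    by (simp add: lact_plus_minus[OF h] rep_left[OF x h] comp_hom_B[OF h x])
next
  fix p' p q and h x :: "'k morphism" assume h: "h \<in> hom_B p' p" and "x \<in> elts (B_bimodule \<delta>) p q"
  then have x: "x \<in> hom_B p q" by simp
  show "ract (B_bimodule \<delta>) p' p q x h \<in> elts (B_bimodule \<delta>) p' q \<and>
    rep p' (ract (B_bimodule \<delta>) p' p q x h) +o plus_minus_ker \<delta> p' q = ract (plus_minus \<delta>) p' p q (rep p x +o plus_minus_ker \<delta> p q) h"
    using tcong_sym[OF rep_right[OF x h]] by (simp add: ract_plus_minus[OF h] tcong_coset comp_hom_B[OF x h])
qed

end

section \<open>Morita equivalence and non-singularity\<close>

lemma non_singular_dual_bases:
  assumes "non_singular (\<delta>::'k::comm_ring_1)"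
  obtains y where "dual_bases \<delta> y"
proof -
  let ?Q = "\<lambda>t p Y. (\<forall>f\<in>brauer_up_mono t p. Y f \<in> Dn p t) \<and>
    (\<forall>x\<in>Up t p. (\<Sum>f\<in>brauer_up_mono t p. comp \<delta> (gen f) (pr \<delta> (Y f) x)) = x) \<and>
    (\<forall>n\<in>Dn p t. (\<Sum>f\<in>brauer_up_mono t p. comp \<delta> (pr \<delta> n (gen f)) (Y f)) = n)"
  have ex: "\<exists>Y. ?Q t p Y" for t p
  proof (cases "t \<preceq>\<^sub>B p")
    case True
    then have "det_on (gram_index t p) (gram \<delta>) dvd 1" using assms by (simp add: non_singular_iff)
    then show ?thesis by (rule dual_basis) (intro exI conjI ballI; assumption?; simp)
  next
    \<comment> \<open>Without parity and order there are no upward or downward diagrams, so all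
      conditions are about zero and any family works.\<close>
    case False
    then have u: "brauer_up t p = {}" using brauer_up_preceq[of _ t p] by auto
    have d: "brauer_down p t = {}" using flip_brauer_down[of _ p t] u by auto
    have m: "brauer_up_mono t p = {}" using mono_up[of _ t p] u by auto
    show ?thesis by (rule exI[of _ "\<lambda>_. 0"]) (auto simp: u d m dest: free_on_empty)
  qed
  define y where "y t p = (SOME Y. ?Q t p Y)" for t p
  have y: "?Q t p (y t p)" for t p unfolding y_def by (rule someI_ex[OF ex])
  have "dual_bases \<delta> y" by unfold_locales (use y in \<open>auto\<close>)
  then show ?thesis by (rule that)
qed

section \<open>From a bimodule isomorphism to an invertible Gram matrix\<close>

lemma bimodule_isoE:
  assumes "bimodule_iso H M N"
  obtains \<phi> where "\<And>p q. bij_betw (\<phi> p q) (elts M p q) (elts N p q)"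
    "\<And>p q x y. x \<in> elts M p q \<Longrightarrow> y \<in> elts M p q \<Longrightarrow>
      \<phi> p q (plus_m M p q x y) = plus_m N p q (\<phi> p q x) (\<phi> p q y)"
    "\<And>p q c x. x \<in> elts M p q \<Longrightarrow> \<phi> p q (scal_m M p q c x) = scal_m N p q c (\<phi> p q x)"
    "\<And>p q q' h x. h \<in> H q q' \<Longrightarrow> x \<in> elts M p q \<Longrightarrow>
      \<phi> p q' (lact M p q q' h x) = lact N p q q' h (\<phi> p q x)"
    "\<And>p' p q h x. h \<in> H p' p \<Longrightarrow> x \<in> elts M p q \<Longrightarrow>
      \<phi> p' q (ract M p' p q x h) = ract N p' p q (\<phi> p q x) h"
proof -
  from assms obtain \<phi> where
    "(\<forall>p q. bij_betw (\<phi> p q) (elts M p q) (elts N p q)) \<and>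
      (\<forall>p q. \<forall>x\<in>elts M p q. \<forall>y\<in>elts M p q.
        \<phi> p q (plus_m M p q x y) = plus_m N p q (\<phi> p q x) (\<phi> p q y)) \<and>
      (\<forall>p q c. \<forall>x\<in>elts M p q. \<phi> p q (scal_m M p q c x) = scal_m N p q c (\<phi> p q x)) \<and>
      (\<forall>p q q'. \<forall>h\<in>H q q'. \<forall>x\<in>elts M p q.
        \<phi> p q' (lact M p q q' h x) = lact N p q q' h (\<phi> p q x)) \<and>
      (\<forall>p' p q. \<forall>h\<in>H p' p. \<forall>x\<in>elts M p q.
        \<phi> p' q (ract M p' p q x h) = ract N p' p q (\<phi> p q x) h)"
    unfolding bimodule_iso_def by (rule exE)
  then show ?thesis by (intro that[of \<phi>]) simp_all
qed

lemma tensor_over_S_iso_imp_non_singular: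
  fixes \<delta> :: "'k::comm_ring_1"
  assumes "bimodule_iso hom_B (plus_minus \<delta>) (B_bimodule \<delta>)"
  shows "non_singular \<delta>"
proof -
  obtain \<phi> where bij: "\<And>p q. bij_betw (\<phi> p q) (elts (plus_minus \<delta>) p q) (hom_B p q)"
    and add: "\<And>p q x y. x \<in> elts (plus_minus \<delta>) p q \<Longrightarrow> y \<in> elts (plus_minus \<delta>) p q \<Longrightarrow>
      \<phi> p q (plus_m (plus_minus \<delta>) p q x y) = \<phi> p q x + \<phi> p q y"
    and scal: "\<And>p q c x. x \<in> elts (plus_minus \<delta>) p q \<Longrightarrow> \<phi> p q (scal_m (plus_minus \<delta>) p q c x) = scal c (\<phi> p q x)"
    and lact: "\<And>p q q' h x. h \<in> hom_B q q' \<Longrightarrow> x \<in> elts (plus_minus \<delta>) p q \<Longrightarrow>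
      \<phi> p q' (lact (plus_minus \<delta>) p q q' h x) = comp \<delta> h (\<phi> p q x)"
    and ract: "\<And>p' p q h x. h \<in> hom_B p' p \<Longrightarrow> x \<in> elts (plus_minus \<delta>) p q \<Longrightarrow>
      \<phi> p' q (ract (plus_minus \<delta>) p' p q x h) = comp \<delta> (\<phi> p q x) h"
    by (rule bimodule_isoE[OF assms, unfolded B_bimodule_simps]) (rule that)
  define \<psi> where "\<psi> p q x = \<phi> p q (x +o plus_minus_ker \<delta> p q)" for p q x
  let ?G = "plus_minus_gens \<delta>"
  have el: "x +o plus_minus_ker \<delta> p q \<in> elts (plus_minus \<delta>) p q" if "x \<in> free_on (?G p q)" for x p q
    unfolding elts_tensor using that by (rule imageI)
  have \<psi>_add: "\<psi> p q (x + y) = \<psi> p q x + \<psi> p q y" if "x \<in> free_on (?G p q)" "y \<in> free_on (?G p q)" for p q x y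
    using add[OF el[OF that(1)] el[OF that(2)]] by (simp add: \<psi>_def plus_tensor)
  have \<psi>_scal: "\<psi> p q (scal c x) = scal c (\<psi> p q x)" if "x \<in> free_on (?G p q)" for p q c x
    using scal[OF el[OF that], of c] by (simp add: \<psi>_def scal_tensor)
  have \<psi>_0: "\<psi> p q 0 = 0" for p q using \<psi>_scal[OF free_on_0, of p q 0] by simp
  have \<psi>_hom: "\<psi> p q x \<in> hom_B p q" if "x \<in> free_on (?G p q)" for p q x
    unfolding \<psi>_def using bij_betw_apply[OF bij el[OF that]] .
  have gens: "gen (s, m, n) \<in> free_on (?G p q)" if "m \<in> Up s q" "n \<in> Dn p s" for s m n p q
    using that by (intro free_on_gen) (simp add: tensor_gens_def)
  define w where "w s = \<psi> s s (gen (s, idm s, idm s))" for s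
  have w_hom: "w s \<in> hom_B s s" for s unfolding w_def by (rule \<psi>_hom[OF gens[OF one_Up one_Dn]])
  have right1: "comp \<delta> (\<psi> s q (gen (s, m, idm s))) n = \<psi> p q (gen (s, m, dnw n))"
    if m: "m \<in> Up s q" and n: "n \<in> hom_B p s" for s p q m n
    using ract[OF n el[OF gens[OF m one_Dn]]]
    by (simp add: \<psi>_def ract_plus_minus[OF n] one_comp[OF n])
  have left1: "\<psi> s q (gen (s, m, idm s)) = comp \<delta> m (w s)" if m: "m \<in> Up s q" for s q m
    using lact[OF Up_hom[OF m] el[OF gens[OF one_Up one_Dn]]]
    by (simp add: \<psi>_def w_def lact_plus_minus[OF Up_hom[OF m]] comp_one[OF Up_hom[OF m]] upw_id[OF m])
  have \<psi>_gen: "\<psi> p q (gen (s, m, n)) = comp \<delta> m (comp \<delta> (w s) n)"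
    if m: "m \<in> Up s q" and n: "n \<in> Dn p s" for p q s m n
    using right1[OF m Dn_hom[OF n]] left1[OF m] comp_assoc[OF Up_hom[OF m] w_hom Dn_hom[OF n], of \<delta>]
    by (simp add: dnw_id[OF n])
  \<comment> \<open>On 1 \<otimes> 1 the right actions of \<open>n\<close> and of its downward part
    agree already in the tensor product; their images under \<open>\<phi>\<close> are the two
    sides.\<close>
  have w_dnw: "comp \<delta> (w s) n = comp \<delta> (w s) (dnw n)" if n: "n \<in> hom_B p s" for p s n
    using right1[OF one_Up n] right1[OF one_Up Dn_hom[OF dnw_Dn[OF n]]]
    by (simp add: w_def[symmetric] dnw_id[OF dnw_Dn[OF n]])
  show ?thesis unfolding non_singular_iff
  proof (intro allI impI)
    fix t s
    let ?F = "brauer_up_mono t s" and ?L = "brauer_level t t"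
    \<comment> \<open>The condition says that \<open>a\<close> acts on upward morphisms from
      \<open>t\<close> to \<open>s\<close> through their pairings with the flipped monotone
      diagrams. It is stable under linear combinations, and for the identity it is the input of
      \<open>det_on_gram_unit\<close>.\<close>
    let ?P = "\<lambda>a. \<exists>v. (\<forall>h\<in>?F. v h \<in> Up t s) \<and> (\<forall>x\<in>Up t s. upw (comp \<delta> a x) = (\<Sum>h\<in>?F. comp \<delta> (v h) (pr \<delta> (gen (flip h)) x)))"
    have P0: "?P 0" by (rule exI[of _ "\<lambda>_. 0"]) simp
    have P_gen: "?P (comp \<delta> m (comp \<delta> (w r) n))" if m: "m \<in> Up r s" and n: "n \<in> Dn s r" for r m n
    proof -
      have eq: "upw (comp \<delta> (comp \<delta> m (comp \<delta> (w r) n)) x) = upw (comp \<delta> m (comp \<delta> (w r) (dnw (comp \<delta> n x))))"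
        if x: "x \<in> Up t s" for x
        using comp_assoc[OF Up_hom[OF m] comp_hom_B[OF w_hom Dn_hom[OF n]] Up_hom[OF x], of \<delta> \<delta>]
          comp_assoc[OF w_hom Dn_hom[OF n] Up_hom[OF x], of \<delta>] w_dnw[OF comp_hom_B[OF Dn_hom[OF n] Up_hom[OF x]], of \<delta>]
        by simp
      have d: "comp \<delta> n x \<in> hom_B t r" if "x \<in> Up t s" for x by (rule comp_hom_B[OF Dn_hom[OF n] Up_hom[OF that]])
      \<comment> \<open>Only the middle object \<open>t\<close> contributes: if
        \<open>t < r\<close>, the morphism \<open>n x\<close> has no downward part, and if
        \<open>r < t\<close>, the composite passes through too few points to be upward.\<close>
      consider "t < r" | "r < t" | "r = t" by linarith
      then show ?thesis
      proof cases
        case 1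
        have "upw (comp \<delta> (comp \<delta> m (comp \<delta> (w r) n)) x) = 0" if "x \<in> Up t s" for x
          using eq[OF that] Dn_zero[OF 1 dnw_Dn[OF d[OF that]]] by simp
        then show ?thesis by (intro exI[of _ "\<lambda>_. 0"]) simp
      next
        case 2
        have "upw (comp \<delta> (comp \<delta> m (comp \<delta> (w r) n)) x) = 0" if "x \<in> Up t s" for x
          unfolding eq[OF that]
          by (rule upw_comp_through[OF Up_hom[OF m] comp_hom_B[OF w_hom Dn_hom[OF dnw_Dn[OF d[OF that]]]] 2])
        then show ?thesis by (intro exI[of _ "\<lambda>_. 0"]) simp
      next
        case 3
        define z where "z = upw (w t)"
        have z: "z \<in> hom_S t t" unfolding z_def Up_square[symmetric] by (rule upw_Up[OF w_hom])
        define m' where "m' = comp \<delta> m z"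
        have mt: "m \<in> Up t s" and nt: "n \<in> Dn s t" using m n 3 by simp_all
        have m': "m' \<in> Up t s" unfolding m'_def by (rule comp_Up[OF mt hom_S_Up[OF z]])
        obtain c where c: "n = (\<Sum>j\<in>gram_index t s. scal (c j) (dbas j))" using dbas_span[OF nt] by auto
        \<comment> \<open>The coordinates of \<open>n\<close> in the downward basis, grouped by
          monotone diagram; the level factors \<open>flip \<sigma>\<close> are absorbed on the
          left.\<close>
        define v where "v h = (\<Sum>\<sigma>\<in>?L. scal (c (h, \<sigma>)) (comp \<delta> m' (gen (flip \<sigma>))))" for h
        have v: "v h \<in> Up t s" for h unfolding v_def
          by (intro free_on_sum free_on_scal comp_Up[OF m'] hom_S_Up[OF gen_level] flip_brauer_level)
        have "upw (comp \<delta> (comp \<delta> m (comp \<delta> (w r) n)) x) = (\<Sum>h\<in>?F. comp \<delta> (v h) (pr \<delta> (gen (flip h)) x))"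
          if x: "x \<in> Up t s" for x
        proof -
          have p: "pr \<delta> n x \<in> hom_S t t" by (rule pr_hom_S[OF nt x])
          have "upw (comp \<delta> (comp \<delta> m (comp \<delta> (w r) n)) x) = upw (comp \<delta> m (comp \<delta> (w t) (pr \<delta> n x)))"
            using eq[OF x] dnw_square[OF d[OF x, unfolded 3]] by (simp add: 3)
          also have "\<dots> = comp \<delta> m (comp \<delta> z (pr \<delta> n x))"
            by (simp add: upw_comp_Up[OF mt comp_hom_B[OF w_hom hom_S_hom[OF p]]] upw_comp_endo[OF w_hom p] z_def)
          also have "\<dots> = comp \<delta> m' (pr \<delta> n x)"
            unfolding m'_def by (rule comp_assoc[OF Up_hom[OF mt] hom_S_hom[OF z] hom_S_hom[OF p], symmetric])
          also have "\<dots> = (\<Sum>j\<in>gram_index t s. scal (c j) (comp \<delta> m' (pr \<delta> (dbas j) x)))"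
            by (simp add: c)
          also have "\<dots> = (\<Sum>h\<in>?F. \<Sum>\<sigma>\<in>?L. scal (c (h, \<sigma>)) (comp \<delta> m' (pr \<delta> (dbas (h, \<sigma>)) x)))"
            unfolding gram_index_def by (simp add: sum.cartesian_product case_prod_unfold)
          also have "\<dots> = (\<Sum>h\<in>?F. comp \<delta> (v h) (pr \<delta> (gen (flip h)) x))"
          proof (rule sum.cong[OF refl])
            fix h assume h: "h \<in> ?F"
            have "comp \<delta> m' (pr \<delta> (dbas (h, \<sigma>)) x) = comp \<delta> (comp \<delta> m' (gen (flip \<sigma>))) (pr \<delta> (gen (flip h)) x)"
              if \<sigma>: "\<sigma> \<in> ?L" for \<sigma>
            proof -
              note fh = gen_flip_dn[OF h] and fs = gen_level[OF flip_brauer_level[OF \<sigma>]]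
              have i: "(h, \<sigma>) \<in> gram_index t s" using h \<sigma> by (simp add: gram_index_def)
              show ?thesis
                by (simp add: dbas_comp[OF i, of \<delta>] pr_comp_left[OF fh x fs]
                    comp_assoc[OF Up_hom[OF m'] hom_S_hom[OF fs] hom_S_hom[OF pr_hom_S[OF fh x]]])
            qed
            then show "(\<Sum>\<sigma>\<in>?L. scal (c (h, \<sigma>)) (comp \<delta> m' (pr \<delta> (dbas (h, \<sigma>)) x))) =
              comp \<delta> (v h) (pr \<delta> (gen (flip h)) x)" by (simp add: v_def)
          qed
          finally show ?thesis .
        qed
        with v show ?thesis by (intro exI[of _ v]) simp
      qed
    qed
    have P_\<psi>: "x \<in> free_on (?G s s) \<and> ?P (\<psi> s s x)" if "x \<in> free_on (?G s s)" for x
      using that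
    proof (induction rule: free_on_induct)
      case zero
      show ?case using P0 by (simp add: \<psi>_0)
    next
      case (gen a)
      then obtain r m n where a: "a = (r, m, n)" "m \<in> Up r s" "n \<in> Dn s r"
        by (cases a) (auto simp: tensor_gens_def)
      show ?case using P_gen[OF a(2,3)] free_on_gen[OF gen] by (simp add: a(1) \<psi>_gen[OF a(2,3)])
    next
      case (add a b)
      then obtain v v' where "\<forall>h\<in>?F. v h \<in> Up t s" "\<forall>h\<in>?F. v' h \<in> Up t s"
        "\<forall>x\<in>Up t s. upw (comp \<delta> (\<psi> s s a) x) = (\<Sum>h\<in>?F. comp \<delta> (v h) (pr \<delta> (gen (flip h)) x))"
        "\<forall>x\<in>Up t s. upw (comp \<delta> (\<psi> s s b) x) = (\<Sum>h\<in>?F. comp \<delta> (v' h) (pr \<delta> (gen (flip h)) x))"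
        by auto
      then have "?P (\<psi> s s a + \<psi> s s b)"
        by (intro exI[of _ "\<lambda>h. v h + v' h"]) (simp add: free_on_add sum.distrib)
      then show ?case using add by (simp add: \<psi>_add free_on_add)
    next
      case (scal k a)
      then obtain v where "\<forall>h\<in>?F. v h \<in> Up t s"
        "\<forall>x\<in>Up t s. upw (comp \<delta> (\<psi> s s a) x) = (\<Sum>h\<in>?F. comp \<delta> (v h) (pr \<delta> (gen (flip h)) x))"
        by auto
      then have "?P (scal k (\<psi> s s a))"
        by (intro exI[of _ "\<lambda>h. scal k (v h)"]) (simp add: free_on_scal scal_sum)
      then show ?case using scal by (simp add: \<psi>_scal free_on_scal)
    qed
    \<comment> \<open>Surjectivity of the isomorphism is used only here, to express the identity of
      \<open>s\<close> by elements \<open>m w n\<close>.\<close>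
    obtain X where X: "X \<in> elts (plus_minus \<delta>) s s" "\<phi> s s X = idm s"
    proof -
      have "idm s \<in> \<phi> s s ` elts (plus_minus \<delta>) s s" using bij[of s s] one_hom[of s] by (simp add: bij_betw_def)
      then show ?thesis using that by (elim imageE) simp
    qed
    then obtain x where x: "x \<in> free_on (?G s s)" "\<psi> s s x = idm s"
      unfolding elts_tensor \<psi>_def by auto
    obtain v where v: "\<And>h. h \<in> ?F \<Longrightarrow> v h \<in> Up t s"
      "\<And>x. x \<in> Up t s \<Longrightarrow> upw (comp \<delta> (idm s) x) = (\<Sum>h\<in>?F. comp \<delta> (v h) (pr \<delta> (gen (flip h)) x))"
      using P_\<psi>[OF x(1)] unfolding x(2) by auto
    show "det_on (gram_index t s) (gram \<delta>) dvd 1"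
    proof (rule det_on_gram_unit[OF v(1)])
      fix x :: "'k morphism" assume x: "x \<in> Up t s"
      show "x = (\<Sum>h\<in>?F. comp \<delta> (v h) (pr \<delta> (gen (flip h)) x))"
        using v(2)[OF x] by (simp add: one_comp[OF Up_hom[OF x]] upw_id[OF x])
    qed
  qed
qed

theorem theorem8p12:
  fixes \<delta> :: "'k::comm_ring_1"
  shows "gives_morita_equivalence \<delta> \<longleftrightarrow> non_singular \<delta>"
proof
  assume "gives_morita_equivalence \<delta>"
  then show "non_singular \<delta>"
    unfolding gives_morita_equivalence_def using tensor_over_S_iso_imp_non_singular by auto
next
  assume "non_singular \<delta>"
  then obtain y where "dual_bases \<delta> y" by (rule non_singular_dual_bases)
  then interpret dual_bases \<delta> y .
  show "gives_morita_equivalence \<delta>"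
    unfolding gives_morita_equivalence_def using tensor_over_S_iso tensor_over_B_iso by auto
qed

end
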